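(* For any coloring sequence $\alpha=(\alpha_1,\ldots,\alpha_\ell)$ of (even) length $\ell\geq 10$, the graph $\mathcal{F}_\alpha$ has a Hamilton cycle.
   Context: A coloring sequence is a sequence $\alpha=(\alpha_1,\ldots,\alpha_\ell)$ of even length $\ell\geq 2$ of integers $\alpha_i\geq 1$; set $N=\sum_{i=1}^\ell\alpha_i$. Label the points of a convex $N$-gon $1,\ldots,N$ counterclockwise and color them according to the pattern $\mathrm{red}^{\alpha_1}\mathrm{blue}^{\alpha_2}\mathrm{red}^{\alpha_3}\cdots\mathrm{red}^{\alpha_{\ell-1}}\mathrm{blue}^{\alpha_\ell}$ (the first $\alpha_1$ points red, the next $\alpha_2$ blue, the next $\alpha_3$ red, etc.). The associahedron $\mathcal{G}_N$ is the graph whose nodes are all triangulations of the convex $N$-gon, two being adjacent if they differ in a flip (removing a diagonal shared by two triangles and replacing it by the other diagonal of the resulting quadrilateral). A triangulation is colorful if no triangle has all three points of the same color. $\mathcal{F}_\alpha$ is the subgraph of $\mathcal{G}_N$ induced by the colorful triangulations. *)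

theory Defs
  imports "Graph_Theory.Graph_Theory"
begin

datatype color = Red | Blue

definition coloring_sequence :: "nat list \<Rightarrow> bool" where
  "coloring_sequence \<alpha> \<longleftrightarrow>
     even (length \<alpha>) \<and> 2 \<le> length \<alpha> \<and> (\<forall>a\<in>set \<alpha>. 1 \<le> a)"

(* List indices start at 0, so the even indices are the odd positions of the sequence. *)
definition color_word :: "nat list \<Rightarrow> color list" where
  "color_word \<alpha> =
     concat (map (\<lambda>i. replicate (\<alpha> ! i) (if even i then Red else Blue)) [0..<length \<alpha>])"

definition point_color :: "nat list \<Rightarrow> nat \<Rightarrow> color" where
  "point_color \<alpha> p = color_word \<alpha> ! (p - 1)"

(* The points of the convex N-gon are 1, ..., N in counterclockwise order; a segment is the
   set of its two end points, a triangle the set of its three corners. *)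
definition sides :: "nat \<Rightarrow> nat set set" where
  "sides N = {{i, i + 1} |i. 1 \<le> i \<and> i < N} \<union> {{N, 1}}"

definition diagonals :: "nat \<Rightarrow> nat set set" where
  "diagonals N = {{i, j} |i j. i \<in> {1..N} \<and> j \<in> {1..N} \<and> i \<noteq> j} - sides N"

(* Segments between points in convex position cross in their interiors iff their end points
   alternate along the polygon. *)
definition crossing :: "nat set \<Rightarrow> nat set \<Rightarrow> bool" where
  "crossing e f \<longleftrightarrow>
     (\<exists>a b c d. a < b \<and> b < c \<and> c < d \<and>
        (e = {a, c} \<and> f = {b, d} \<or> e = {b, d} \<and> f = {a, c}))"

(* A triangulation is identified with its set of diagonals: an inclusion-maximal set of
   pairwise non-crossing diagonals. *)
definition triangulation :: "nat \<Rightarrow> nat set set \<Rightarrow> bool" where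
  "triangulation N T \<longleftrightarrow>
     T \<subseteq> diagonals N \<and>
     (\<forall>e\<in>T. \<forall>f\<in>T. \<not> crossing e f) \<and>
     (\<forall>e\<in>diagonals N - T. \<exists>f\<in>T. crossing e f)"

(* In convex position every 3-cycle of pairwise non-crossing segments bounds a face. *)
definition triangles :: "nat \<Rightarrow> nat set set \<Rightarrow> nat set set" where
  "triangles N T =
     {{a, b, c} |a b c. a < b \<and> b < c \<and>
        {a, b} \<in> sides N \<union> T \<and> {b, c} \<in> sides N \<union> T \<and> {a, c} \<in> sides N \<union> T}"

definition flip :: "nat \<Rightarrow> nat set set \<Rightarrow> nat set set \<Rightarrow> bool" where
  "flip N T T' \<longleftrightarrow>
     (\<exists>a b c d. distinct [a, b, c, d] \<and> {a, c} \<in> T \<and>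
        {a, b, c} \<in> triangles N T \<and> {a, c, d} \<in> triangles N T \<and>
        T' = (T - {{a, c}}) \<union> {{b, d}})"

(* Undirected graphs are represented, as usual in Graph_Theory, by digraphs with a symmetric
   arc relation; flips are reversible. *)
definition associahedron :: "nat \<Rightarrow> nat set set pair_pre_digraph" where
  "associahedron N =
     \<lparr> pverts = {T. triangulation N T},
       parcs = {(T, T'). triangulation N T \<and> triangulation N T' \<and> flip N T T'} \<rparr>"

definition colorful :: "nat list \<Rightarrow> nat set set \<Rightarrow> bool" where
  "colorful \<alpha> T \<longleftrightarrow>
     (\<forall>t\<in>triangles (sum_list \<alpha>) T. \<not> (\<exists>x. \<forall>p\<in>t. point_color \<alpha> p = x))"

definition colorful_flip_graph ::
    "nat list \<Rightarrow> (nat set set, nat set set \<times> nat set set) pre_digraph" where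
  "colorful_flip_graph \<alpha> =
     with_proj (associahedron (sum_list \<alpha>)) \<restriction>
       {T. triangulation (sum_list \<alpha>) T \<and> colorful \<alpha> T}"

(* Cycles of Graph_Theory may traverse an edge back and forth, since its two orientations are
   different arcs; the length bound excludes this. The tails of the arcs of a cycle are the
   vertices that it visits. *)
definition hamilton_cycle :: "('a, 'b) pre_digraph \<Rightarrow> 'b list \<Rightarrow> bool" where
  "hamilton_cycle G p \<longleftrightarrow>
     pre_digraph.cycle G p \<and> 3 \<le> length p \<and> tail G ` set p = verts G"

end

theory Submission
  imports Defs
begin

text \<open>Forgetting the monochromatic diagonals of a colorful triangulation leaves a dissection into
  triangles and \<open>l div 2 - 1\<close> quadrilaterals, where \<open>l\<close> is the length of the coloring sequence. The
  colorful triangulations with a given dissection form a hypercube of dimension at least four, one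
  coordinate per quadrilateral, and a flip of a bichromatic diagonal matches subcubes of codimension
  at most two in the hypercubes of two dissections.

  The graph of dissections has a spanning tree in which every vertex has at most two children. For
  alternating colors it is built by adding one quadrilateral at a time. Then the color classes are
  enlarged one after the other, always the last one before the root side, rotating the polygon in
  between. In both steps the new dissections are grouped into small trees over the old ones, and
  these are joined at their ends.

  Going up this tree, the Hamilton cycles of the hypercubes are merged: inside a hypercube of
  dimension at least four there is a Hamilton cycle through the edge prescribed by the parent and
  through two further edges, one in each subcube matched to a child.\<close>

section \<open>Colorful triangulations as labelled trees\<close>

text \<open>A bichromatic diagonal borders at most two quadrilaterals, and flipping it is legal only
  for prescribed values of their bits; hence the codimension two. Two cycles are merged by trading
  one edge of each for the two flips that join their ends. So the cycle in the cube of a tree vertex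
  needs, besides the edge prescribed by the parent, one edge per child, inside the matched subcube
  and in a direction that the flip leaves free. Dimension four, which is what length ten provides,
  leaves room for two such edges even if the two subcubes together fix all coordinates. The real
  constraint is therefore the degree of the tree: replacing every old vertex by a group of new ones
  must not raise it. This is why each group has two distinguished ends that vary compatibly with
  flips of the old vertex: the old neighbors can be distributed over both. Since the parent may use
  either end, the inductions over the old tree prove the versions with either end as root together.
  Runs are inserted only at the end of the word because right triangles move freely along the right
  spine; rotation brings the other color classes to this place.\<close>

text \<open>Cut a colorful triangulation along its bichromatic diagonals. The pieces are triangles on a
  monochromatic side of the polygon and quadrilaterals split by a monochromatic diagonal. Rooted at
  the side from the last to the first point, this is a tree: \<open>Side\<close> is a bichromatic side of the
  polygon, \<open>LTri\<close> and \<open>RTri\<close> are triangles whose monochromatic side is the leftmost or the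
  rightmost one, and \<open>Quad\<close> carries a label, which is later the bit telling the two monochromatic
  diagonals apart.\<close>

datatype 'a ctree =
    Side
  | LTri "'a ctree"
  | RTri "'a ctree"
  | Quad 'a "'a ctree" "'a ctree" "'a ctree"

text \<open>The non-root sides of the polygon from left to right, \<open>True\<close> meaning monochromatic.\<close>

fun word :: "'a ctree \<Rightarrow> bool list" where
  "word Side = [False]"
| "word (LTri t) = True # word t"
| "word (RTri t) = word t @ [True]"
| "word (Quad x a b c) = word a @ word b @ word c"

text \<open>Flips of a bichromatic diagonal. The list records for each quadrilateral at that diagonal the bit
  that makes the flip legal and the bit that the quadrilateral has afterwards.\<close>

inductive move :: "'a ctree \<Rightarrow> ('a \<times> bool \<times> bool) list \<Rightarrow> 'a ctree \<Rightarrow> bool" where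
  LR: "move (LTri (RTri t)) [] (RTri (LTri t))"
| LQ: "move (LTri (Quad x a b c)) [(x, True, True)] (Quad x (LTri a) b c)"
| RQ: "move (RTri (Quad x a b c)) [(x, False, False)] (Quad x a b (RTri c))"
| Q12: "move (Quad x (RTri a) b c) [(x, False, False)] (Quad x a (LTri b) c)"
| Q23: "move (Quad x a (RTri b) c) [(x, True, True)] (Quad x a b (LTri c))"
| QQ12: "move (Quad x (Quad y a b c) d e) [(x, False, False), (y, True, False)]
    (Quad x a (Quad y b c d) e)"
| QQ13: "move (Quad x (Quad y a b c) d e) [(x, True, False), (y, False, True)]
    (Quad x a b (Quad y c d e))"
| QQ23: "move (Quad x a (Quad y b c d) e) [(x, True, True), (y, True, False)]
    (Quad x a b (Quad y c d e))"
| sym: "move s K t \<Longrightarrow> move t (map (\<lambda>(x, i, j). (x, j, i)) K) s"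
| in_LTri: "move s K t \<Longrightarrow> move (LTri s) K (LTri t)"
| in_RTri: "move s K t \<Longrightarrow> move (RTri s) K (RTri t)"
| in_Quad1: "move s K t \<Longrightarrow> move (Quad x s b c) K (Quad x t b c)"
| in_Quad2: "move s K t \<Longrightarrow> move (Quad x a s c) K (Quad x a t c)"
| in_Quad3: "move s K t \<Longrightarrow> move (Quad x a b s) K (Quad x a b t)"

type_synonym shape = "unit ctree"

definition adj :: "shape \<Rightarrow> shape \<Rightarrow> bool" where
  "adj s t \<longleftrightarrow> (\<exists>K. move s K t)"

lemma adj_sym: "adj s t \<Longrightarrow> adj t s"
  unfolding adj_def by (blast intro: move.sym)

lemma adj_rules:
  "adj (LTri (RTri t)) (RTri (LTri t))"
  "adj (LTri (Quad x a b c)) (Quad x (LTri a) b c)"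
  "adj (RTri (Quad x a b c)) (Quad x a b (RTri c))"
  "adj (Quad x (RTri a) b c) (Quad x a (LTri b) c)"
  "adj (Quad x a (RTri b) c) (Quad x a b (LTri c))"
  "adj (Quad x (Quad y a b c) d e) (Quad x a (Quad y b c d) e)"
  "adj (Quad x (Quad y a b c) d e) (Quad x a b (Quad y c d e))"
  "adj (Quad x a (Quad y b c d) e) (Quad x a b (Quad y c d e))"
  unfolding adj_def by (blast intro: move.intros)+

lemma adj_context:
  assumes "adj s t"
  shows "adj (LTri s) (LTri t)" "adj (RTri s) (RTri t)" "adj (Quad x s b c) (Quad x t b c)"
    "adj (Quad x a s c) (Quad x a t c)" "adj (Quad x a b s) (Quad x a b t)"
  using assms unfolding adj_def by (blast intro: move.intros)+

text \<open>Rule induction on \<open>move\<close> with the bit lists projected away: in the graph of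
  dissections only the existence of a move counts. The bits come back when the cubes are
  glued.\<close>

lemma adj_induct [consumes 1, case_names sym LR LQ RQ Q12 Q23 QQ12 QQ13 QQ23 L R Q1 Q2 Q3]:
  assumes "adj s t"
    and "\<And>s t. adj s t \<Longrightarrow> P s t \<Longrightarrow> P t s"
    and "\<And>t. P (LTri (RTri t)) (RTri (LTri t))"
    and "\<And>x a b c. P (LTri (Quad x a b c)) (Quad x (LTri a) b c)"
    and "\<And>x a b c. P (RTri (Quad x a b c)) (Quad x a b (RTri c))"
    and "\<And>x a b c. P (Quad x (RTri a) b c) (Quad x a (LTri b) c)"
    and "\<And>x a b c. P (Quad x a (RTri b) c) (Quad x a b (LTri c))"
    and "\<And>x y a b c d e. P (Quad x (Quad y a b c) d e) (Quad x a (Quad y b c d) e)"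
    and "\<And>x y a b c d e. P (Quad x (Quad y a b c) d e) (Quad x a b (Quad y c d e))"
    and "\<And>x y a b c d e. P (Quad x a (Quad y b c d) e) (Quad x a b (Quad y c d e))"
    and "\<And>s t. adj s t \<Longrightarrow> P s t \<Longrightarrow> P (LTri s) (LTri t)"
    and "\<And>s t. adj s t \<Longrightarrow> P s t \<Longrightarrow> P (RTri s) (RTri t)"
    and "\<And>s t x b c. adj s t \<Longrightarrow> P s t \<Longrightarrow> P (Quad x s b c) (Quad x t b c)"
    and "\<And>s t x a c. adj s t \<Longrightarrow> P s t \<Longrightarrow> P (Quad x a s c) (Quad x a t c)"
    and "\<And>s t x a b. adj s t \<Longrightarrow> P s t \<Longrightarrow> P (Quad x a b s) (Quad x a b t)"
  shows "P s t"
proof -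
  from assms(1) obtain K where "move s K t" unfolding adj_def by blast
  then have "adj s t \<and> P s t"
  proof induction
    case (sym s K t)
    then show ?case by (blast intro: adj_sym assms(2))
  qed (auto intro: assms(3-) adj_rules adj_context)
  then show ?thesis ..
qed

lemma word_adj: "adj s t \<Longrightarrow> word s = word t"
  by (induction rule: adj_induct) auto

section \<open>Binary arborescences\<close>

text \<open>\<open>arb R a V\<close>: a spanning tree of \<open>V\<close> with root \<open>a\<close> and at most two children per vertex;
  \<open>att R a V\<close>: such a tree, or nothing, that can be hung below \<open>a\<close>.\<close>

inductive arb :: "('a \<Rightarrow> 'a \<Rightarrow> bool) \<Rightarrow> 'a \<Rightarrow> 'a set \<Rightarrow> bool"
  and att :: "('a \<Rightarrow> 'a \<Rightarrow> bool) \<Rightarrow> 'a \<Rightarrow> 'a set \<Rightarrow> bool"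
  for R where
  arb_node: "att R a V \<Longrightarrow> att R a W \<Longrightarrow> a \<notin> V \<Longrightarrow> a \<notin> W \<Longrightarrow> V \<inter> W = {} \<Longrightarrow>
    arb R a (insert a (V \<union> W))"
| att_empty: "att R a {}"
| att_arb: "R a b \<Longrightarrow> arb R b V \<Longrightarrow> att R a V"

lemma arbI:
  "att R a V \<Longrightarrow> att R a W \<Longrightarrow> a \<notin> V \<Longrightarrow> a \<notin> W \<Longrightarrow> V \<inter> W = {} \<Longrightarrow> X = insert a (V \<union> W) \<Longrightarrow>
    arb R a X"
  by (simp add: arb_node)

lemma arb_singleton: "arb R a {a}"
  by (rule arbI[OF att_empty att_empty]) auto

lemma arb_root: "arb R a V \<Longrightarrow> a \<in> V"
  by (cases rule: arb.cases) auto

lemma arb_image: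
  assumes "arb R a V" "inj_on f U" "V \<subseteq> U"
    and "\<And>x y. R x y \<Longrightarrow> x \<in> U \<Longrightarrow> y \<in> U \<Longrightarrow> R' (f x) (f y)"
  shows "arb R' (f a) (f ` V)"
proof -
  have "arb R a V \<Longrightarrow> V \<subseteq> U \<Longrightarrow> arb R' (f a) (f ` V)"
    and "att R a V \<Longrightarrow> a \<in> U \<Longrightarrow> V \<subseteq> U \<Longrightarrow> att R' (f a) (f ` V)" for a V
  proof (induction rule: arb_att.inducts)
    case (arb_node a V W)
    then have U: "a \<in> U" "V \<subseteq> U" "W \<subseteq> U" by auto
    show ?case
    proof (rule arbI)
      show "att R' (f a) (f ` V)" "att R' (f a) (f ` W)" using arb_node U by auto
      show "f a \<notin> f ` V" "f a \<notin> f ` W"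
        using arb_node(5,6) U assms(2) by (auto simp: inj_on_def)
      show "f ` V \<inter> f ` W = {}"
        using arb_node(7) U assms(2) by (metis image_empty inj_on_image_Int)
    qed auto
  next
    case (att_empty a) then show ?case by (simp add: arb_att.att_empty)
  next
    case (att_arb a b V)
    then have "b \<in> V" by (blast intro: arb_root)
    with att_arb show ?case by (blast intro: arb_att.att_arb assms(4))
  qed
  with assms(1,3) show ?thesis by blast
qed

section \<open>Right spines and the contexts around them\<close>

definition ctx :: "(shape \<Rightarrow> shape) \<Rightarrow> bool" where
  "ctx C \<longleftrightarrow> inj C \<and> (\<forall>s t. adj s t \<longrightarrow> adj (C s) (C t))"

lemma ctx_id: "ctx id" by (simp add: ctx_def)

lemma ctx_comp: "ctx C \<Longrightarrow> ctx D \<Longrightarrow> ctx (C \<circ> D)"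
  by (simp add: ctx_def inj_compose)

lemmas ctx_comp' = ctx_comp[unfolded comp_def]

lemma ctx_RTri: "ctx RTri" by (auto simp: ctx_def inj_def intro: adj_context)

lemma ctx_adj: "ctx C \<Longrightarrow> adj s t \<Longrightarrow> adj (C s) (C t)" by (simp add: ctx_def)

lemma ctx_eq: "ctx C \<Longrightarrow> C s = C t \<longleftrightarrow> s = t" by (auto simp: ctx_def inj_def)

text \<open>The letters of a right spine other than \<open>RTri\<close>. By
  \<open>frame_RTri\<close> they commute with \<open>RTri\<close> up to a flip, so inserting right
  triangles is a shuffle of words; a \<open>ctx\<close> collects the letters already read.\<close>

inductive frame :: "(shape \<Rightarrow> shape) \<Rightarrow> bool" where
  "frame LTri"
| "frame (Quad x a b)"

lemma ctx_frame: "frame f \<Longrightarrow> ctx f"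
  by (auto simp: ctx_def inj_def elim!: frame.cases intro: adj_context)

lemma frame_RTri: "frame f \<Longrightarrow> adj (RTri (f s)) (f (RTri s))"
  by (cases rule: frame.cases) (auto intro: adj_rules adj_sym)

lemma frame_neq: "frame f \<Longrightarrow> f s \<noteq> RTri t" "frame f \<Longrightarrow> f s \<noteq> Side"
  by (auto elim: frame.cases)

inductive rs :: "shape \<Rightarrow> bool" where
  rs_Side: "rs Side"
| rs_frame: "frame f \<Longrightarrow> rs u \<Longrightarrow> rs (f u)"

lemma word_not_Nil [simp]: "word t \<noteq> []" by (induction t) auto

lemma last_frame: "frame f \<Longrightarrow> last (word (f u)) = last (word u)"
  by (auto elim!: frame.cases)

text \<open>A right triangle anywhere on the right spine makes the last side of the word
  monochromatic, so this syntactic condition depends on the word alone.\<close>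

lemma rs_iff: "rs t \<longleftrightarrow> \<not> last (word t)"
proof
  show "rs t \<Longrightarrow> \<not> last (word t)" by (induction rule: rs.induct) (auto simp: last_frame)
  show "\<not> last (word t) \<Longrightarrow> rs t"
    by (induction t) (auto intro: rs.intros frame.intros rs_frame[of LTri] rs_frame[of
      "Quad _ _ _"])
qed

fun ap :: "shape \<Rightarrow> shape \<Rightarrow> shape" where
  "ap z Side = z"
| "ap z (LTri u) = LTri (ap z u)"
| "ap z (RTri u) = RTri (ap z u)"
| "ap z (Quad x a b u) = Quad x a b (ap z u)"

lemma ap_frame: "frame f \<Longrightarrow> ap z (f u) = f (ap z u)"
  by (auto elim!: frame.cases)

text \<open>Makes the innermost end of a group vary compatibly with flips of the base shape, as the
  context rules do for the outermost end.\<close>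

lemma adj_ap: "adj s t \<Longrightarrow> adj (ap z s) (ap z t)"
  by (induction rule: adj_induct) (auto intro: adj_rules adj_context adj_sym)

section \<open>Insertion of a monochromatic run\<close>

text \<open>All interleavings of the right spine with \<open>a\<close> right triangles.\<close>

fun ins :: "nat \<Rightarrow> shape \<Rightarrow> shape set" where
  "ins 0 t = {t}"
| "ins (Suc a) Side = {(RTri ^^ Suc a) Side}"
| "ins (Suc a) (LTri u) = RTri ` ins a (LTri u) \<union> LTri ` ins (Suc a) u"
| "ins (Suc a) (Quad x p q u) = RTri ` ins a (Quad x p q u) \<union> Quad x p q ` ins (Suc a) u"
| "ins (Suc a) (RTri u) = {}"

lemma ins_Side: "ins a Side = {(RTri ^^ a) Side}" by (cases a) auto

lemma ins_frame: "frame f \<Longrightarrow> ins (Suc a) (f u) = RTri ` ins a (f u) \<union> f ` ins (Suc a) u"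
  by (auto elim!: frame.cases)

lemma ctx_funpow: "ctx C \<Longrightarrow> ctx (C ^^ n)"
  by (induction n) (auto intro: ctx_comp ctx_id)

definition slots :: "'a set \<Rightarrow> 'a set list \<Rightarrow> bool" where
  "slots V Ws \<longleftrightarrow> (\<forall>W \<in> set Ws. V \<inter> W = {}) \<and> sorted_wrt (\<lambda>A B. A \<inter> B = {}) Ws"

text \<open>Both arborescences split the interleavings according to their outermost letter; the third
  open slot is what makes this recursion close.\<close>

lemma arb_ins_outer:
  assumes "rs u" "frame f" "ctx C"
    and "att adj (C ((RTri ^^ Suc a) (f u))) W0"
    and "att adj (C (f (ap ((RTri ^^ Suc a) Side) u))) W1"
    and "att adj (C (f ((RTri ^^ Suc a) u))) W2"
    and "slots (C ` ins (Suc a) (f u)) [W0, W1, W2]"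
  shows "arb adj (C ((RTri ^^ Suc a) (f u))) (C ` ins (Suc a) (f u) \<union> W0 \<union> W1 \<union> W2)"
  using assms
proof (induction u arbitrary: f C a W0 W1 W2 rule: rs.induct)
  case (rs_Side f C a W0 W1 W2)
  then show ?case
  proof (induction a arbitrary: C W0 W1 W2)
    case 0
    let ?B = "insert (C (f (RTri Side))) (W2 \<union> W1)"
    have B: "arb adj (C (f (RTri Side))) ?B"
      using 0 by (intro arbI[of _ _ W2 W1]) (auto simp: slots_def ins_frame)
    have "adj (C (RTri (f Side))) (C (f (RTri Side)))"
      using 0 by (auto intro: ctx_adj frame_RTri)
    with B have "att adj (C (RTri (f Side))) ?B" by (rule att_arb[rotated])
    then show ?case
      using 0 by (intro arbI[of _ _ W0 ?B]) (auto simp: slots_def ins_frame ctx_eq frame_neq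
        frame_neq[symmetric])
  next
    case (Suc a)
    let ?r = "(RTri ^^ Suc (Suc a)) Side"
    \<comment> \<open>Below \<open>f\<close> only one shape is possible here, so the slots of
      \<open>W1\<close> and \<open>W2\<close> coincide at it. It hangs at the third slot of the
      class with outermost letter \<open>RTri\<close>.\<close>
    let ?B = "insert (C (f ?r)) (W2 \<union> W1)"
    have B: "arb adj (C (f ?r)) ?B"
      using Suc.prems by (intro arbI[of _ _ W2 W1]) (auto simp: slots_def ins_frame)
    have "adj (C (RTri (f ((RTri ^^ Suc a) Side)))) (C (f ?r))"
      using Suc.prems by (auto intro: ctx_adj frame_RTri)
    with B have att: "att adj (C (RTri (f ((RTri ^^ Suc a) Side)))) ?B" by (rule att_arb[rotated])
    have "arb adj ((C \<circ> RTri) ((RTri ^^ Suc a) (f Side)))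
        ((C \<circ> RTri) ` ins (Suc a) (f Side) \<union> W0 \<union> {} \<union> ?B)"
      using Suc.prems att
      by (intro Suc.IH)
        (auto simp: slots_def ins_frame[of f "Suc a"] ins_Side ctx_eq frame_neq
          frame_neq[symmetric] image_image
           ctx_comp' ctx_RTri att_empty)
    then show ?case
      using Suc.prems by (simp add: ins_frame[of f "Suc a"] image_Un image_image Un_ac)
  qed
next
  case (rs_frame g u f C a W0 W1 W2)
  show ?case using rs_frame.prems
  proof (induction a arbitrary: C W0 W1 W2)
    case 0
    let ?B = "(C \<circ> f) ` ins (Suc 0) (g u) \<union> W2 \<union> W1 \<union> {}"
    have B: "arb adj ((C \<circ> f) ((RTri ^^ Suc 0) (g u))) ?B"
      using 0 by (intro rs_frame.IH) (auto simp: rs_frame.hyps slots_def ins_frame[of f] image_Un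
        image_image
          ap_frame ctx_comp' ctx_frame att_empty)
    have "adj (C (RTri (f (g u)))) (C (f (RTri (g u))))"
      using 0 by (auto intro: ctx_adj frame_RTri)
    with B have "att adj (C (RTri (f (g u)))) ?B" by (auto intro: att_arb)
    then show ?case
      using 0 by (intro arbI[of _ _ W0 ?B])
        (auto simp: slots_def ins_frame[of f] ctx_eq frame_neq frame_neq[symmetric] image_image
          image_Un)
  next
    case (Suc a)
    \<comment> \<open>The class with outermost letter \<open>f\<close> is entered at its own
      outermost end, the place of \<open>W2\<close>; its innermost end is that of the whole group,
      the place of \<open>W1\<close>. The class as a whole hangs at the third slot of the class of
      \<open>RTri\<close>, one flip away.\<close>
    let ?B = "(C \<circ> f) ` ins (Suc (Suc a)) (g u) \<union> W2 \<union> W1 \<union> {}"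
    have B: "arb adj ((C \<circ> f) ((RTri ^^ Suc (Suc a)) (g u))) ?B"
      using Suc.prems by (intro rs_frame.IH) (auto simp: rs_frame.hyps slots_def ins_frame[of f]
        image_Un image_image
          ap_frame ctx_comp' ctx_frame att_empty)
    have "adj (C (RTri (f ((RTri ^^ Suc a) (g u))))) (C (f ((RTri ^^ Suc (Suc a)) (g u))))"
      using Suc.prems by (auto intro: ctx_adj frame_RTri)
    with B have att: "att adj (C (RTri (f ((RTri ^^ Suc a) (g u))))) ?B" by (auto intro: att_arb)
    have "arb adj ((C \<circ> RTri) ((RTri ^^ Suc a) (f (g u))))
        ((C \<circ> RTri) ` ins (Suc a) (f (g u)) \<union> W0 \<union> {} \<union> ?B)"
      using Suc.prems att
      by (intro Suc.IH)
        (auto simp: slots_def ins_frame[of f "Suc a"] ctx_eq frame_neq frame_neq[symmetric]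
          image_image image_Un
           ctx_comp' ctx_RTri att_empty)
    then show ?case
      using Suc.prems by (simp add: ins_frame[of f "Suc a"] image_Un image_image Un_ac)
  qed
qed

lemma arb_ins_inner:
  assumes "rs u" "frame f" "ctx C"
    and "att adj (C (f (ap ((RTri ^^ Suc a) Side) u))) W0"
    and "att adj (C ((RTri ^^ Suc a) (f u))) W1"
    and "att adj (C (RTri (f (ap ((RTri ^^ a) Side) u)))) W2"
    and "slots (C ` ins (Suc a) (f u)) [W0, W1, W2]"
  shows "arb adj (C (f (ap ((RTri ^^ Suc a) Side) u))) (C ` ins (Suc a) (f u) \<union> W0 \<union> W1 \<union> W2)"
proof -
  \<comment> \<open>Spans the class with outermost letter \<open>RTri\<close> from its innermost
    end. For \<open>a = 0\<close> this class is a single vertex, which takes both \<open>W1\<close>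
    and \<open>W2\<close>; otherwise the induction hypothesis for \<open>a\<close> will supply the
    fourth premise.\<close>
  have inner: "arb adj (C (RTri (f (ap ((RTri ^^ a) Side) u))))
      ((C \<circ> RTri) ` ins a (f u) \<union> W2 \<union> W1)"
    if "frame f" "ctx C" "rs u"
      "a \<noteq> 0 \<Longrightarrow> arb adj ((C \<circ> RTri) (f (ap ((RTri ^^ a) Side) u)))
        ((C \<circ> RTri) ` ins a (f u) \<union> W2 \<union> W1 \<union> {})"
      "att adj (C ((RTri ^^ Suc a) (f u))) W1"
      "att adj (C (RTri (f (ap ((RTri ^^ a) Side) u)))) W2"
      "slots (C ` ins (Suc a) (f u)) [W0, W1, W2]"
    for f u C a W0 W1 W2
  proof (cases a)
    case 0
    have "ap Side u = u" using \<open>rs u\<close> by (induction rule: rs.induct) (auto simp: ap_frame)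
    with 0 that show ?thesis
      by (intro arbI[of _ _ W2 W1]) (auto simp: slots_def ins_frame)
  next
    case (Suc b)
    then show ?thesis using that by simp
  qed
  show ?thesis
    using assms
  proof (induction u arbitrary: f C a W0 W1 W2 rule: rs.induct)
    case (rs_Side f C a W0 W1 W2)
    then show ?case
    proof (induction a arbitrary: C W0 W1 W2)
      case (0 C W0 W1 W2)
      let ?B = "(C \<circ> RTri) ` ins 0 (f Side) \<union> W2 \<union> W1"
      have "arb adj (C (RTri (f (ap ((RTri ^^ 0) Side) Side)))) ?B"
        using 0 rs.rs_Side by (intro inner[where ?W0.0 = W0]) auto
      then have "att adj (C (f (RTri Side))) ?B"
        using 0 by (auto intro!: att_arb intro: ctx_adj frame_RTri adj_sym)
      then show ?case using 0
        by (intro arbI[of _ _ W0 ?B]) (auto simp: slots_def ins_frame ctx_eq frame_neq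
          frame_neq[symmetric])
    next
      case (Suc a C W0 W1 W2)
      let ?B = "(C \<circ> RTri) ` ins (Suc a) (f Side) \<union> W2 \<union> W1"
      have "arb adj (C (RTri (f (ap ((RTri ^^ Suc a) Side) Side)))) ?B"
      proof (rule inner[where ?W0.0 = W0])
        show "arb adj ((C \<circ> RTri) (f (ap ((RTri ^^ Suc a) Side) Side)))
            ((C \<circ> RTri) ` ins (Suc a) (f Side) \<union> W2 \<union> W1 \<union> {})"
          using Suc.prems
          by (intro Suc.IH) (auto simp: slots_def ins_frame[of f "Suc a"] image_image image_Un
            ctx_comp' ctx_RTri att_empty)
      qed (use Suc.prems rs.rs_Side in auto)
      then have "att adj (C (f ((RTri ^^ Suc (Suc a)) Side))) ?B"
        using Suc.prems by (auto intro!: att_arb intro: ctx_adj frame_RTri adj_sym)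
      then show ?case using Suc.prems
        by (intro arbI[of _ _ W0 ?B])
          (auto simp: slots_def ins_frame[of f "Suc a"] ins_Side ctx_eq frame_neq
            frame_neq[symmetric]
            image_image image_Un)
    qed
  next
    case (rs_frame g u f C a W0 W1 W2)
    have rs: "rs (g u)" using rs_frame.hyps by (rule rs.rs_frame)
    have outer: "arb adj (C (f (ap ((RTri ^^ Suc a) Side) (g u))))
        (C ` ins (Suc a) (f (g u)) \<union> W0 \<union> W1 \<union> W2)"
      if "frame f" "ctx C" "att adj (C (f (ap ((RTri ^^ Suc a) Side) (g u)))) W0"
        "slots (C ` ins (Suc a) (f (g u))) [W0, W1, W2]"
        "arb adj (C (RTri (f (ap ((RTri ^^ a) Side) (g u))))) ((C \<circ> RTri) ` ins a (f (g u)) \<union> W2 \<union>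
          W1)"
      for C a W0 W1 W2
    proof -
      let ?B = "(C \<circ> RTri) ` ins a (f (g u)) \<union> W2 \<union> W1"
      \<comment> \<open>The class of \<open>RTri\<close> hangs at the third slot of the induction
        hypothesis for \<open>u\<close>: there \<open>f\<close> is followed directly by an
        \<open>RTri\<close>, and one flip exchanges the two.\<close>
      have att: "att adj ((C \<circ> f) (RTri (g (ap ((RTri ^^ a) Side) u)))) ?B"
        using that rs_frame.hyps
        by (auto simp: ap_frame intro!: att_arb intro: ctx_adj frame_RTri adj_sym)
      have "arb adj ((C \<circ> f) (g (ap ((RTri ^^ Suc a) Side) u)))
          ((C \<circ> f) ` ins (Suc a) (g u) \<union> W0 \<union> {} \<union> ?B)"
        using that att rs_frame.hyps
        by (intro rs_frame.IH)
          (auto simp: slots_def ins_frame[of f] image_image image_Un ap_frame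
            ctx_comp' ctx_frame att_empty ctx_eq frame_neq frame_neq[symmetric])
      then show ?thesis
        using that rs_frame.hyps by (simp add: ins_frame[of f] ap_frame image_Un image_image Un_ac)
    qed
    show ?case using rs_frame.prems
    proof (induction a arbitrary: C W0 W1 W2)
      case (0 C W0 W1 W2)
      have "arb adj (C (RTri (f (ap ((RTri ^^ 0) Side) (g u)))))
          ((C \<circ> RTri) ` ins 0 (f (g u)) \<union> W2 \<union> W1)"
        using 0 rs by (intro inner[where ?W0.0 = W0]) auto
      with 0 show ?case by (intro outer)
    next
      case (Suc a C W0 W1 W2)
      have "arb adj ((C \<circ> RTri) (f (ap ((RTri ^^ Suc a) Side) (g u))))
          ((C \<circ> RTri) ` ins (Suc a) (f (g u)) \<union> W2 \<union> W1 \<union> {})"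
        using Suc.prems
        by (intro Suc.IH) (auto simp: slots_def ins_frame[of f "Suc a"] image_image image_Un
          ctx_comp' ctx_RTri att_empty)
      then have "arb adj (C (RTri (f (ap ((RTri ^^ Suc a) Side) (g u)))))
          ((C \<circ> RTri) ` ins (Suc a) (f (g u)) \<union> W2 \<union> W1)"
        using Suc.prems rs by (intro inner[where ?W0.0 = W0])
      with Suc.prems show ?case by (intro outer)
    qed
  qed
qed

section \<open>Recovering the base shape of an interleaving\<close>

fun strip :: "shape \<Rightarrow> shape" where
  "strip Side = Side"
| "strip (LTri u) = LTri (strip u)"
| "strip (RTri u) = strip u"
| "strip (Quad x a b u) = Quad x a b (strip u)"

lemma strip_frame: "frame f \<Longrightarrow> strip (f u) = f (strip u)"
  by (auto elim!: frame.cases)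

lemma rs_strip: "rs (strip t)"
  by (induction t) (auto intro: rs.intros frame.intros rs_frame[of LTri] rs_frame[of "Quad _ _ _"])

lemma strip_rs: "rs t \<Longrightarrow> strip t = t"
  by (induction rule: rs.induct) (auto simp: strip_frame)

lemma strip_ins: "rs t \<Longrightarrow> s \<in> ins a t \<Longrightarrow> strip s = t"
proof (induction t arbitrary: s a rule: rs.induct)
  case rs_Side
  have "strip ((RTri ^^ a) Side) = Side" by (induction a) auto
  with rs_Side show ?case by (simp add: ins_Side)
next
  case (rs_frame f u)
  from rs_frame.prems show ?case
    by (induction a arbitrary: s)
      (auto simp: rs_frame.hyps ins_frame strip_rs strip_frame rs.rs_frame rs_frame.IH)
qed

lemma word_frame: "frame f \<Longrightarrow> \<exists>p. \<forall>u. word (f u) = p @ word u"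
  by (cases rule: frame.cases) (auto intro: exI[of _ "[True]"] exI[of _ "_ @ _"])

lemma word_ins: "rs t \<Longrightarrow> s \<in> ins a t \<Longrightarrow> word s = word t @ replicate a True"
proof (induction t arbitrary: s a rule: rs.induct)
  case rs_Side
  have "word ((RTri ^^ a) Side) = False # replicate a True"
    by (induction a) (auto simp: replicate_append_same)
  with rs_Side show ?case by (simp add: ins_Side)
next
  case (rs_frame f u)
  obtain p where p: "\<And>u. word (f u) = p @ word u" using word_frame rs_frame.hyps(1) by blast
  from rs_frame.prems show ?case
    by (induction a arbitrary: s)
      (auto simp: rs_frame.hyps ins_frame p rs_frame.IH replicate_append_same)
qed

lemma ins_frameI: "frame f \<Longrightarrow> s \<in> ins a u \<Longrightarrow> f s \<in> ins a (f u)"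
  by (cases a) (auto simp: ins_frame)

lemma RTri_ins: "rs t \<Longrightarrow> s \<in> ins a t \<Longrightarrow> RTri s \<in> ins (Suc a) t"
  by (cases rule: rs.cases) (auto simp: ins_Side ins_frame)

lemma ex_ins_strip: "\<exists>a. s \<in> ins a (strip s)"
proof (induction s)
  case Side
  show ?case by (auto intro!: exI[of _ 0])
next
  case (LTri s)
  then show ?case using ins_frameI[OF frame.intros(1)] by auto
next
  case (RTri s)
  then show ?case using RTri_ins[OF rs_strip] by auto
next
  case (Quad x a b s)
  then show ?case using ins_frameI[OF frame.intros(2)] by fastforce
qed

lemma append_replicate_cancel:
  assumes "xs @ replicate a True = ys @ replicate b True"
    and "xs \<noteq> []" "\<not> last xs" "ys \<noteq> []" "\<not> last ys"
  shows "xs = ys \<and> a = b"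
  using assms(1)
proof (induction a arbitrary: b)
  case 0
  then show ?case using assms(2-) by (cases b) (auto simp flip: replicate_append_same)
next
  case (Suc a)
  then show ?case
  proof (cases b)
    case 0
    with Suc.prems assms(2-) show ?thesis by (auto simp flip: replicate_append_same)
  next
    case (Suc b')
    with Suc.prems have "xs @ replicate a True = ys @ replicate b' True"
      by (simp flip: replicate_append_same)
    with Suc.IH Suc show ?thesis by simp
  qed
qed

abbreviation shapes :: "bool list \<Rightarrow> shape set" where
  "shapes w \<equiv> {s. word s = w}"

text \<open>\<open>strip\<close> recovers the base shape, and the number of right triangles on the
  right spine is the length of the final run of monochromatic sides. The condition on
  \<open>w\<close> makes this final run unambiguous.\<close>

lemma shapes_append_run:
  assumes "w \<noteq> []" "\<not> last w"
  shows "shapes (w @ replicate a True) = (\<Union>t \<in> shapes w. ins a t)"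
proof (intro set_eqI iffI)
  fix s assume s: "s \<in> shapes (w @ replicate a True)"
  obtain b where b: "s \<in> ins b (strip s)" using ex_ins_strip by blast
  have "word s = word (strip s) @ replicate b True" using b by (rule word_ins[OF rs_strip])
  moreover have "\<not> last (word (strip s))" using rs_strip rs_iff by blast
  ultimately have "word (strip s) = w \<and> b = a"
    using s assms by (intro append_replicate_cancel) auto
  with b show "s \<in> (\<Union>t \<in> shapes w. ins a t)" by auto
next
  fix s assume "s \<in> (\<Union>t \<in> shapes w. ins a t)"
  then show "s \<in> shapes (w @ replicate a True)"
    using assms(2) by (auto simp: word_ins rs_iff)
qed

text \<open>Every vertex of the old tree becomes the group of its interleavings. In both versions
  the first child group hangs at the outermost end and the second at the innermost end; the versions
  differ only in the end that serves as root.\<close>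

lemma arb_run:
  assumes "arb adj t V" "\<And>x. x \<in> V \<Longrightarrow> rs x \<and> x \<noteq> Side"
  shows "arb adj ((RTri ^^ Suc a) t) (\<Union> (ins (Suc a) ` V))"
proof -
  let ?F = "\<lambda>V. \<Union> (ins (Suc a) ` V)"
  let ?e0 = "RTri ^^ Suc a" and ?e1 = "ap ((RTri ^^ Suc a) Side)"
  let ?ok = "\<lambda>x. rs x \<and> x \<noteq> Side"
  have e0: "adj (?e0 s) (?e0 t)" if "adj s t" for s t
    using ctx_adj[OF ctx_funpow[OF ctx_RTri]] that .
  have disj: "?F V \<inter> ?F W = {}" if "V \<inter> W = {}" "\<And>x. x \<in> V \<union> W \<Longrightarrow> ?ok x" for V W
    using that strip_ins by blast
  have "arb adj t V \<Longrightarrow> (\<And>x. x \<in> V \<Longrightarrow> ?ok x) \<Longrightarrow> arb adj (?e0 t) (?F V) \<and> arb adj (?e1 t) (?F V)"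
    and "att adj t V \<Longrightarrow> (\<And>x. x \<in> V \<Longrightarrow> ?ok x) \<Longrightarrow> att adj (?e0 t) (?F V) \<and> att adj (?e1 t) (?F V)"
      for t V
  proof (induction rule: arb_att.inducts)
    case (arb_node t V W)
    then obtain f u where t: "t = f u" "frame f" "rs u" by (metis insertI1 rs.cases)
    have e1: "?e1 t = f (?e1 u)" using t by (simp add: ap_frame)
    have [simp]: "?F (insert t (V \<union> W)) = ins (Suc a) (f u) \<union> ?F V \<union> ?F W" using t by auto
    have sl: "slots (id ` ins (Suc a) (f u)) [?F V, ?F W, {}]"
         "slots (id ` ins (Suc a) (f u)) [?F W, ?F V, {}]"
      using arb_node.prems arb_node.hyps disj[of "{t}" V] disj[of "{t}" W] disj[of V W]
      by (auto simp: slots_def t)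
    have "arb adj (id (?e0 (f u))) (id ` ins (Suc a) (f u) \<union> ?F V \<union> ?F W \<union> {})"
      using t arb_node sl by (intro arb_ins_outer ctx_id att_empty) (auto simp: ap_frame)
    moreover have "arb adj (id (f (?e1 u))) (id ` ins (Suc a) (f u) \<union> ?F W \<union> ?F V \<union> {})"
      using t arb_node sl by (intro arb_ins_inner ctx_id att_empty) (auto simp: ap_frame)
    ultimately show ?case using t by (simp add: ap_frame Un_ac)
  next
    case (att_empty t) then show ?case by (simp add: arb_att.att_empty)
  next
    case (att_arb t b V) then show ?case by (blast intro: arb_att.att_arb e0 adj_ap)
  qed
  with assms show ?thesis by blast
qed

definition spanned :: "bool list \<Rightarrow> bool" where
  "spanned w \<longleftrightarrow> (\<exists>a. arb adj a (shapes w))"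

text \<open>The length bound excludes \<open>Side\<close>, whose spine has no frame, so that the two
  ends of its group would coincide.\<close>

lemma spanned_append_run:
  assumes "spanned w" "1 < length w" "\<not> last w"
  shows "spanned (w @ replicate a True)"
proof (cases a)
  case 0 then show ?thesis using assms by simp
next
  case (Suc b)
  from assms obtain t where "arb adj t (shapes w)" by (auto simp: spanned_def)
  then have "arb adj ((RTri ^^ a) t) (\<Union> (ins a ` shapes w))"
    unfolding Suc using assms by (intro arb_run) (auto simp: rs_iff)
  moreover have "w \<noteq> []" using assms by auto
  ultimately show ?thesis unfolding spanned_def using shapes_append_run assms by metis
qed

section \<open>Adding a quadrilateral\<close>

fun pure :: "shape \<Rightarrow> bool" where
  "pure Side \<longleftrightarrow> True"
| "pure (Quad x a b c) \<longleftrightarrow> pure a \<and> pure b \<and> pure c"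
| "pure _ \<longleftrightarrow> False"

text \<open>The shapes with one more quadrilateral are grouped into combs. The backbone of the comb of
  \<open>t\<close> moves a new quadrilateral down the right spine of \<open>t\<close>, and below each backbone vertex a tooth
  transfers the left spine of the first child of that quadrilateral to its second child. The two ends
  of the backbone depend on \<open>t\<close> compatibly with flips, so neighboring combs can be joined there.\<close>

fun tooth :: "shape \<Rightarrow> shape \<Rightarrow> shape list" where
  "tooth (Quad x c a b) d = Quad () (Quad x c a b) d Side # tooth c (Quad () a b d)"
| "tooth c d = [Quad () c d Side]"

fun comb :: "shape \<Rightarrow> shape set" where
  "comb (Quad x a b u) = set (tooth (Quad x a b u) Side) \<union> Quad x a b ` comb u"
| "comb t = set (tooth t Side)"

fun merge :: "shape \<Rightarrow> shape \<Rightarrow> shape" where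
  "merge c (Quad x a b d) = merge (Quad x c a b) d"
| "merge c _ = c"

text \<open>The inverse construction: the quadrilateral at the end of the right spine is dissolved,
  and the right spine of its second child returns to the left spine of the first. On pure shapes
  other than \<open>Side\<close>, the combs are the fibres of this map.\<close>

fun con :: "shape \<Rightarrow> shape" where
  "con (Quad x c d Side) = merge c d"
| "con (Quad x a b u) = Quad x a b (con u)"
| "con t = t"

text \<open>The first child shrinks strictly from one entry of a tooth to the next; this bound keeps
  the head of a tooth out of the remaining entries.\<close>

lemma tooth_left_size: "Quad x p q r \<in> set (tooth c d) \<Longrightarrow> size p \<le> size c"
  by (induction c d rule: tooth.induct) auto

lemma tooth_form: "s \<in> set (tooth c d) \<Longrightarrow> \<exists>p q. s = Quad () p q Side"
  by (induction c d rule: tooth.induct) auto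

lemma tooth_con: "s \<in> set (tooth c d) \<Longrightarrow> pure d \<Longrightarrow> pure c \<Longrightarrow> con s = merge c d"
  by (induction c d rule: tooth.induct) auto

lemma tooth_word: "s \<in> set (tooth c d) \<Longrightarrow> word s = word c @ word d @ [False]"
  by (induction c d rule: tooth.induct) auto

lemma tooth_head: "Quad () c d Side \<in> set (tooth c d)"
  by (induction c d rule: tooth.induct) auto

lemma tooth_step:
  "Quad () (Quad () c a b) d Side \<in> set (tooth e z) \<Longrightarrow>
    Quad () c (Quad () a b d) Side \<in> set (tooth e z)"
  by (induction e z rule: tooth.induct) (auto intro: tooth_head)

text \<open>Induction along the right spine of \<open>d\<close>: \<open>merge\<close> puts its first
  quadrilateral on the left spine of \<open>c\<close>, and \<open>tooth_step\<close> takes it back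
  as one step along the tooth.\<close>

lemma tooth_merge: "pure d \<Longrightarrow> Quad () c d Side \<in> set (tooth (merge c d) Side)"
  by (induction d arbitrary: c) (auto intro: tooth_head tooth_step)

lemma pure_word: "pure t \<longleftrightarrow> True \<notin> set (word t)"
  by (induction t) auto

lemma comb_neq_Side: "s \<in> comb t \<Longrightarrow> s \<noteq> Side"
  by (induction t arbitrary: s) (auto dest: tooth_form)

lemma con_Quad: "u \<noteq> Side \<Longrightarrow> con (Quad x a b u) = Quad x a b (con u)"
  by (cases u) auto

lemma tooth_head_notin:
  "Quad () (Quad x c a b) d z \<notin> set (tooth c e)"
  using tooth_left_size[of "()" "Quad x c a b" d z c e] by auto

lemma tooth_comb_disjoint: "s \<in> comb u \<Longrightarrow> Quad x p q s \<notin> set (tooth c d)"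
  using tooth_form comb_neq_Side by blast

lemma comb_con: "s \<in> comb t \<Longrightarrow> pure t \<Longrightarrow> con s = t"
proof (induction t arbitrary: s)
  case Side
  then show ?case by auto
next
  case (Quad x a b u)
  show ?case
  proof (cases "s \<in> set (tooth (Quad x a b u) Side)")
    case True
    then show ?thesis using Quad.prems tooth_con by fastforce
  next
    case False
    with Quad.prems obtain s' where "s = Quad x a b s'" "s' \<in> comb u" by auto
    then show ?thesis using Quad comb_neq_Side con_Quad by auto
  qed
qed auto

lemma comb_word: "s \<in> comb t \<Longrightarrow> word s = word t @ [False, False]"
proof (induction t arbitrary: s)
  case (Quad x a b u)
  then show ?case by (auto dest!: tooth_word)
qed (auto dest!: tooth_word)

lemma tooth_comb: "set (tooth t Side) \<subseteq> comb t"
  by (cases t) auto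

lemma con_comb: "pure s \<Longrightarrow> s \<noteq> Side \<Longrightarrow> s \<in> comb (con s)"
proof (induction s)
  case (Quad x a b u)
  show ?case
  proof (cases "u = Side")
    case True
    then show ?thesis using Quad tooth_merge[of b a] tooth_comb by auto
  next
    case False
    then show ?thesis using Quad by (auto simp: con_Quad)
  qed
qed auto

lemma shapes_add_quad:
  "shapes (replicate (Suc (Suc n)) False) = (\<Union>t \<in> shapes (replicate n False). comb t)"
    if "n \<noteq> 0"
proof (intro set_eqI iffI)
  have rep: "replicate (Suc (Suc n)) False = replicate n False @ [False, False]" for n
    by (induction n) auto
  fix s assume s: "s \<in> shapes (replicate (Suc (Suc n)) False)"
  then have "pure s" "s \<noteq> Side" by (auto simp: pure_word)
  then have c: "s \<in> comb (con s)" by (rule con_comb)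
  then have "word s = word (con s) @ [False, False]" by (rule comb_word)
  with s have "word (con s) = replicate n False" unfolding rep by simp
  with c show "s \<in> (\<Union>t \<in> shapes (replicate n False). comb t)" by auto
next
  have rep: "replicate (Suc (Suc n)) False = replicate n False @ [False, False]" for n
    by (induction n) auto
  fix s assume "s \<in> (\<Union>t \<in> shapes (replicate n False). comb t)"
  then show "s \<in> shapes (replicate (Suc (Suc n)) False)" unfolding rep by (auto simp: comb_word)
qed

lemma att_ctx: "ctx C \<Longrightarrow> adj s t \<Longrightarrow> arb adj (C t) V \<Longrightarrow> att adj (C s) V"
  by (blast intro: att_arb ctx_adj)

lemma arb_tooth:
  assumes "ctx C"
  shows "arb adj (C (Quad () c d Side)) (C ` set (tooth c d))"
proof (induction c d rule: tooth.induct)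
  case (1 x c a b d)
  have "adj (Quad () (Quad x c a b) d Side) (Quad () c (Quad () a b d) Side)"
    using adj_rules(6)[of "()" "()"] by simp
  then have "att adj (C (Quad () (Quad x c a b) d Side)) (C ` set (tooth c (Quad () a b d)))"
    using att_ctx[OF assms _ 1] by blast
  then show ?case
    using assms by (intro arbI[OF _ att_empty]) (auto simp: ctx_eq tooth_head_notin)
qed (simp_all add: arb_singleton)

section \<open>Spanning trees of the combs\<close>

abbreviation leaf_quad :: shape where
  "leaf_quad \<equiv> Quad () Side Side Side"

lemma ctx_Quad: "ctx (Quad x a b)" by (simp add: ctx_frame frame.intros)

lemma adj_backbone: "adj (Quad () (Quad x a b u) Side Side) (Quad x a b (Quad () u Side Side))"
  using adj_rules(7)[of "()" "()"] by simp

lemma att_tooth: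
  assumes "ctx C"
  shows "att adj (C (Quad () (Quad x a b u) Side Side)) (C ` set (tooth a (Quad () b u Side)))"
  using att_ctx[OF assms _ arb_tooth[OF assms]] adj_rules(6)[of "()" "()" a b u Side Side] by simp

text \<open>A backbone vertex above the bottom already has two children, its tooth and the next
  backbone vertex. So both attached sets go to the bottom, which has no children of its own.\<close>

lemma arb_comb_outer:
  assumes "pure t" "ctx C"
    and "att adj (C (ap leaf_quad t)) W1" "att adj (C (ap leaf_quad t)) W2"
    and "slots (C ` comb t) [W1, W2]"
  shows "arb adj (C (Quad () t Side Side)) (C ` comb t \<union> W1 \<union> W2)"
  using assms
proof (induction t arbitrary: C)
  case Side
  then show ?case by (intro arbI[of _ _ W1 W2]) (auto simp: slots_def)
next
  case (Quad x a b u)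
  let ?B = "(C \<circ> Quad x a b) ` comb u \<union> W1 \<union> W2"
  let ?T = "C ` set (tooth a (Quad () b u Side))"
  have "arb adj ((C \<circ> Quad x a b) (Quad () u Side Side)) ?B"
    using Quad.prems by (intro Quad.IH) (auto simp: slots_def image_image image_Un ctx_comp'
      ctx_Quad)
  then have "att adj (C (Quad () (Quad x a b u) Side Side)) ?B"
    using att_ctx[OF Quad.prems(2) adj_backbone] by simp
  moreover have "att adj (C (Quad () (Quad x a b u) Side Side)) ?T"
    using Quad.prems by (intro att_tooth)
  ultimately show ?case
    using Quad.prems
    by (intro arbI[of _ _ ?B ?T])
      (auto simp: slots_def image_image image_Un ctx_eq tooth_head_notin
        simp: tooth_comb_disjoint)
qed auto

text \<open>With the bottom as root the backbone is climbed. The bottom then has one slot left, for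
  \<open>W1\<close>, and the top, which has only its tooth below it, has one for
  \<open>W2\<close>.\<close>

lemma arb_comb_inner:
  assumes "pure t" "ctx C"
    and "att adj (C (ap leaf_quad t)) W1" "att adj (C (Quad () t Side Side)) W2"
    and "slots (C ` comb t) [W1, W2]"
  shows "arb adj (C (ap leaf_quad t)) (C ` comb t \<union> W1 \<union> W2)"
  using assms
proof (induction t arbitrary: C W2)
  case Side
  then show ?case by (intro arbI[of _ _ W1 W2]) (auto simp: slots_def)
next
  case (Quad x a b u)
  let ?T = "C ` set (tooth a (Quad () b u Side))"
  \<comment> \<open>The top together with its tooth and \<open>W2\<close> plays the role of
    \<open>W2\<close> for the comb of \<open>u\<close>.\<close>
  let ?B = "C ` set (tooth (Quad x a b u) Side) \<union> W2"
  have "arb adj (C (Quad () (Quad x a b u) Side Side)) ?B"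
    using Quad.prems att_tooth
    by (intro arbI[of _ _ ?T W2]) (auto simp: slots_def image_image image_Un ctx_eq
      tooth_head_notin)
  then have "att adj (C (Quad x a b (Quad () u Side Side))) ?B"
    by (rule att_ctx[OF Quad.prems(2) adj_sym[OF adj_backbone]])
  then have "arb adj ((C \<circ> Quad x a b) (ap leaf_quad u)) ((C \<circ> Quad x a b) ` comb u \<union> W1 \<union> ?B)"
    using Quad.prems
    by (intro Quad.IH)
      (auto simp: slots_def image_image image_Un ctx_comp' ctx_Quad ctx_eq simp:
        tooth_comb_disjoint)
  then show ?case by (simp add: image_image image_Un Un_ac)
qed auto

lemma arb_add_quad:
  assumes "arb adj t V" "\<And>x. x \<in> V \<Longrightarrow> pure x"
  shows "arb adj (ap leaf_quad t) (\<Union> (comb ` V))"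
proof -
  let ?F = "\<lambda>V. \<Union> (comb ` V)"
  let ?e0 = "\<lambda>t. Quad () t Side Side" and ?e1 = "ap leaf_quad"
  have disj: "?F V \<inter> ?F W = {}" if "V \<inter> W = {}" "\<And>x. x \<in> V \<union> W \<Longrightarrow> pure x" for V W
    using that comb_con by blast
  have "arb adj t V \<Longrightarrow> (\<And>x. x \<in> V \<Longrightarrow> pure x) \<Longrightarrow> arb adj (?e0 t) (?F V) \<and> arb adj (?e1 t) (?F V)"
    and "att adj t V \<Longrightarrow> (\<And>x. x \<in> V \<Longrightarrow> pure x) \<Longrightarrow> att adj (?e0 t) (?F V) \<and> att adj (?e1 t) (?F V)"
      for t V
  proof (induction rule: arb_att.inducts)
    case (arb_node t V W)
    have sl: "slots (id ` comb t) [?F V, ?F W]"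
      using arb_node.prems arb_node.hyps disj[of "{t}" V] disj[of "{t}" W] disj[of V W]
      by (auto simp: slots_def)
    have "arb adj (id (?e0 t)) (id ` comb t \<union> ?F V \<union> ?F W)"
      using arb_node sl by (intro arb_comb_outer ctx_id) auto
    moreover have "arb adj (id (?e1 t)) (id ` comb t \<union> ?F V \<union> ?F W)"
      using arb_node sl by (intro arb_comb_inner ctx_id) auto
    ultimately show ?case by (simp add: Un_ac)
  next
    case (att_empty t) then show ?case by (simp add: arb_att.att_empty)
  next
    case (att_arb t b V) then show ?case by (blast intro: arb_att.att_arb adj_context adj_ap)
  qed
  with assms show ?thesis by blast
qed

lemma shapes_Side: "shapes [False] = {Side}"
proof -
  have pos: "0 < length (word t)" for t :: shape by simp
  have "s = Side" if "word s = [False]" for s :: shape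
  proof (cases s)
    case (Quad x a b c)
    with that have "length (word a) + length (word b) + length (word c) = 1"
      by (metis add.assoc length_append word.simps(4) length_Cons list.size(3) One_nat_def)
    then show ?thesis using pos[of a] pos[of b] by linarith
  qed (use that in auto)
  then show ?thesis by auto
qed

lemma spanned_alternating: "spanned (replicate (2 * n + 1) False)"
proof (induction n)
  case 0
  show ?case using arb_singleton[of adj Side] by (auto simp: spanned_def shapes_Side)
next
  case (Suc n)
  then obtain t where "arb adj t (shapes (replicate (2 * n + 1) False))" by (auto simp: spanned_def)
  then have "arb adj (ap leaf_quad t) (\<Union> (comb ` shapes (replicate (2 * n + 1) False)))"
    by (rule arb_add_quad) (auto simp: pure_word)
  also have "\<Union> (comb ` shapes (replicate (2 * n + 1) False)) =
    shapes (replicate (2 * Suc n + 1) False)"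
    using shapes_add_quad[of "2 * n + 1"] by simp
  finally show ?case unfolding spanned_def by blast
qed

section \<open>Rotating the polygon\<close>

text \<open>Re-rooting at the first side reverses the left spine into a right spine. The first argument
  accumulates the part that has already been reversed.\<close>

fun rotr :: "shape \<Rightarrow> shape \<Rightarrow> shape" where
  "rotr z Side = z"
| "rotr z (RTri t) = rotr (LTri z) t"
| "rotr z (Quad x a b c) = rotr (Quad x b c z) a"
| "rotr z (LTri t) = LTri t"

fun rotl :: "shape \<Rightarrow> shape \<Rightarrow> shape" where
  "rotl z Side = z"
| "rotl z (LTri t) = rotl (RTri z) t"
| "rotl z (Quad x a b c) = rotl (Quad x z a b) c"
| "rotl z (RTri t) = RTri t"

lemma rotl_rotr: "\<not> hd (word t) \<Longrightarrow> rotl Side (rotr z t) = rotl t z"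
  by (induction z t rule: rotr.induct) auto

lemma rotr_rotl: "\<not> last (word t) \<Longrightarrow> rotr Side (rotl z t) = rotr t z"
  by (induction z t rule: rotl.induct) auto

lemma word_rotr: "\<not> hd (word t) \<Longrightarrow> word (rotr z t) = tl (word t) @ word z"
  by (induction z t rule: rotr.induct) auto

lemma word_rotl: "\<not> last (word t) \<Longrightarrow> word (rotl z t) = word z @ butlast (word t)"
  by (induction z t rule: rotl.induct) (auto simp: butlast_append)

lemma adj_rotr_acc: "adj z z' \<Longrightarrow> \<not> hd (word t) \<Longrightarrow> adj (rotr z t) (rotr z' t)"
proof (induction z t arbitrary: z' rule: rotr.induct)
  case (2 z t)
  then show ?case by (simp add: adj_context)
next
  case (3 z x a b c)
  then show ?case by (simp add: adj_context)
qed auto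

text \<open>Seen from the new root the sides of a quadrilateral shift cyclically, so a flip rule on
  the reversed spine becomes another rule in the accumulator, for example \<open>QQ12\<close> a
  reversed \<open>QQ13\<close>. This may exchange two labels, which is invisible for shapes.\<close>

lemma adj_rotr: "adj s t \<Longrightarrow> \<not> hd (word s) \<Longrightarrow> adj (rotr z s) (rotr z t)"
proof (induction arbitrary: z rule: adj_induct)
  case (sym s t)
  then show ?case using word_adj[OF sym(1)] by (simp add: adj_sym)
next
  case (RQ x a b c)
  then show ?case by (simp add: adj_rotr_acc adj_sym[OF adj_rules(5)])
next
  case (Q12 x a b c)
  then show ?case by (simp add: adj_rotr_acc adj_rules(2))
next
  case (Q23 x a b c)
  then show ?case by (simp add: adj_rotr_acc adj_rules(4))
next
  case (QQ12 x y a b c d e)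
  then show ?case using adj_rules(7)[of x y b c d e z] by (simp add: adj_rotr_acc adj_sym)
next
  case (QQ13 x y a b c d e)
  then show ?case using adj_rules(8)[of x b y c d e z] by (simp add: adj_rotr_acc adj_sym)
next
  case (QQ23 x y a b c d e)
  then show ?case using adj_rules(6)[of x y b c d e z] by (simp add: adj_rotr_acc)
next
  case (Q2 s t x a c)
  then show ?case by (simp add: adj_rotr_acc adj_context)
next
  case (Q3 s t x a b)
  then show ?case by (simp add: adj_rotr_acc adj_context)
qed simp_all

text \<open>The root side is bichromatic as well, though it is not part of the word: rerooting at
  the first side makes the old root side the last letter.\<close>

lemma spanned_rotate:
  assumes "spanned (False # w)"
  shows "spanned (w @ [False])"
proof -
  from assms obtain a where a: "arb adj a (shapes (False # w))" by (auto simp: spanned_def)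
  have inv: "rotl Side (rotr Side t) = t" if "t \<in> shapes (False # w)" for t
    using that rotl_rotr[of t Side] by auto
  have img: "rotr Side ` shapes (False # w) = shapes (w @ [False])"
  proof (intro set_eqI iffI)
    fix s assume s: "s \<in> shapes (w @ [False])"
    then have "rotr Side (rotl Side s) = s" using rotr_rotl[of s Side] by auto
    moreover have "rotl Side s \<in> shapes (False # w)" using s by (auto simp: word_rotl)
    ultimately show "s \<in> rotr Side ` shapes (False # w)" by (metis imageI)
  qed (auto simp: word_rotr)
  have "arb adj (rotr Side a) (rotr Side ` shapes (False # w))"
    using a by (rule arb_image[where U = "shapes (False # w)"])
      (auto intro!: inj_on_inverseI[of _ "rotl Side"] inv adj_rotr)
  then show ?thesis unfolding img spanned_def by blast
qed

text \<open>The side pattern of color classes with \<open>b + 1\<close> points each: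
  \<open>b\<close> monochromatic sides inside a class and one bichromatic side between consecutive
  classes.\<close>

fun runs :: "nat list \<Rightarrow> bool list" where
  "runs [] = []"
| "runs [b] = replicate b True"
| "runs (b # c # bs) = replicate b True @ False # runs (c # bs)"

lemma runs_snoc: "bs \<noteq> [] \<Longrightarrow> runs (bs @ [b]) = runs bs @ False # replicate b True"
  by (induction bs rule: runs.induct) auto

text \<open>The leading \<open>False\<close> letters belong to classes that still have one point.
  Each step rotates one of them to the end and appends a run behind it.\<close>

lemma spanned_runs_aux:
  assumes "n \<noteq> 0" "length bs \<le> 2 * n + 1"
  shows "spanned (replicate (2 * n + 1 - length bs) False @ runs (b # bs))"
  using assms(2)
proof (induction bs rule: rev_induct)
  case Nil
  have "spanned (replicate (2 * n + 1) False @ replicate b True)"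
    using spanned_alternating \<open>n \<noteq> 0\<close> by (intro spanned_append_run) auto
  then show ?case by simp
next
  case (snoc c bs)
  let ?k = "2 * n - length bs"
  have eq: "2 * n + 1 - length bs = Suc ?k" using snoc.prems by auto
  have "spanned (False # replicate ?k False @ runs (b # bs))"
    using snoc.IH snoc.prems unfolding eq by simp
  then have "spanned ((replicate ?k False @ runs (b # bs)) @ [False])"
    by (rule spanned_rotate)
  moreover have "replicate ?k False @ runs (b # bs) \<noteq> []"
    using snoc.prems \<open>n \<noteq> 0\<close> by (cases bs rule: rev_cases) (auto simp: runs_snoc[of "_ # _",
      simplified])
  ultimately have "spanned (((replicate ?k False @ runs (b # bs)) @ [False]) @ replicate c True)"
    by (intro spanned_append_run) auto
  then show ?case using runs_snoc[of "b # bs" c] by simp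
qed

lemma spanned_runs:
  assumes "even (length bs)" "4 \<le> length bs"
  shows "spanned (runs bs)"
proof (cases bs)
  case Nil then show ?thesis using assms by simp
next
  case (Cons b cs)
  define n where "n = (length bs - 2) div 2"
  have "length cs = 2 * n + 1" "n \<noteq> 0" using assms Cons by (auto simp: n_def elim!: evenE)
  then show ?thesis using spanned_runs_aux[of n cs b] Cons by simp
qed

section \<open>Hamilton paths\<close>

definition hpath :: "('a \<Rightarrow> 'a \<Rightarrow> bool) \<Rightarrow> 'a set \<Rightarrow> 'a list \<Rightarrow> 'a \<Rightarrow> 'a \<Rightarrow> bool" where
  "hpath E V xs u v \<longleftrightarrow>
     distinct xs \<and> set xs = V \<and> successively E xs \<and> xs \<noteq> [] \<and> hd xs = u \<and> last xs = v"

definition consec :: "'a list \<Rightarrow> 'a set \<Rightarrow> bool" where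
  "consec xs e \<longleftrightarrow> (\<exists>ys a b zs. xs = ys @ a # b # zs \<and> e = {a, b})"

lemma consec_append:
  "consec (xs @ ys) e \<longleftrightarrow>
    consec xs e \<or> consec ys e \<or> (xs \<noteq> [] \<and> ys \<noteq> [] \<and> e = {last xs, hd ys})"
proof
  assume "consec (xs @ ys) e"
  then obtain ps a b qs where eq: "xs @ ys = ps @ a # b # qs" and e: "e = {a, b}"
    unfolding consec_def by blast
  from eq consider us where "xs = ps @ us" "us @ ys = a # b # qs"
    | us where "ps = xs @ us" "ys = us @ a # b # qs"
    by (auto simp: append_eq_append_conv2)
  then show "consec xs e \<or> consec ys e \<or> (xs \<noteq> [] \<and> ys \<noteq> [] \<and> e = {last xs, hd ys})"
  proof cases
    case 1
    then show ?thesis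
    proof (cases us)
      case Nil
      with 1 have "ys = [] @ a # b # qs" by simp
      then show ?thesis using e unfolding consec_def by blast
    next
      case (Cons a' us')
      show ?thesis
      proof (cases us')
        case Nil
        with 1 Cons e show ?thesis by auto
      next
        case (Cons b' us'')
        with 1 \<open>us = a' # us'\<close> have "xs = ps @ a # b # us''" by simp
        then show ?thesis using e unfolding consec_def by blast
      qed
    qed
  next
    case 2
    then show ?thesis using e unfolding consec_def by blast
  qed
next
  assume "consec xs e \<or> consec ys e \<or> (xs \<noteq> [] \<and> ys \<noteq> [] \<and> e = {last xs, hd ys})"
  then consider "consec xs e" | "consec ys e" | "xs \<noteq> []" "ys \<noteq> []" "e = {last xs, hd ys}" by blast
  then show "consec (xs @ ys) e"
  proof cases
    case 1
    then obtain ps a b qs where "xs @ ys = ps @ a # b # (qs @ ys)" "e = {a, b}"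
      unfolding consec_def by auto
    then show ?thesis unfolding consec_def by blast
  next
    case 2
    then obtain ps a b qs where "xs @ ys = (xs @ ps) @ a # b # qs" "e = {a, b}"
      unfolding consec_def by auto
    then show ?thesis unfolding consec_def by blast
  next
    case 3
    then have "xs @ ys = butlast xs @ last xs # hd ys # tl ys" by simp
    then show ?thesis using 3 unfolding consec_def by blast
  qed
qed

lemma consec_rev: "consec (rev xs) e \<longleftrightarrow> consec xs e"
proof -
  have "consec (rev xs) e" if "consec xs e" for xs :: "'a list"
  proof -
    from that obtain ys a b zs where "xs = ys @ a # b # zs" "e = {a, b}" unfolding consec_def
      by blast
    then have "rev xs = rev zs @ b # a # rev ys" "e = {b, a}" by auto
    then show ?thesis unfolding consec_def by blast
  qed
  from this[of xs] this[of "rev xs"] show ?thesis by auto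
qed

lemma hpath_rev:
  assumes "hpath E V xs u v" "symp E"
  shows "hpath E V (rev xs) v u"
proof -
  have "(\<lambda>x y. E y x) = E" using assms(2) by (auto simp: symp_def fun_eq_iff)
  then have "successively E (rev xs)"
    using assms(1) unfolding successively_rev hpath_def by metis
  with assms(1) show ?thesis by (auto simp: hpath_def hd_rev last_rev)
qed

lemma consec_split:
  assumes "consec xs {a, b}"
  obtains ys zs where "xs = ys @ a # b # zs" | ys zs where "xs = ys @ b # a # zs"
  using assms unfolding consec_def by (metis doubleton_eq_iff)

text \<open>The edge is replaced by a detour through \<open>W\<close>. It may be traversed in either
  direction, and then the detour is reversed, hence the symmetry of \<open>E\<close>. That all other
  edges survive is what permits a second insertion.\<close>

lemma hpath_insert:
  assumes xs: "hpath E V xs u v" "consec xs {a, b}"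
    and ys: "hpath E W ys a' b'" and E: "symp E" "E a a'" "E b b'" and disj: "V \<inter> W = {}"
  shows "\<exists>zs. hpath E (V \<union> W) zs u v \<and> (\<forall>e. consec xs e \<longrightarrow> e \<noteq> {a, b} \<longrightarrow> consec zs e)"
proof -
  have *: "\<exists>zs. hpath E (V \<union> W) zs u v \<and> (\<forall>e. consec xs e \<longrightarrow> e \<noteq> {a, b} \<longrightarrow> consec zs e)"
    if ys: "hpath E W ys a' b'" and E: "E a a'" "E b' b" and eq: "xs = ps @ a # b # qs"
    for ps qs a b a' b' ys
  proof (intro exI conjI allI impI)
    let ?zs = "(ps @ [a]) @ ys @ (b # qs)"
    have xs': "xs = (ps @ [a]) @ (b # qs)" using eq by simp
    have succ: "successively E (ps @ [a])" "successively E (b # qs)"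
      using xs(1) successively_append_iff[of E "ps @ [a]" "b # qs"] unfolding hpath_def xs'
        by blast+
    have ysD: "distinct ys" "set ys = W" "successively E ys" "ys \<noteq> []" "hd ys = a'" "last ys = b'"
      using ys by (auto simp: hpath_def)
    show "hpath E (V \<union> W) ?zs u v"
      unfolding hpath_def
    proof (intro conjI)
      show "distinct ?zs" "set ?zs = V \<union> W" using xs(1) ysD disj eq by (auto simp: hpath_def)
      show "successively E ?zs"
        using succ ysD E unfolding successively_append_iff by simp
      show "?zs \<noteq> []" by simp
      show "hd ?zs = u" using xs(1) eq by (cases ps) (auto simp: hpath_def)
      show "last ?zs = v" using xs(1) eq by (auto simp: hpath_def)
    qed
    fix e assume "consec xs e" "e \<noteq> {a, b}"
    then have "consec (ps @ [a]) e \<or> consec (b # qs) e"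
      using consec_append[of "ps @ [a]" "b # qs" e] unfolding xs' by auto
    then show "consec ?zs e"
      using consec_append[of "ps @ [a]" "ys @ (b # qs)" e] consec_append[of ys "b # qs" e] by auto
  qed
  from xs(2) show ?thesis
  proof (cases rule: consec_split)
    case (1 ps qs)
    show ?thesis by (rule *[OF ys E(2) sympD[OF E(1,3)] 1])
  next
    case (2 ps qs)
    have "hpath E W (rev ys) b' a'" using ys E(1) by (rule hpath_rev)
    from *[OF this E(3) sympD[OF E(1,2)] 2] show ?thesis by (simp add: insert_commute)
  qed
qed

section \<open>Hamilton cycles of the hypercube\<close>

definition tog :: "'a \<Rightarrow> 'a set \<Rightarrow> 'a set" where
  "tog x A = (if x \<in> A then A - {x} else insert x A)"

lemma mem_tog: "y \<in> tog x A \<longleftrightarrow> (if y = x then x \<notin> A else y \<in> A)"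
  by (auto simp: tog_def)

lemma tog_tog [simp]: "tog x (tog x A) = A"
  by (auto simp: mem_tog split: if_splits)

definition cube :: "'a set \<Rightarrow> 'a set \<Rightarrow> 'a set \<Rightarrow> bool" where
  "cube X A B \<longleftrightarrow> (\<exists>x\<in>X. B = tog x A)"

lemma cube_tog: "x \<in> X \<Longrightarrow> cube X A (tog x A)" "x \<in> X \<Longrightarrow> cube X (tog x A) A"
  unfolding cube_def by (blast, metis tog_tog)

lemma symp_cube: "symp (cube X)"
  by (auto simp: symp_def cube_def intro: cube_tog[unfolded cube_def])

text \<open>Traverses a Hamilton path of the smaller cube, taking the edge in direction \<open>q\<close> at every vertex.\<close>

fun zigzag :: "'a \<Rightarrow> bool \<Rightarrow> 'a set list \<Rightarrow> 'a set list" where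
  "zigzag q l [] = []"
| "zigzag q l (B # Bs) =
    (if l then [insert q B, B] else [B, insert q B]) @ zigzag q (\<not> l) Bs"

lemma zigzag_Nil [simp]: "zigzag q l Bs = [] \<longleftrightarrow> Bs = []"
  by (cases Bs) auto

lemma hd_zigzag: "Bs \<noteq> [] \<Longrightarrow> hd (zigzag q l Bs) = (if l then insert q (hd Bs) else hd Bs)"
  by (cases Bs) auto

lemma last_zigzag:
  "Bs \<noteq> [] \<Longrightarrow> last (zigzag q l Bs) = (if l = even (length Bs) then insert q (last Bs) else last Bs)"
proof (induction Bs arbitrary: l)
  case (Cons B Bs)
  show ?case
  proof (cases "Bs = []")
    case True
    then show ?thesis by simp
  next
    case False
    then have "last (zigzag q l (B # Bs)) = last (zigzag q (\<not> l) Bs)" by simp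
    with Cons.IH[OF False, of "\<not> l"] False show ?thesis by simp
  qed
qed simp

lemma set_zigzag: "set (zigzag q l Bs) = set Bs \<union> insert q ` set Bs"
  by (induction q l Bs rule: zigzag.induct) auto

lemma distinct_zigzag:
  "distinct Bs \<Longrightarrow> \<forall>B\<in>set Bs. q \<notin> B \<Longrightarrow> distinct (zigzag q l Bs)"
proof (induction q l Bs rule: zigzag.induct)
  case (2 q l B Bs)
  have "B \<notin> set Bs \<union> insert q ` set Bs" "B \<noteq> insert q B" using 2(2,3) by auto
  moreover have "insert q B \<notin> set Bs" using 2(3) by auto
  moreover have "insert q B \<notin> insert q ` set Bs"
  proof
    assume "insert q B \<in> insert q ` set Bs"
    then obtain C where C: "C \<in> set Bs" "insert q B = insert q C" by blast
    then have "B = C" using 2(3) by (simp add: insert_ident)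
    then show False using C(1) 2(2) by simp
  qed
  ultimately show ?case using 2 by (simp add: set_zigzag)
qed simp

lemma successively_zigzag:
  "successively (cube X) Bs \<Longrightarrow> \<forall>B\<in>set Bs. q \<notin> B \<Longrightarrow> q \<notin> X \<Longrightarrow>
     successively (cube (insert q X)) (zigzag q l Bs)"
proof (induction q l Bs rule: zigzag.induct)
  case (2 q l B Bs)
  have "cube (insert q X) B (insert q B)" "cube (insert q X) (insert q B) B"
    using 2(3) by (auto simp: cube_def tog_def)
  moreover have "cube (insert q X) B (hd Bs)" "cube (insert q X) (insert q B) (insert q (hd Bs))"
    if "Bs \<noteq> []"
  proof -
    have "cube X B (hd Bs)" using 2(2) that by (cases Bs) auto
    then obtain x where x: "x \<in> X" "hd Bs = tog x B" by (auto simp: cube_def)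
    then show "cube (insert q X) B (hd Bs)" by (auto simp: cube_def)
    have "insert q (hd Bs) = tog x (insert q B)" using x 2(4)
      by (auto simp: mem_tog split: if_splits)
    then show "cube (insert q X) (insert q B) (insert q (hd Bs))" using x by (auto simp: cube_def)
  qed
  moreover have "successively (cube X) Bs" using 2(2) by (cases Bs) auto
  ultimately show ?case
    using 2(1,3,4) by (cases "Bs = []") (auto simp: successively_append_iff hd_zigzag
      successively_Cons)
qed auto

lemma consec_zigzag: "B \<in> set Bs \<Longrightarrow> consec (zigzag q l Bs) {B, insert q B}"
proof (induction q l Bs rule: zigzag.induct)
  case (2 q l B' Bs)
  have "consec (if l then [insert q B', B'] else [B', insert q B']) {B', insert q B'}"
    unfolding consec_def by (cases l) (auto intro!: exI[of _ "[]"])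
  with 2 show ?case by (auto simp: consec_append)
qed auto

text \<open>Even length brings the zigzag back to the side in direction \<open>q\<close> on which it
  started, so its ends again differ in \<open>x\<close> alone. Every edge in direction
  \<open>q\<close> lies on it, since each vertex of the smaller cube is doubled.\<close>

lemma zigzag_hpath:
  assumes Bs: "hpath (cube (X - {q})) (Pow (X - {q})) Bs (A - {q}) (tog x (A - {q}))"
    and "even (length Bs)" "q \<in> X" "x \<noteq> q" "A \<subseteq> X"
  shows "hpath (cube X) (Pow X) (zigzag q (q \<in> A) Bs) A (tog x A)"
    and "even (length (zigzag q (q \<in> A) Bs))"
    and "B \<subseteq> X \<Longrightarrow> consec (zigzag q (q \<in> A) Bs) {B, tog q B}"
proof -
  have X: "insert q (X - {q}) = X" using assms(3) by auto
  have q: "\<forall>B\<in>set Bs. q \<notin> B" using Bs by (auto simp: hpath_def)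
  have "set (zigzag q (q \<in> A) Bs) = Pow X"
    using Bs Pow_insert[of q "X - {q}"] X by (auto simp: set_zigzag hpath_def)
  moreover have "last (zigzag q (q \<in> A) Bs) = tog x A"
    using Bs assms(2,4) by (auto simp: last_zigzag hpath_def mem_tog split: if_splits)
  moreover have "successively (cube X) (zigzag q (q \<in> A) Bs)"
    using successively_zigzag[of "X - {q}" Bs q] Bs q X by (auto simp: hpath_def)
  ultimately show "hpath (cube X) (Pow X) (zigzag q (q \<in> A) Bs) A (tog x A)"
    using Bs q by (auto simp: hpath_def hd_zigzag distinct_zigzag)
  show "even (length (zigzag q (q \<in> A) Bs))"
  proof -
    have "even (length (zigzag q l Bs))" for l
      by (induction q l Bs rule: zigzag.induct) auto
    then show ?thesis .
  qed
  assume "B \<subseteq> X"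
  then have "B - {q} \<in> set Bs" using Bs by (auto simp: hpath_def)
  then have "consec (zigzag q (q \<in> A) Bs) {B - {q}, insert q (B - {q})}" by (rule consec_zigzag)
  moreover have "{B - {q}, insert q (B - {q})} = {B, tog q B}" by (auto simp: tog_def)
  ultimately show "consec (zigzag q (q \<in> A) Bs) {B, tog q B}" by simp
qed

text \<open>Evenness of the length is carried along because the zigzag in the next dimension relies
  on it.\<close>

lemma ex_hpath_cube:
  assumes "finite X" "x \<in> X" "A \<subseteq> X"
  shows "\<exists>Bs. hpath (cube X) (Pow X) Bs A (tog x A) \<and> even (length Bs)"
  using assms
proof (induction "card X" arbitrary: X A)
  case 0
  then show ?case by auto
next
  case (Suc n)
  show ?case
  proof (cases "X = {x}")
    case True
    then have "hpath (cube X) (Pow X) [A, tog x A] A (tog x A)"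
      using Suc.prems by (auto simp: hpath_def cube_def tog_def)
    then show ?thesis by (intro exI[of _ "[A, tog x A]"]) auto
  next
    case False
    then obtain q where q: "q \<in> X" "q \<noteq> x" using Suc.prems by auto
    have "\<exists>Bs. hpath (cube (X - {q})) (Pow (X - {q})) Bs (A - {q}) (tog x (A - {q})) \<and>
      even (length Bs)"
      using Suc.hyps(2) Suc.prems q by (intro Suc.hyps(1)) auto
    then show ?thesis using zigzag_hpath(1,2)[of X q _ A x] q Suc.prems by blast
  qed
qed

lemma hpath_all_parallel:
  assumes "finite X" "x \<in> X" "q \<in> X" "x \<noteq> q" "A \<subseteq> X"
  shows "\<exists>Bs. hpath (cube X) (Pow X) Bs A (tog x A) \<and> (\<forall>B. B \<subseteq> X \<longrightarrow> consec Bs {B, tog q B})"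
proof -
  obtain Bs where "hpath (cube (X - {q})) (Pow (X - {q})) Bs (A - {q}) (tog x (A - {q}))"
    "even (length Bs)"
    using ex_hpath_cube[of "X - {q}" x "A - {q}"] assms by auto
  from zigzag_hpath(1,3)[OF this] show ?thesis using assms by blast
qed

text \<open>The cycle from \<open>hpath_all_parallel\<close> whose closing edge joins
  \<open>B\<close> and \<open>tog y B\<close> is opened at the \<open>q\<close>-edge of
  \<open>A\<close> instead. The former closing edge is then on the path, and of the
  \<open>q\<close>-edges only that of \<open>A\<close> is lost.\<close>

lemma hpath_parallel_edge:
  assumes "finite X" "q \<in> X" "y \<in> X" "y \<noteq> q" "A \<subseteq> X" "B \<subseteq> X"
  shows "\<exists>Bs. hpath (cube X) (Pow X) Bs A (tog q A) \<and> consec Bs {B, tog y B} \<and>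
    (\<forall>C. C \<subseteq> X \<longrightarrow> {C, tog q C} \<noteq> {A, tog q A} \<longrightarrow> consec Bs {C, tog q C})"
proof -
  obtain Bs where Bs: "hpath (cube X) (Pow X) Bs B (tog y B)"
    and all: "\<And>C. C \<subseteq> X \<Longrightarrow> consec Bs {C, tog q C}"
    using hpath_all_parallel[of X y q B] assms by blast
  have main: "\<exists>Cs. hpath (cube X) (Pow X) Cs b a \<and> consec Cs {B, tog y B} \<and>
    (\<forall>C. C \<subseteq> X \<longrightarrow> {C, tog q C} \<noteq> {a, b} \<longrightarrow> consec Cs {C, tog q C})"
    if eq: "Bs = ps @ a # b # qs" for ps a b qs
  proof (intro exI conjI allI impI)
    let ?Cs = "(b # qs) @ (ps @ [a])"
    have ends: "last (b # qs) = tog y B" "hd (ps @ [a]) = B"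
      using Bs eq by (auto simp: hpath_def hd_append)
    have "cube X (tog y B) B" using assms(3) by (rule cube_tog)
    moreover have "successively (cube X) (ps @ [a])" "successively (cube X) (b # qs)"
      using Bs successively_append_iff[of "cube X" "ps @ [a]" "b # qs"] eq unfolding hpath_def
        by auto
    ultimately have "successively (cube X) ?Cs"
      using ends unfolding successively_append_iff by simp
    moreover have "distinct ?Cs" "set ?Cs = Pow X" using Bs eq by (auto simp: hpath_def)
    ultimately show "hpath (cube X) (Pow X) ?Cs b a" unfolding hpath_def by simp
    show "consec ?Cs {B, tog y B}"
      unfolding consec_append ends by (simp add: insert_commute)
    fix C assume "C \<subseteq> X" "{C, tog q C} \<noteq> {a, b}"
    then have "consec ((ps @ [a]) @ (b # qs)) {C, tog q C}" "{C, tog q C} \<noteq> {a, b}"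
      using all eq by auto
    then show "consec ?Cs {C, tog q C}"
      using consec_append[of "ps @ [a]" "b # qs" "{C, tog q C}"]
        consec_append[of "b # qs" "ps @ [a]" "{C, tog q C}"] by auto
  qed
  from all[OF \<open>A \<subseteq> X\<close>] show ?thesis
  proof (cases rule: consec_split)
    case (1 ps qs)
    from main[OF 1] obtain Cs where Cs: "hpath (cube X) (Pow X) Cs (tog q A) A"
      "consec Cs {B, tog y B}" "\<forall>C. C \<subseteq> X \<longrightarrow> {C, tog q C} \<noteq> {A, tog q A} \<longrightarrow> consec Cs {C, tog q C}"
      by blast
    then show ?thesis
      using hpath_rev[OF Cs(1) symp_cube] by (intro exI[of _ "rev Cs"]) (simp add: consec_rev)
  next
    case (2 ps qs)
    from main[OF 2] show ?thesis by (simp add: insert_commute)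
  qed
qed

text \<open>\<open>K\<close> and \<open>q\<close> occupy at most three of the at least four
  directions. A further direction \<open>y\<close> yields two different \<open>q\<close>-edges with
  an end in the subcube, at \<open>k\<close> and at \<open>insert y k\<close>, and \<open>e\<close>
  is at most one of them.\<close>

lemma ex_subcube_edge:
  assumes "finite X" "4 \<le> card X" "K \<subseteq> X" "card K \<le> 2" "k \<subseteq> K" "q \<in> X"
  shows "\<exists>B. B \<subseteq> X \<and> B \<inter> K = k \<and> {B, tog q B} \<noteq> e"
proof -
  have fK: "finite K" using assms finite_subset by blast
  have "card (insert q K) < card X" using assms fK by (simp add: card_insert_if)
  then have "\<not> X \<subseteq> insert q K" using card_mono[of "insert q K" X] fK by auto
  then obtain y where y: "y \<in> X" "y \<notin> insert q K" by blast
  have "insert y k \<notin> {k, tog q k}"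
    using y assms(5) by (auto simp: tog_def split: if_splits)
  then have "e \<noteq> {k, tog q k} \<or> e \<noteq> {insert y k, tog q (insert y k)}"
    by (metis insertI1)
  moreover have "k \<subseteq> X" "k \<inter> K = k" "insert y k \<subseteq> X" "insert y k \<inter> K = k" using y assms by auto
  ultimately show ?thesis by metis
qed

definition cedge :: "'a \<Rightarrow> 'a set \<Rightarrow> 'a set set" where
  "cedge x A = {A, tog x A}"

lemmas hpath_all_parallel_cedge = hpath_all_parallel[folded cedge_def]
lemmas hpath_parallel_edge_cedge = hpath_parallel_edge[folded cedge_def]
lemmas ex_subcube_edge_cedge = ex_subcube_edge[folded cedge_def]

text \<open>A direction outside \<open>K1\<close> and \<open>K2\<close> and different from
  \<open>d\<close> serves both children at once. The difficulty is that \<open>K1\<close>,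
  \<open>K2\<close> and \<open>d\<close> may exhaust all directions: then edges in direction
  \<open>d\<close> must be used too, and the one at \<open>A\<close> is missing from the path
  because it closes the cycle.\<close>

lemma hpath_two_subcubes:
  assumes X: "finite X" "4 \<le> card X" and A: "A \<subseteq> X" "d \<in> X"
    and K1: "K1 \<subseteq> X" "card K1 \<le> 2" "k1 \<subseteq> K1"
    and K2: "K2 \<subseteq> X" "card K2 \<le> 2" "k2 \<subseteq> K2"
  shows "\<exists>Bs B1 x1 B2 x2. hpath (cube X) (Pow X) Bs A (tog d A) \<and>
    B1 \<subseteq> X \<and> B1 \<inter> K1 = k1 \<and> x1 \<in> X - K1 \<and> consec Bs (cedge x1 B1) \<and>
    B2 \<subseteq> X \<and> B2 \<inter> K2 = k2 \<and> x2 \<in> X - K2 \<and> consec Bs (cedge x2 B2) \<and>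
    cedge x1 B1 \<noteq> cedge x2 B2"
proof -
  let ?P = "\<lambda>K1 k1 K2 k2 Bs B1 x1 B2 x2. hpath (cube X) (Pow X) Bs A (tog d A) \<and>
    B1 \<subseteq> X \<and> B1 \<inter> K1 = k1 \<and> x1 \<in> X - K1 \<and> consec Bs (cedge x1 B1) \<and>
    B2 \<subseteq> X \<and> B2 \<inter> K2 = k2 \<and> x2 \<in> X - K2 \<and> consec Bs (cedge x2 B2) \<and>
    cedge x1 B1 \<noteq> cedge x2 B2"
  have fin: "finite K1" "finite K2" using X K1 K2 finite_subset by blast+
  consider q where "q \<in> X" "q \<notin> K1 \<union> K2" "q \<noteq> d" | "X \<subseteq> insert d (K1 \<union> K2)" by blast
  then show ?thesis
  proof cases
    case 1
    obtain Bs where Bs: "hpath (cube X) (Pow X) Bs A (tog d A)"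
      "\<And>B. B \<subseteq> X \<Longrightarrow> consec Bs (cedge q B)"
      using hpath_all_parallel_cedge[of X d q A] X A 1 by blast
    obtain B1 where B1: "B1 \<subseteq> X" "B1 \<inter> K1 = k1" using K1 by (metis inf.absorb1 subset_trans)
    obtain B2 where "B2 \<subseteq> X" "B2 \<inter> K2 = k2" "cedge q B2 \<noteq> cedge q B1"
      using ex_subcube_edge_cedge[OF X K2 1(1), of "cedge q B1"] by auto
    with B1 Bs 1 have "?P K1 k1 K2 k2 Bs B1 q B2 q" by simp
    then show ?thesis by (intro exI)
  next
    case 2
    have card: "4 \<le> card (insert d (K1 \<union> K2))"
      using X(2) card_mono[OF _ 2] fin by force
    show ?thesis
    proof (cases "d \<in> K1 \<union> K2")
      case False
      have "\<not> X \<subseteq> {d}" using X card_mono[of "{d}" X] by auto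
      then obtain y where y: "y \<in> X" "y \<noteq> d" by blast
      obtain Bs where Bs: "hpath (cube X) (Pow X) Bs A (tog d A)"
        "\<And>C. C \<subseteq> X \<Longrightarrow> cedge d C \<noteq> cedge d A \<Longrightarrow> consec Bs (cedge d C)"
        using hpath_parallel_edge_cedge[of X d y A A] X A y by blast
      \<comment> \<open>Both ends of a \<open>d\<close>-edge agree on \<open>K\<close>, so different
        traces on \<open>K\<close> certify different edges.\<close>
      have mem: "B \<inter> K = C \<inter> K" if "cedge d B = cedge d C" "d \<notin> K" for B C K
      proof -
        have "B = C \<or> B = tog d C" using that(1) by (auto simp: cedge_def doubleton_eq_iff)
        then show ?thesis using that(2) by (auto simp: tog_def split: if_splits)
      qed
      have dK: "d \<notin> K1" "d \<notin> K2" using False by auto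
      show ?thesis
      proof (cases "A \<inter> K1 = k1")
        case True
        have "\<not> K1 \<subseteq> K2"
        proof
          assume "K1 \<subseteq> K2"
          then have "card (insert d (K1 \<union> K2)) \<le> 3"
            using K2(2) fin by (simp add: card_insert_if sup.absorb2)
          with card show False by simp
        qed
        then obtain x where x: "x \<in> K1" "x \<notin> K2" by blast
        \<comment> \<open>\<open>x\<close> is used to spoil the trace on \<open>K1\<close>: the edge
          at \<open>B2\<close> then leaves the first subcube, which contains both \<open>A\<close>
          and \<open>B1\<close>.\<close>
        define B2 where "B2 = (if x \<in> k1 then k2 else insert x k2)"
        have B2: "B2 \<subseteq> X" "B2 \<inter> K2 = k2" "B2 \<inter> K1 \<noteq> k1"
          using x K1 K2 by (auto simp: B2_def)
        obtain B1 where B1: "B1 \<subseteq> X" "B1 \<inter> K1 = k1" "cedge d B1 \<noteq> cedge d A"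
          using ex_subcube_edge_cedge[OF X K1 A(2), of "cedge d A"] by auto
        have "cedge d B2 \<noteq> cedge d A" "cedge d B1 \<noteq> cedge d B2"
          using mem[of B2 A K1] mem[of B1 B2 K1] B1 B2 dK True by metis+
        with B1 B2 Bs A dK have "?P K1 k1 K2 k2 Bs B1 d B2 d" by simp
        then show ?thesis by (intro exI)
      next
        case False
        obtain B2 where B2: "B2 \<subseteq> X" "B2 \<inter> K2 = k2" "cedge d B2 \<noteq> cedge d A"
          using ex_subcube_edge_cedge[OF X K2 A(2), of "cedge d A"] by auto
        obtain B1 where B1: "B1 \<subseteq> X" "B1 \<inter> K1 = k1" "cedge d B1 \<noteq> cedge d B2"
          using ex_subcube_edge_cedge[OF X K1 A(2), of "cedge d B2"] by auto
        have "cedge d B1 \<noteq> cedge d A" using mem[of B1 A K1] B1 dK False by metis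
        with B1 B2 Bs A dK have "?P K1 k1 K2 k2 Bs B1 d B2 d" by simp
        then show ?thesis by (intro exI)
      qed
    next
      case True
      have disj: "K1 \<inter> K2 = {}"
      proof -
        have "card K1 + card K2 = card (K1 \<union> K2) + card (K1 \<inter> K2)" using fin by (rule card_Un_Int)
        moreover have "4 \<le> card (K1 \<union> K2)" using card True by (simp add: insert_absorb)
        ultimately have "card (K1 \<inter> K2) = 0" using K1 K2 by linarith
        then show ?thesis using fin by simp
      qed
      \<comment> \<open>\<open>K1\<close> and \<open>K2\<close> are disjoint, so \<open>d\<close> is
        fixed by one of the subcubes only. That one receives a single edge in another direction
        \<open>y\<close>, and the other receives a \<open>d\<close>-edge. Their directions differ,
        so the edges do.\<close>
      have *: "\<exists>Bs B1 x1 B2 x2. ?P K1 k1 K2 k2 Bs B1 x1 B2 x2"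
        if K1: "K1 \<subseteq> X" "card K1 \<le> 2" "k1 \<subseteq> K1" and K2: "K2 \<subseteq> X" "card K2 \<le> 2" "k2 \<subseteq> K2"
          and d: "d \<in> K1" "d \<notin> K2" for K1 k1 K2 k2
      proof -
        have "\<not> X \<subseteq> K1" using X K1 card_mono[of K1 X] finite_subset[OF K1(1) X(1)] by auto
        then obtain y where y: "y \<in> X" "y \<notin> K1" by blast
        have k1: "k1 \<subseteq> X" "k1 \<inter> K1 = k1" using K1 by auto
        obtain Bs where Bs: "hpath (cube X) (Pow X) Bs A (tog d A)" "consec Bs (cedge y k1)"
          "\<And>C. C \<subseteq> X \<Longrightarrow> cedge d C \<noteq> cedge d A \<Longrightarrow> consec Bs (cedge d C)"
          using hpath_parallel_edge_cedge[of X d y A k1] X A y d k1 by blast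
        obtain B2 where B2: "B2 \<subseteq> X" "B2 \<inter> K2 = k2" "cedge d B2 \<noteq> cedge d A"
          using ex_subcube_edge_cedge[OF X K2 A(2), of "cedge d A"] by auto
        have "cedge y k1 \<noteq> cedge d B2"
        proof
          assume eq: "cedge y k1 = cedge d B2"
          have "d \<in> k1 \<longleftrightarrow> d \<in> tog y k1" using y d by (auto simp: mem_tog)
          moreover have "d \<in> B2 \<longleftrightarrow> d \<notin> tog d B2" by (simp add: mem_tog)
          ultimately show False using eq unfolding cedge_def
            by (metis insertE insertI1 insertI2 singletonD)
        qed
        with Bs B2 k1 y A d have "?P K1 k1 K2 k2 Bs k1 y B2 d" by simp
        then show ?thesis by (intro exI)
      qed
      show ?thesis
      proof (cases "d \<in> K1")
        case True
        with disj show ?thesis using *[OF K1 K2] by blast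
      next
        case False
        with \<open>d \<in> K1 \<union> K2\<close> have "d \<in> K2" by blast
        from *[OF K2 K1 this False] obtain Bs B1 x1 B2 x2 where "?P K2 k2 K1 k1 Bs B1 x1 B2 x2"
          by (elim exE)
        then have "?P K1 k1 K2 k2 Bs B2 x2 B1 x1" by auto
        then show ?thesis by (intro exI)
      qed
    qed
  qed
qed

section \<open>Rotations of binary trees\<close>

datatype btree = BLeaf | BNode btree btree

inductive rot :: "btree \<Rightarrow> btree \<Rightarrow> bool" where
  rot_right: "rot (BNode (BNode a b) c) (BNode a (BNode b c))"
| rot_sym: "rot s t \<Longrightarrow> rot t s"
| rot_in_left: "rot s t \<Longrightarrow> rot (BNode s c) (BNode t c)"
| rot_in_right: "rot s t \<Longrightarrow> rot (BNode c s) (BNode c t)"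

lemma rot_left: "rot (BNode a (BNode b c)) (BNode (BNode a b) c)"
  by (rule rot_sym[OF rot_right])

fun to_bin :: "bool ctree \<Rightarrow> btree" where
  "to_bin Side = BLeaf"
| "to_bin (LTri t) = BNode BLeaf (to_bin t)"
| "to_bin (RTri t) = BNode (to_bin t) BLeaf"
| "to_bin (Quad i a b c) =
    (if i then BNode (to_bin a) (BNode (to_bin b) (to_bin c))
     else BNode (BNode (to_bin a) (to_bin b)) (to_bin c))"

definition tflip :: "bool ctree \<Rightarrow> bool ctree \<Rightarrow> bool" where
  "tflip s t \<longleftrightarrow> rot (to_bin s) (to_bin t)"

lemma symp_tflip: "symp tflip"
  by (auto simp: symp_def tflip_def intro: rot_sym)

lemma rot_to_bin_context:
  assumes "rot (to_bin s) (to_bin t)"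
  shows "rot (to_bin (LTri s)) (to_bin (LTri t))" "rot (to_bin (RTri s)) (to_bin (RTri t))"
    "rot (to_bin (Quad i s b c)) (to_bin (Quad i t b c))"
    "rot (to_bin (Quad i a s c)) (to_bin (Quad i a t c))"
    "rot (to_bin (Quad i a b s)) (to_bin (Quad i a b t))"
  using assms by (auto intro: rot_in_left rot_in_right)

fun labels :: "'a ctree \<Rightarrow> 'a list" where
  "labels Side = []"
| "labels (LTri t) = labels t"
| "labels (RTri t) = labels t"
| "labels (Quad x a b c) = x # labels a @ labels b @ labels c"

lemma map_ctree_cong_labels: "(\<And>x. x \<in> set (labels t) \<Longrightarrow> f x = g x) \<Longrightarrow> map_ctree f t = map_ctree g t"
  by (induction t) auto

lemma map_ctree_eqD: "map_ctree f t = map_ctree g t \<Longrightarrow> x \<in> set (labels t) \<Longrightarrow> f x = g x"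
  by (induction t) auto

lemma word_map [simp]: "word (map_ctree f t) = word t" by (induction t) auto

lemma move_labels:
  "move s K t \<Longrightarrow> set (labels s) = set (labels t) \<and> length (labels s) = length (labels t) \<and>
    fst ` set K \<subseteq> set (labels s) \<and> length K \<le> 2"
  by (induction rule: move.induct) (auto simp: image_image case_prod_unfold)

lemma move_distinct: "move s K t \<Longrightarrow> distinct (labels s) \<longleftrightarrow> distinct (labels t)"
  using move_labels by (metis card_distinct distinct_card)

text \<open>With the recorded bits, the monochromatic diagonals lie such that the two triangles at
  the bichromatic diagonal form exactly one rotation. Distinct labels keep these bits from affecting
  any other quadrilateral.\<close>

lemma move_tflip:
  assumes "move s K t" "distinct (labels s)"
    and "\<And>x i j. (x, i, j) \<in> set K \<Longrightarrow> v x = i \<and> v' x = j"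
    and "\<And>x. x \<notin> fst ` set K \<Longrightarrow> v x = v' x"
  shows "tflip (map_ctree v s) (map_ctree v' t)"
proof -
  have cong: "map_ctree v a = map_ctree v' a"
    if "fst ` set K \<inter> set (labels a) = {}" "\<And>x. x \<notin> fst ` set K \<Longrightarrow> v x = v' x"
    for K :: "('a \<times> bool \<times> bool) list" and a and v v' :: "'a \<Rightarrow> bool"
    using that by (intro map_ctree_cong_labels) blast
  have "rot (to_bin (map_ctree v s)) (to_bin (map_ctree v' t))"
    using assms
  proof (induction arbitrary: v v' rule: move.induct)
    case (LR t)
    have "map_ctree v t = map_ctree v' t" using LR by (intro cong[of "[]"]) auto
    then show ?case by (simp add: rot_left)
  next
    case (LQ x a b c)
    note c = cong[of "[(x, True, True)]" _ v v', OF _ LQ(3)]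
    have "map_ctree v a = map_ctree v' a" "map_ctree v b = map_ctree v' b" "map_ctree v c =
      map_ctree v' c"
      using LQ(1) by (auto intro!: c)
    moreover have "v x" "v' x" using LQ(2)[of x True True] by auto
    ultimately show ?case by (simp add: rot_left)
  next
    case (RQ x a b c)
    note c = cong[of "[(x, False, False)]" _ v v', OF _ RQ(3)]
    have "map_ctree v a = map_ctree v' a" "map_ctree v b = map_ctree v' b" "map_ctree v c =
      map_ctree v' c"
      using RQ(1) by (auto intro!: c)
    moreover have "\<not> v x" "\<not> v' x" using RQ(2)[of x False False] by auto
    ultimately show ?case by (simp add: rot_right)
  next
    case (Q12 x a b c)
    note c = cong[of "[(x, False, False)]" _ v v', OF _ Q12(3)]
    have "map_ctree v a = map_ctree v' a" "map_ctree v b = map_ctree v' b" "map_ctree v c =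
      map_ctree v' c"
      using Q12(1) by (auto intro!: c)
    moreover have "\<not> v x" "\<not> v' x" using Q12(2)[of x False False] by auto
    ultimately show ?case by (simp add: rot_in_left rot_right)
  next
    case (Q23 x a b c)
    note c = cong[of "[(x, True, True)]" _ v v', OF _ Q23(3)]
    have "map_ctree v a = map_ctree v' a" "map_ctree v b = map_ctree v' b" "map_ctree v c =
      map_ctree v' c"
      using Q23(1) by (auto intro!: c)
    moreover have "v x" "v' x" using Q23(2)[of x True True] by auto
    ultimately show ?case by (simp add: rot_in_right rot_right)
  next
    case (QQ12 x y a b c d e)
    note c = cong[of "[(x, False, False), (y, True, False)]" _ v v', OF _ QQ12(3)]
    have "map_ctree v a = map_ctree v' a" "map_ctree v b = map_ctree v' b" "map_ctree v c =
      map_ctree v' c"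
      "map_ctree v d = map_ctree v' d" "map_ctree v e = map_ctree v' e"
      using QQ12(1) by (auto intro!: c)
    moreover have "\<not> v x" "\<not> v' x" "v y" "\<not> v' y"
      using QQ12(2)[of x False False] QQ12(2)[of y True False] by auto
    ultimately show ?case by (auto intro!: rot_in_left rot_right)
  next
    case (QQ13 x y a b c d e)
    note c = cong[of "[(x, True, False), (y, False, True)]" _ v v', OF _ QQ13(3)]
    have "map_ctree v a = map_ctree v' a" "map_ctree v b = map_ctree v' b" "map_ctree v c =
      map_ctree v' c"
      "map_ctree v d = map_ctree v' d" "map_ctree v e = map_ctree v' e"
      using QQ13(1) by (auto intro!: c)
    moreover have "v x" "\<not> v' x" "\<not> v y" "v' y"
      using QQ13(2)[of x True False] QQ13(2)[of y False True] by auto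
    ultimately show ?case by (auto intro!: rot_right)
  next
    case (QQ23 x a y b c d e)
    note c = cong[of "[(x, True, True), (y, True, False)]" _ v v', OF _ QQ23(3)]
    have "map_ctree v a = map_ctree v' a" "map_ctree v b = map_ctree v' b" "map_ctree v c =
      map_ctree v' c"
      "map_ctree v d = map_ctree v' d" "map_ctree v e = map_ctree v' e"
      using QQ23(1) by (auto intro!: c)
    moreover have "v x" "v' x" "v y" "\<not> v' y"
      using QQ23(2)[of x True True] QQ23(2)[of y True False] by auto
    ultimately show ?case by (auto intro!: rot_in_right rot_right)
  next
    case (sym s K t)
    have "rot (to_bin (map_ctree v' s)) (to_bin (map_ctree v t))"
    proof (rule sym.IH)
      show "distinct (labels s)" using sym.hyps sym.prems(1) move_distinct by blast
      show "v' x = i \<and> v x = j" if "(x, i, j) \<in> set K" for x i j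
        using that sym.prems(2)[of x j i] by force
      show "v' x = v x" if "x \<notin> fst ` set K" for x
        using that sym.prems(3)[of x] by (force simp: image_image case_prod_unfold)
    qed
    then show ?case by (rule rot_sym)
  next
    case (in_Quad1 s K t x b c)
    have "fst ` set K \<subseteq> set (labels s)" using in_Quad1.hyps move_labels by blast
    moreover from this have "x \<notin> fst ` set K" using in_Quad1.prems(1) by auto
    moreover from calculation have "fst ` set K \<inter> set (labels b) =
      {}" "fst ` set K \<inter> set (labels c) = {}"
      using in_Quad1.prems(1) by auto
    ultimately have "map_ctree v b = map_ctree v' b" "map_ctree v c = map_ctree v' c" "v x = v' x"
      using cong[of K _ v v', OF _ in_Quad1.prems(3)] in_Quad1.prems(3)[of x] by auto
    then show ?case using rot_to_bin_context(3)[OF in_Quad1.IH[OF _ in_Quad1.prems(2,3)]]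
      in_Quad1.prems(1)
      by auto
  next
    case (in_Quad2 s K t x a c)
    have "fst ` set K \<subseteq> set (labels s)" using in_Quad2.hyps move_labels by blast
    moreover from this have "x \<notin> fst ` set K" using in_Quad2.prems(1) by auto
    moreover from calculation have "fst ` set K \<inter> set (labels a) =
      {}" "fst ` set K \<inter> set (labels c) = {}"
      using in_Quad2.prems(1) by auto
    ultimately have "map_ctree v a = map_ctree v' a" "map_ctree v c = map_ctree v' c" "v x = v' x"
      using cong[of K _ v v', OF _ in_Quad2.prems(3)] in_Quad2.prems(3)[of x] by auto
    then show ?case using rot_to_bin_context(4)[OF in_Quad2.IH[OF _ in_Quad2.prems(2,3)]]
      in_Quad2.prems(1)
      by auto
  next
    case (in_Quad3 s K t x a b)
    have "fst ` set K \<subseteq> set (labels s)" using in_Quad3.hyps move_labels by blast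
    moreover from this have "x \<notin> fst ` set K" using in_Quad3.prems(1) by auto
    moreover from calculation have "fst ` set K \<inter> set (labels a) =
      {}" "fst ` set K \<inter> set (labels b) = {}"
      using in_Quad3.prems(1) by auto
    ultimately have "map_ctree v a = map_ctree v' a" "map_ctree v b = map_ctree v' b" "v x = v' x"
      using cong[of K _ v v', OF _ in_Quad3.prems(3)] in_Quad3.prems(3)[of x] by auto
    then show ?case using rot_to_bin_context(5)[OF in_Quad3.IH[OF _ in_Quad3.prems(2,3)]]
      in_Quad3.prems(1)
      by auto
  qed (auto intro: rot_in_left rot_in_right)
  then show ?thesis by (simp add: tflip_def)
qed

lemma map_ctree_eq_simps:
  "map_ctree f s = Side \<longleftrightarrow> s = Side"
  "map_ctree f s = LTri t \<longleftrightarrow> (\<exists>u. s = LTri u \<and> map_ctree f u = t)"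
  "map_ctree f s = RTri t \<longleftrightarrow> (\<exists>u. s = RTri u \<and> map_ctree f u = t)"
  "map_ctree f s = Quad x a b c \<longleftrightarrow> (\<exists>x' a' b' c'. s = Quad x' a' b' c' \<and> f x' = x \<and>
     map_ctree f a' = a \<and> map_ctree f b' = b \<and> map_ctree f c' = c)"
  by (cases s; auto)+

text \<open>Together with \<open>ex_map_ctree\<close> this resolves preimages under
  \<open>map_ctree\<close> constructor by constructor, so that the witnesses in
  \<open>move_lift\<close> are found by assumption.\<close>

lemma all_map_ctree:
  "(\<forall>s. map_ctree f s = LTri t \<longrightarrow> P s) \<longleftrightarrow> (\<forall>u. map_ctree f u = t \<longrightarrow> P (LTri u))"
  "(\<forall>s. map_ctree f s = RTri t \<longrightarrow> P s) \<longleftrightarrow> (\<forall>u. map_ctree f u = t \<longrightarrow> P (RTri u))"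
  "(\<forall>s. map_ctree f s = Quad x a b c \<longrightarrow> P s) \<longleftrightarrow> (\<forall>a'. map_ctree f a' = a \<longrightarrow>
     (\<forall>b'. map_ctree f b' = b \<longrightarrow> (\<forall>c'. map_ctree f c' = c \<longrightarrow> (\<forall>x'. f x' = x \<longrightarrow> P (Quad x' a' b'
       c')))))"
  by (auto simp: map_ctree_eq_simps)

lemma ex_map_ctree:
  "(\<exists>s. map_ctree f s = LTri t \<and> P s) \<longleftrightarrow> (\<exists>u. map_ctree f u = t \<and> P (LTri u))"
  "(\<exists>s. map_ctree f s = RTri t \<and> P s) \<longleftrightarrow> (\<exists>u. map_ctree f u = t \<and> P (RTri u))"
  "(\<exists>s. map_ctree f s = Quad x a b c \<and> P s) \<longleftrightarrow> (\<exists>a'. map_ctree f a' = a \<and>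
     (\<exists>b'. map_ctree f b' = b \<and> (\<exists>c'. map_ctree f c' = c \<and> (\<exists>x'. f x' = x \<and> P (Quad x' a' b'
       c')))))"
  by (auto simp: map_ctree_eq_simps) blast

text \<open>A move carries the quadrilaterals along, so a labelling before the move induces one
  after it. Both directions are proved together because \<open>sym\<close> exchanges them.\<close>

lemma move_lift:
  fixes f :: "'a \<Rightarrow> 'b"
  assumes "move s0 K0 t0"
  shows "\<forall>s. map_ctree f s = s0 \<longrightarrow> (\<exists>t K. map_ctree f t = t0 \<and> move s K t)"
    and "\<forall>t. map_ctree f t = t0 \<longrightarrow> (\<exists>s K. map_ctree f s = s0 \<and> move t K s)"
proof -
  let ?L = "\<lambda>s0 t0. \<forall>s. map_ctree f s = s0 \<longrightarrow> (\<exists>t. map_ctree f t = t0 \<and> (\<exists>K. move s K t))"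
  let ?M = "\<lambda>(s :: 'a ctree) t. \<exists>K. move s K t"
  have rules: "\<And>t. ?M (LTri (RTri t)) (RTri (LTri t))"
    "\<And>x a b c. ?M (LTri (Quad x a b c)) (Quad x (LTri a) b c)"
    "\<And>x a b c. ?M (RTri (Quad x a b c)) (Quad x a b (RTri c))"
    "\<And>x a b c. ?M (Quad x (RTri a) b c) (Quad x a (LTri b) c)"
    "\<And>x a b c. ?M (Quad x a (RTri b) c) (Quad x a b (LTri c))"
    "\<And>x y a b c d e. ?M (Quad x (Quad y a b c) d e) (Quad x a (Quad y b c d) e)"
    "\<And>x y a b c d e. ?M (Quad x (Quad y a b c) d e) (Quad x a b (Quad y c d e))"
    "\<And>x y a b c d e. ?M (Quad x a (Quad y b c d) e) (Quad x a b (Quad y c d e))"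
    by (blast intro: move.intros)+
  have sym: "?M s t \<Longrightarrow> ?M t s" for s t by (blast intro: move.sym)
  have "?L s0 t0 \<and> ?L t0 s0" using assms
  proof (induction rule: move.induct)
    case (in_LTri s K t)
    then show ?case unfolding all_map_ctree ex_map_ctree by (blast intro: move.in_LTri)
  next
    case (in_RTri s K t)
    then show ?case unfolding all_map_ctree ex_map_ctree by (blast intro: move.in_RTri)
  next
    case (in_Quad1 s K t)
    then show ?case unfolding all_map_ctree ex_map_ctree by (blast intro: move.in_Quad1)
  next
    case (in_Quad2 s K t)
    then show ?case unfolding all_map_ctree ex_map_ctree by (blast intro: move.in_Quad2)
  next
    case (in_Quad3 s K t)
    then show ?case unfolding all_map_ctree ex_map_ctree by (blast intro: move.in_Quad3)
  next
    case (sym s K t) then show ?case by blast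
  next
    case (LR t)
    show ?case unfolding all_map_ctree ex_map_ctree
      by (intro conjI allI impI; (rule exI, rule conjI, assumption)+,
        (rule rules(1) | rule sym[OF rules(1)]))
  next
    case (LQ x a b c)
    show ?case unfolding all_map_ctree ex_map_ctree
      by (intro conjI allI impI; (rule exI, rule conjI, assumption)+,
        (rule rules(2) | rule sym[OF rules(2)]))
  next
    case (RQ x a b c)
    show ?case unfolding all_map_ctree ex_map_ctree
      by (intro conjI allI impI; (rule exI, rule conjI, assumption)+,
        (rule rules(3) | rule sym[OF rules(3)]))
  next
    case (Q12 x a b c)
    show ?case unfolding all_map_ctree ex_map_ctree
      by (intro conjI allI impI; (rule exI, rule conjI, assumption)+,
        (rule rules(4) | rule sym[OF rules(4)]))
  next
    case (Q23 x a b c)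
    show ?case unfolding all_map_ctree ex_map_ctree
      by (intro conjI allI impI; (rule exI, rule conjI, assumption)+,
        (rule rules(5) | rule sym[OF rules(5)]))
  next
    case (QQ12 x y a b c d e)
    show ?case unfolding all_map_ctree ex_map_ctree
      by (intro conjI allI impI; (rule exI, rule conjI, assumption)+,
        (rule rules(6) | rule sym[OF rules(6)]))
  next
    case (QQ13 x y a b c d e)
    show ?case unfolding all_map_ctree ex_map_ctree
      by (intro conjI allI impI; (rule exI, rule conjI, assumption)+,
        (rule rules(7) | rule sym[OF rules(7)]))
  next
    case (QQ23 x a y b c d e)
    show ?case unfolding all_map_ctree ex_map_ctree
      by (intro conjI allI impI; (rule exI, rule conjI, assumption)+,
        (rule rules(8) | rule sym[OF rules(8)]))
  qed
  then show "\<forall>s. map_ctree f s = s0 \<longrightarrow> (\<exists>t K. map_ctree f t = t0 \<and> move s K t)"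
    "\<forall>t. map_ctree f t = t0 \<longrightarrow> (\<exists>s K. map_ctree f s = s0 \<and> move t K s)" by blast+
qed

abbreviation shape :: "'a ctree \<Rightarrow> shape" where
  "shape \<equiv> map_ctree (\<lambda>_. ())"

text \<open>The forbidden set \<open>F\<close> strengthens the induction: the root and the three
  subtrees of a quadrilateral need disjoint labels.\<close>

lemma ex_labelling:
  fixes D :: shape
  assumes "finite F"
  shows "\<exists>s :: nat ctree. shape s = D \<and> distinct (labels s) \<and> set (labels s) \<inter> F = {}"
  using assms
proof (induction D arbitrary: F)
  case Side
  show ?case by (rule exI[of _ Side]) auto
next
  case (LTri t)
  from LTri.IH[OF LTri.prems] obtain s :: "nat ctree" where
    "shape s = t" "distinct (labels s)" "set (labels s) \<inter> F = {}" by blast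
  then show ?case by (intro exI[of _ "LTri s"]) auto
next
  case (RTri t)
  from RTri.IH[OF RTri.prems] obtain s :: "nat ctree" where
    "shape s = t" "distinct (labels s)" "set (labels s) \<inter> F = {}" by blast
  then show ?case by (intro exI[of _ "RTri s"]) auto
next
  case (Quad x a b c)
  obtain y where y: "y \<notin> F" using Quad.prems ex_new_if_finite by blast
  obtain a' :: "nat ctree" where a: "shape a' =
    a" "distinct (labels a')" "set (labels a') \<inter> insert y F = {}"
    using Quad.IH(1)[of "insert y F"] Quad.prems by blast
  obtain b' :: "nat ctree" where b: "shape b' = b" "distinct (labels b')"
      "set (labels b') \<inter> (insert y F \<union> set (labels a')) = {}"
    using Quad.IH(2)[of "insert y F \<union> set (labels a')"] Quad.prems by blast
  obtain c' :: "nat ctree" where c: "shape c' = c" "distinct (labels c')"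
      "set (labels c') \<inter> (insert y F \<union> set (labels a') \<union> set (labels b')) = {}"
    using Quad.IH(3)[of "insert y F \<union> set (labels a') \<union> set (labels b')"] Quad.prems by blast
  show ?case using y a b c by (intro exI[of _ "Quad y a' b' c'"]) auto
qed

section \<open>The hypercube over a shape\<close>

definition bits :: "'a ctree \<Rightarrow> 'a set \<Rightarrow> bool ctree" where
  "bits s A = map_ctree (\<lambda>x. x \<in> A) s"

definition fibre :: "shape \<Rightarrow> bool ctree set" where
  "fibre D = {t. shape t = D}"

lemma bits_in_fibre: "bits s A \<in> fibre (shape s)"
  by (simp add: bits_def fibre_def ctree.map_comp comp_def)

lemma inj_on_bits: "inj_on (bits s) (Pow (set (labels s)))"
proof (rule inj_onI)
  fix A B assume "A \<in> Pow (set (labels s))" "B \<in> Pow (set (labels s))" "bits s A = bits s B"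
  then show "A = B" using map_ctree_eqD[of "\<lambda>x. x \<in> A" s "\<lambda>x. x \<in> B"] unfolding bits_def by blast
qed

lemma bits_cong: "A \<inter> set (labels s) = B \<inter> set (labels s) \<Longrightarrow> bits s A = bits s B"
  unfolding bits_def by (rule map_ctree_cong_labels) blast

lemma fibre_eq_bits:
  assumes "distinct (labels s)"
  shows "fibre (shape s) = bits s ` Pow (set (labels s))"
proof
  show "bits s ` Pow (set (labels s)) \<subseteq> fibre (shape s)" using bits_in_fibre by blast
  have "\<exists>A \<subseteq> set (labels s). t = bits s A" if "shape t = shape s" for t :: "bool ctree"
    using that assms
  proof (induction s arbitrary: t)
    case (Quad x a b c)
    then obtain i a' b' c' where t: "t = Quad i a' b' c'" "shape a' = shape a" "shape b' = shape b"
      "shape c' = shape c" by (cases t) auto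
    obtain A where A: "A \<subseteq> set (labels a)" "a' = bits a A"
      using Quad.IH(1)[OF t(2)] Quad.prems(2) by auto
    obtain B where B: "B \<subseteq> set (labels b)" "b' = bits b B"
      using Quad.IH(2)[OF t(3)] Quad.prems(2) by auto
    obtain C where C: "C \<subseteq> set (labels c)" "c' = bits c C"
      using Quad.IH(3)[OF t(4)] Quad.prems(2) by auto
    let ?Z = "A \<union> B \<union> C \<union> (if i then {x} else {})"
    have "bits a A = bits a ?Z" "bits b B = bits b ?Z" "bits c C = bits c ?Z"
      using A B C Quad.prems(2) by (auto intro!: bits_cong)
    moreover have "i \<longleftrightarrow> x \<in> ?Z" using A B C Quad.prems(2) by auto
    ultimately have "t = bits (Quad x a b c) ?Z" using t A B C by (simp add: bits_def)
    moreover have "?Z \<subseteq> set (labels (Quad x a b c))" using A B C by auto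
    ultimately show ?case by blast
  next
    case Side
    then show ?case by (auto simp: bits_def map_ctree_eq_simps)
  next
    case (LTri s)
    then show ?case by (cases t) (auto simp: bits_def)
  next
    case (RTri s)
    then show ?case by (cases t) (auto simp: bits_def)
  qed
  then show "fibre (shape s) \<subseteq> bits s ` Pow (set (labels s))" unfolding fibre_def by blast
qed

lemma tflip_tog:
  assumes "x \<in> set (labels s)" "distinct (labels s)"
  shows "tflip (bits s A) (bits s (tog x A))"
proof -
  have "rot (to_bin (bits s A)) (to_bin (bits s (tog x A)))" using assms
  proof (induction s)
    case (Quad y a b c)
    have other: "bits t A = bits t (tog x A)" if "x \<notin> set (labels t)" for t
      using that by (intro bits_cong) (auto simp: mem_tog split: if_splits)
    have q: "bits (Quad y a b c) Z = Quad (y \<in> Z) (bits a Z) (bits b Z) (bits c Z)" for Z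
      by (simp add: bits_def)
    consider "x = y" | "x \<noteq> y" "x \<in> set (labels a)" | "x \<noteq> y" "x \<in> set (labels b)"
      | "x \<noteq> y" "x \<in> set (labels c)" using Quad.prems by auto
    then show ?case
    proof cases
      case 1
      then have "bits a A = bits a (tog x A)" "bits b A = bits b (tog x A)" "bits c A =
        bits c (tog x A)"
        using other[of a] other[of b] other[of c] Quad.prems by auto
      then show ?thesis using 1 unfolding q by (auto simp: mem_tog rot_left rot_right)
    next
      case 2
      then have "bits b A = bits b (tog x A)" "bits c A = bits c (tog x A)" "y \<in> A \<longleftrightarrow> y \<in> tog x A"
        using other[of b] other[of c] Quad.prems by (auto simp: mem_tog)
      then show ?thesis using rot_to_bin_context(3)[OF Quad.IH(1)] 2 Quad.prems unfolding q by auto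
    next
      case 3
      then have "bits a A = bits a (tog x A)" "bits c A = bits c (tog x A)" "y \<in> A \<longleftrightarrow> y \<in> tog x A"
        using other[of a] other[of c] Quad.prems by (auto simp: mem_tog)
      then show ?thesis using rot_to_bin_context(4)[OF Quad.IH(2)] 3 Quad.prems unfolding q by auto
    next
      case 4
      then have "bits a A = bits a (tog x A)" "bits b A = bits b (tog x A)" "y \<in> A \<longleftrightarrow> y \<in> tog x A"
        using other[of a] other[of b] Quad.prems by (auto simp: mem_tog)
      then show ?thesis using rot_to_bin_context(5)[OF Quad.IH(3)] 4 Quad.prems unfolding q by auto
    qed
  next
    case Side then show ?case by simp
  next
    case (LTri s) then show ?case by (auto simp: bits_def intro: rot_in_right)
  next
    case (RTri s) then show ?case by (auto simp: bits_def intro: rot_in_left)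
  qed
  then show ?thesis by (simp add: tflip_def)
qed

section \<open>Gluing the cubes\<close>

lemma move_keys: "move s K t \<Longrightarrow> distinct (labels s) \<Longrightarrow> distinct (map fst K)"
proof (induction rule: move.induct)
  case (sym s K t)
  then have "distinct (map fst K)" using move_distinct by blast
  then show ?case by (simp add: case_prod_unfold comp_def)
qed auto

lemma move_subcube:
  assumes "move s K t" "distinct (labels s)"
  shows "\<exists>J k k'. J \<subseteq> set (labels s) \<and> card J \<le> 2 \<and> k \<subseteq> J \<and> k' \<subseteq> J \<and>
    (\<forall>A. A \<inter> J = k \<longrightarrow> tflip (bits s A) (bits t ((A - J) \<union> k')))"
proof (intro exI conjI allI impI)
  let ?J = "fst ` set K"
  \<comment> \<open>The traces of the matched subcubes before and after the move. Keys in
    \<open>K\<close> are distinct, so each label has one recorded pair of bits.\<close>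
  let ?k = "{x. \<exists>j. (x, True, j) \<in> set K}" and ?k' = "{x. \<exists>i. (x, i, True) \<in> set K}"
  show "?J \<subseteq> set (labels s)" using move_labels[OF assms(1)] by blast
  show "card ?J \<le> 2"
    using move_labels[OF assms(1)] card_length[of "map fst K"] by simp
  show "?k \<subseteq> ?J" "?k' \<subseteq> ?J" by force+
  have uniq: "i = i' \<and> j = j'" if "(x, i, j) \<in> set K" "(x, i', j') \<in> set K" for x i j i' j'
    using that move_keys[OF assms] by (auto dest: eq_key_imp_eq_value)
  fix A assume A: "A \<inter> ?J = ?k"
  show "tflip (bits s A) (bits t ((A - ?J) \<union> ?k'))"
    unfolding bits_def
  proof (rule move_tflip[OF assms])
    fix x i j assume x: "(x, i, j) \<in> set K"
    then have "x \<in> ?J" by force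
    moreover have "(\<exists>j'. (x, True, j') \<in> set K) \<longleftrightarrow> i"
      using x by (cases i) (auto dest: uniq[OF x])
    moreover have "(\<exists>i'. (x, i', True) \<in> set K) \<longleftrightarrow> j"
      using x by (cases j) (auto dest: uniq[OF x])
    ultimately have "x \<in> ?J" "x \<in> ?k \<longleftrightarrow> i" "x \<in> ?k' \<longleftrightarrow> j" by simp_all
    then show "(x \<in> A) = i \<and> (x \<in> (A - ?J) \<union> ?k') = j" unfolding A[symmetric] by simp
  next
    fix x assume "x \<notin> ?J"
    moreover have "x \<notin> ?k'" using calculation by force
    ultimately show "(x \<in> A) = (x \<in> (A - ?J) \<union> ?k')" by blast
  qed
qed

lemma consec_map: "consec xs {a, b} \<Longrightarrow> consec (map f xs) {f a, f b}"
proof (erule consec_split)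
  fix ys zs assume "xs = ys @ a # b # zs"
  then have "map f xs = map f ys @ f a # f b # map f zs" by simp
  then show ?thesis unfolding consec_def by blast
next
  fix ys zs assume "xs = ys @ b # a # zs"
  then have "map f xs = map f ys @ f b # f a # map f zs" "{f a, f b} = {f b, f a}" by auto
  then show ?thesis unfolding consec_def by blast
qed

lemma hpath_bits:
  assumes "hpath (cube (set (labels s))) (Pow (set (labels s))) Bs A B" "distinct (labels s)"
  shows "hpath tflip (fibre (shape s)) (map (bits s) Bs) (bits s A) (bits s B)"
proof -
  have "successively (\<lambda>A B. tflip (bits s A) (bits s B)) Bs"
    using assms by (auto simp: hpath_def cube_def elim!: successively_mono intro: tflip_tog)
  then show ?thesis
    using assms inj_on_bits[of s]
    by (auto simp: hpath_def distinct_map fibre_eq_bits successively_map hd_map last_map)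
qed

lemma hpath_insert_option:
  assumes xs: "hpath E U xs u v" "consec xs {a, b}" and E: "symp E" and disj: "U \<inter> W = {}"
    and W: "W = {} \<or> (\<exists>ys a' b'. hpath E W ys a' b' \<and> E a a' \<and> E b b')"
  shows "\<exists>zs. hpath E (U \<union> W) zs u v \<and> (\<forall>e. consec xs e \<longrightarrow> e \<noteq> {a, b} \<longrightarrow> consec zs e)"
proof (cases "W = {}")
  case True
  then show ?thesis using xs(1) by (intro exI[of _ xs]) simp
next
  case False
  with W obtain ys a' b' where "hpath E W ys a' b'" "E a a'" "E b b'" by blast
  then show ?thesis using hpath_insert[OF xs _ E _ _ disj] by blast
qed

text \<open>Each shape carries the cube of its diagonal choices. A Hamilton cycle through a prescribed edge
  is represented by a Hamilton path between the ends of that edge.\<close>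

definition glues :: "shape \<Rightarrow> shape set \<Rightarrow> bool" where
  "glues a V \<longleftrightarrow> (\<forall>(s :: nat ctree) A d. shape s = a \<longrightarrow> distinct (labels s) \<longrightarrow> 4 \<le> length (labels s) \<longrightarrow>
     A \<subseteq> set (labels s) \<longrightarrow> d \<in> set (labels s) \<longrightarrow>
     (\<exists>xs. hpath tflip (\<Union> (fibre ` V)) xs (bits s A) (bits s (tog d A))))"

text \<open>What a child has to offer: every edge of the parent cube inside the subcube given by
  \<open>k\<close> on \<open>J\<close>, in a direction outside \<open>J\<close>, admits a detour
  through all fibres over \<open>V\<close>.\<close>

definition attachable :: "nat ctree \<Rightarrow> shape set \<Rightarrow> nat set \<Rightarrow> nat set \<Rightarrow> bool" where
  "attachable s V J k \<longleftrightarrow>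
    (\<forall>B x. B \<subseteq> set (labels s) \<longrightarrow> B \<inter> J = k \<longrightarrow> x \<in> set (labels s) - J \<longrightarrow>
      \<Union> (fibre ` V) = {} \<or> (\<exists>ys a' b'. hpath tflip (\<Union> (fibre ` V)) ys a' b' \<and>
        tflip (bits s B) a' \<and> tflip (bits s (tog x B)) b'))"

text \<open>Both ends of the edge flip into the child cube, and since \<open>x\<close> lies outside
  \<open>J\<close> their images differ in \<open>x\<close> again. They form the edge that is
  prescribed to the child.\<close>

lemma subcube_slot:
  fixes s :: "nat ctree"
  assumes V: "V = {} \<or> (\<exists>b. adj (shape s) b \<and> glues b V)"
    and s: "distinct (labels s)" "4 \<le> length (labels s)"
  shows "\<exists>J k. J \<subseteq> set (labels s) \<and> card J \<le> 2 \<and> k \<subseteq> J \<and>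
    attachable s V J k"
proof (cases "V = {}")
  case True
  then show ?thesis by (intro exI[of _ "{}"]) (simp add: attachable_def)
next
  case False
  with V obtain b K where b: "move (shape s) K b" "glues b V" by (auto simp: adj_def)
  from move_lift(1)[OF b(1)] obtain t K' where t: "shape t = b" "move s K' t" by blast
  note ml = move_labels[OF t(2)]
  have t': "distinct (labels t)" "4 \<le> length (labels t)" "set (labels t) = set (labels s)"
    using move_distinct[OF t(2)] ml s by simp_all
  obtain J k k' where
    J: "J \<subseteq> set (labels s)" "card J \<le> 2" "k \<subseteq> J" "k' \<subseteq> J"
    and tf: "\<forall>A. A \<inter> J = k \<longrightarrow> tflip (bits s A) (bits t ((A - J) \<union> k'))"
    using move_subcube[OF t(2) s(1)] by (elim exE conjE) (rule that)
  have ex: "\<exists>ys a' b'. hpath tflip (\<Union> (fibre ` V)) ys a' b' \<and>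
      tflip (bits s B) a' \<and> tflip (bits s (tog x B)) b'"
    if B: "B \<subseteq> set (labels s)" "B \<inter> J = k" and x: "x \<in> set (labels s) - J" for B x
  proof -
    let ?B = "(B - J) \<union> k'"
    have "tog x B \<inter> J = k" using B(2) x by (auto simp: tog_def)
    then have "tflip (bits s (tog x B)) (bits t ((tog x B - J) \<union> k'))" by (rule tf[rule_format])
    moreover have "(tog x B - J) \<union> k' = tog x ?B" using x J(4) by (auto simp: tog_def)
    ultimately have "tflip (bits s (tog x B)) (bits t (tog x ?B))" by simp
    moreover have "tflip (bits s B) (bits t ?B)" using B(2) by (rule tf[rule_format])
    moreover have "?B \<subseteq> set (labels t)" "x \<in> set (labels t)" using B x J t'(3) by auto
    then have "\<exists>ys. hpath tflip (\<Union> (fibre ` V)) ys (bits t ?B) (bits t (tog x ?B))"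
      using b(2) t(1) t'(1,2) unfolding glues_def by blast
    ultimately show ?thesis by blast
  qed
  then have "attachable s V J k" unfolding attachable_def by (intro allI impI disjI2)
  with J(1-3) show ?thesis by (intro exI conjI)
qed

lemma glues_node:
  assumes V: "V = {} \<or> (\<exists>b. adj a b \<and> glues b V)" and W: "W = {} \<or> (\<exists>b. adj a b \<and> glues b W)"
    and disj: "a \<notin> V" "a \<notin> W" "V \<inter> W = {}"
  shows "glues a (insert a (V \<union> W))"
  unfolding glues_def
proof (intro allI impI)
  fix s :: "nat ctree" and A d
  assume sh: "shape s = a" and s: "distinct (labels s)" "4 \<le> length (labels s)"
    and A: "A \<subseteq> set (labels s)" "d \<in> set (labels s)"
  let ?X = "set (labels s)" and ?F = "\<lambda>V. \<Union> (fibre ` V)"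
  have X: "finite ?X" "4 \<le> card ?X" using s by (simp_all add: distinct_card)
  obtain J1 k1 where J1: "J1 \<subseteq> ?X" "card J1 \<le> 2" "k1 \<subseteq> J1" and s1: "attachable s V J1 k1"
    using subcube_slot[OF V[folded sh] s] by (elim exE conjE) (rule that)
  obtain J2 k2 where J2: "J2 \<subseteq> ?X" "card J2 \<le> 2" "k2 \<subseteq> J2" and s2: "attachable s W J2 k2"
    using subcube_slot[OF W[folded sh] s] by (elim exE conjE) (rule that)
  from hpath_two_subcubes[OF X A J1 J2] obtain Bs B1 x1 B2 x2 where
    Bs: "hpath (cube ?X) (Pow ?X) Bs A (tog d A)" and
    B1: "B1 \<subseteq> ?X" "B1 \<inter> J1 = k1" "x1 \<in> ?X - J1" "consec Bs (cedge x1 B1)" and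
    B2: "B2 \<subseteq> ?X" "B2 \<inter> J2 = k2" "x2 \<in> ?X - J2" "consec Bs (cedge x2 B2)" and
    ne: "cedge x1 B1 \<noteq> cedge x2 B2" by (elim exE conjE) (rule that)
  let ?e = "\<lambda>x B. {bits s B, bits s (tog x B)}"
  have e: "?e x B = bits s ` cedge x B" for x B by (simp add: cedge_def)
  have "cedge x1 B1 \<subseteq> Pow ?X" "cedge x2 B2 \<subseteq> Pow ?X"
    using B1(1,3) B2(1,3) by (auto simp: cedge_def tog_def split: if_splits)
  then have ne': "?e x2 B2 \<noteq> ?e x1 B1"
    unfolding e using ne inj_on_image_eq_iff[OF inj_on_bits] by metis
  have p: "hpath tflip (fibre a) (map (bits s) Bs) (bits s A) (bits s (tog d A))"
    using hpath_bits[OF Bs s(1)] sh by simp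
  have c: "consec (map (bits s) Bs) (?e x1 B1)" "consec (map (bits s) Bs) (?e x2 B2)"
    using B1(4) B2(4) unfolding cedge_def by (auto intro: consec_map)
  have "fibre a \<inter> ?F V = {}" using disj(1) by (auto simp: fibre_def)
  from hpath_insert_option[OF p c(1) symp_tflip this s1[unfolded attachable_def, rule_format, OF
    B1(1-3)]] c(2) ne'
  obtain zs where zs: "hpath tflip (fibre a \<union> ?F V) zs (bits s A) (bits s (tog d A))"
    "consec zs (?e x2 B2)" by blast
  have "(fibre a \<union> ?F V) \<inter> ?F W = {}" using disj by (auto simp: fibre_def)
  from hpath_insert_option[OF zs symp_tflip this s2[unfolded attachable_def, rule_format, OF
    B2(1-3)]]
  show "\<exists>xs. hpath tflip (?F (insert a (V \<union> W))) xs (bits s A) (bits s (tog d A))"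
    by (auto simp: Un_assoc)
qed

lemma arb_glues: "arb adj a V \<Longrightarrow> glues a V"
  and "att adj a V \<Longrightarrow> V = {} \<or> (\<exists>b. adj a b \<and> glues b V)"
proof (induction rule: arb_att.inducts)
  case (arb_node a V W)
  then show ?case by (intro glues_node)
qed auto

text \<open>A quadrilateral replaces one bichromatic side by three, and triangles preserve their
  number. So nine bichromatic sides besides the root force four quadrilaterals.\<close>

lemma count_sides: "length (filter Not (word t)) = 2 * length (labels t) + 1"
  by (induction t) auto

lemma ctree_hamilton:
  assumes "spanned w" "9 \<le> length (filter Not w)"
  shows "\<exists>xs u v. hpath tflip {t :: bool ctree. word t = w} xs u v \<and> tflip v u \<and> 3 \<le> length xs"
proof -
  from assms(1) obtain a where a: "arb adj a (shapes w)" by (auto simp: spanned_def)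
  then have wa: "word a = w" using arb_root[OF a] by simp
  obtain s :: "nat ctree" where s: "shape s = a" "distinct (labels s)"
    using ex_labelling[of "{}" a] by auto
  have len: "4 \<le> length (labels s)"
    using count_sides[of s] assms(2) wa s(1) word_map[of "\<lambda>_. ()" s] by simp
  then obtain d where d: "d \<in> set (labels s)" by (cases "labels s") auto
  obtain xs where "hpath tflip (\<Union> (fibre ` shapes w)) xs (bits s {}) (bits s (tog d {}))"
    using arb_glues[OF a] s len d unfolding glues_def by blast
  moreover have "\<Union> (fibre ` shapes w) = {t. word t = w}"
  proof
    show "{t. word t = w} \<subseteq> \<Union> (fibre ` shapes w)"
    proof
      fix t :: "bool ctree" assume "t \<in> {t. word t = w}"
      then have "t \<in> fibre (shape t)" "shape t \<in> shapes w" by (auto simp: fibre_def)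
      then show "t \<in> \<Union> (fibre ` shapes w)" by blast
    qed
  qed (auto simp: fibre_def)
  ultimately have xs: "hpath tflip {t. word t = w} xs (bits s {}) (bits s (tog d {}))" by simp
  have fib: "bits s ` Pow (set (labels s)) \<subseteq> {t. word t = w}"
    using s wa by (auto simp: bits_def)
  have "card (Pow (set (labels s))) = card (bits s ` Pow (set (labels s)))"
    using inj_on_bits card_image by metis
  also have "\<dots> \<le> card (set xs)" using xs fib by (intro card_mono finite_set) (simp add: hpath_def)
  also have "\<dots> \<le> length xs" by (rule card_length)
  finally have "2 ^ length (labels s) \<le> length xs" using s(2) by (simp add: card_Pow distinct_card)
  moreover have "(2::nat) ^ 4 \<le> 2 ^ length (labels s)" using len by (intro power_increasing) auto
  ultimately have "3 \<le> length xs" by simp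
  moreover have "tflip (bits s (tog d {})) (bits s {})"
    using tflip_tog[OF d s(2)] symp_tflip by (auto dest: sympD)
  ultimately show ?thesis using xs by blast
qed

section \<open>Triangulations as binary trees\<close>

fun sz :: "btree \<Rightarrow> nat" where
  "sz BLeaf = 1"
| "sz (BNode l r) = sz l + sz r"

text \<open>The sides of the polygon are included, so that every subtree spans a subpolygon with its
  root segment as one side; \<open>tri\<close> removes the sides of the full polygon.\<close>

fun segs :: "nat \<Rightarrow> btree \<Rightarrow> nat set set" where
  "segs i BLeaf = {{i, i + 1}}"
| "segs i (BNode l r) = insert {i, i + sz l + sz r} (segs i l \<union> segs (i + sz l) r)"

lemma sz_pos [simp]: "0 < sz t" by (induction t) auto

lemma sz_neq_0 [simp]: "sz t \<noteq> 0" using sz_pos[of t] by linarith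

lemma segs_bounds: "e \<in> segs i t \<Longrightarrow> \<exists>a b. e = {a, b} \<and> i \<le> a \<and> a < b \<and> b \<le> i + sz t"
proof (induction t arbitrary: i)
  case (BNode l r)
  then consider "e = {i, i + sz l + sz r}" | "e \<in> segs i l" | "e \<in> segs (i + sz l) r" by auto
  then show ?case
  proof cases
    case 1
    then show ?thesis using sz_pos[of l] by (intro exI[of _ i] exI[of _ "i + sz l + sz r"]) auto
  next
    case 2
    then show ?thesis using BNode.IH(1) by fastforce
  next
    case 3
    from BNode.IH(2)[OF this] obtain a b where
      "e = {a, b}" "i + sz l \<le> a" "a < b" "b \<le> i + sz l + sz r" by blast
    then show ?thesis by (intro exI[of _ a] exI[of _ b]) auto
  qed
qed auto

lemma doubleton_less_iff: "a < b \<Longrightarrow> c < d \<Longrightarrow> {a, b} = {c, d} \<longleftrightarrow> a = c \<and> b = (d::nat)"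
  by (auto simp: doubleton_eq_iff)

lemma segs_pair: "a < b \<Longrightarrow> {a, b} \<in> segs i t \<Longrightarrow> i \<le> a \<and> b \<le> i + sz t"
  using segs_bounds[of "{a, b}" i t] by (metis doubleton_less_iff)

lemma segs_root: "{i, i + sz t} \<in> segs i t" by (cases t) (auto simp: add.assoc)

lemma segs_BNode_iff:
  assumes "a < b"
  shows "{a, b} \<in> segs i (BNode l r) \<longleftrightarrow>
    a = i \<and> b = i + sz l + sz r \<or> {a, b} \<in> segs i l \<or> {a, b} \<in> segs (i + sz l) r"
  using assms doubleton_less_iff[of a b i "i + sz l + sz r"] by simp

lemma segs_side: "i \<le> j \<Longrightarrow> j < i + sz t \<Longrightarrow> {j, j + 1} \<in> segs i t"
proof (induction t arbitrary: i)
  case (BNode l r)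
  then show ?case by (cases "j < i + sz l") auto
qed auto

lemma crossing_iff:
  assumes "a < b" "c < (d::nat)"
  shows "crossing {a, b} {c, d} \<longleftrightarrow> a < c \<and> c < b \<and> b < d \<or> c < a \<and> a < d \<and> d < b"
  unfolding crossing_def
proof (intro iffI)
  assume "\<exists>p q r s. p < q \<and> q < r \<and> r < s \<and>
     ({a, b} = {p, r} \<and> {c, d} = {q, s} \<or> {a, b} = {q, s} \<and> {c, d} = {p, r})"
  then obtain p q r s where "p < q" "q < r" "r < s"
    "{a, b} = {p, r} \<and> {c, d} = {q, s} \<or> {a, b} = {q, s} \<and> {c, d} = {p, r}" by blast
  then show "a < c \<and> c < b \<and> b < d \<or> c < a \<and> a < d \<and> d < b"
    using assms by (auto simp: doubleton_less_iff)
next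
  assume "a < c \<and> c < b \<and> b < d \<or> c < a \<and> a < d \<and> d < b"
  then show "\<exists>p q r s. p < q \<and> q < r \<and> r < s \<and>
     ({a, b} = {p, r} \<and> {c, d} = {q, s} \<or> {a, b} = {q, s} \<and> {c, d} = {p, r})" by blast
qed

lemma segs_noncrossing:
  "{a, b} \<in> segs i t \<Longrightarrow> {c, d} \<in> segs i t \<Longrightarrow> a < c \<Longrightarrow> c < b \<Longrightarrow> b < d \<Longrightarrow> False"
proof (induction t arbitrary: i)
  case (BNode l r)
  have lt: "a < b" "c < d" using BNode.prems by auto
  note 1 = BNode.prems(1)[unfolded segs_BNode_iff[OF lt(1)]]
    and 2 = BNode.prems(2)[unfolded segs_BNode_iff[OF lt(2)]]
  show ?case
    using 1 2 BNode.IH(1)[of i] BNode.IH(2)[of "i + sz l"] BNode.prems(3-5)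
      segs_pair[OF lt(1), of i l] segs_pair[OF lt(2), of i l]
      segs_pair[OF lt(1), of "i + sz l" r] segs_pair[OF lt(2), of "i + sz l" r]
    by (elim disjE) (auto; linarith)+
qed (auto simp: doubleton_eq_iff)

text \<open>A missing segment that straddles the apex \<open>i + sz l\<close> is crossed by a
  segment from the apex to one of the two ends of the root segment.\<close>

lemma segs_maximal:
  assumes "a < b" "i \<le> a" "b \<le> i + sz t" "{a, b} \<notin> segs i t"
  shows "\<exists>c d. c < d \<and> {c, d} \<in> segs i t \<and> crossing {a, b} {c, d}"
  using assms
proof (induction t arbitrary: i)
  case BLeaf
  then have "a = i" "b = i + 1" by auto
  with BLeaf show ?case by simp
next
  case (BNode l r)
  consider "b \<le> i + sz l" | "i + sz l \<le> a" | "a < i + sz l" "i + sz l < b" by linarith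
  then show ?case
  proof cases
    case 1
    then obtain c d where "c < d" "{c, d} \<in> segs i l" "crossing {a, b} {c, d}"
      using BNode.IH(1)[of i] BNode.prems by auto
    then show ?thesis by auto
  next
    case 2
    then obtain c d where "c < d" "{c, d} \<in> segs (i + sz l) r" "crossing {a, b} {c, d}"
      using BNode.IH(2)[of "i + sz l"] BNode.prems by (auto simp: add.assoc)
    then show ?thesis by auto
  next
    case 3
    show ?thesis
    proof (cases "i < a")
      case True
      then have "crossing {a, b} {i, i + sz l}" using 3 BNode.prems(1) by (simp add: crossing_iff)
      then show ?thesis using segs_root[of i l] by (intro exI[of _ i] exI[of _ "i + sz l"]) auto
    next
      case False
      then have "a = i" using BNode.prems by simp
      then have "b \<noteq> i + sz l + sz r" using BNode.prems by auto
      then have "crossing {a, b} {i + sz l, i + sz l + sz r}"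
        using 3 BNode.prems by (simp add: crossing_iff)
      then show ?thesis using segs_root[of "i + sz l" r]
        by (intro exI[of _ "i + sz l"] exI[of _ "i + sz l + sz r"]) auto
    qed
  qed
qed

lemma segs_left:
  "segs i l = {e \<in> segs i (BNode l r). e \<subseteq> {..i + sz l}}"
proof (intro set_eqI iffI)
  fix e assume e: "e \<in> segs i l"
  with segs_bounds[OF e] show "e \<in> {e \<in> segs i (BNode l r). e \<subseteq> {..i + sz l}}" by auto
next
  fix e assume e: "e \<in> {e \<in> segs i (BNode l r). e \<subseteq> {..i + sz l}}"
  moreover have "e \<noteq> {i, i + sz l + sz r}" using e by auto
  moreover have "e \<notin> segs (i + sz l) r"
  proof
    assume "e \<in> segs (i + sz l) r"
    then obtain a b where "e = {a, b}" "a < b" "i + sz l \<le> a" using segs_bounds by blast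
    with e show False by simp
  qed
  ultimately show "e \<in> segs i l" by auto
qed

lemma segs_right:
  "segs (i + sz l) r = {e \<in> segs i (BNode l r). e \<subseteq> {i + sz l..}}"
proof (intro set_eqI iffI)
  fix e assume e: "e \<in> segs (i + sz l) r"
  with segs_bounds[OF e] show "e \<in> {e \<in> segs i (BNode l r). e \<subseteq> {i + sz l..}}" by auto
next
  fix e assume e: "e \<in> {e \<in> segs i (BNode l r). e \<subseteq> {i + sz l..}}"
  moreover have "e \<noteq> {i, i + sz l + sz r}" using e by auto
  moreover have "e \<notin> segs i l"
  proof
    assume "e \<in> segs i l"
    then obtain a b where "e = {a, b}" "a < b" "b \<le> i + sz l" using segs_bounds by blast
    with e show False by simp
  qed
  ultimately show "e \<in> segs (i + sz l) r" by auto
qed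

text \<open>Two different split points would produce crossing segments. Once the split point is
  known, \<open>segs_left\<close> and \<open>segs_right\<close> cut out the subtrees by
  position.\<close>

lemma segs_inj: "segs i t = segs i t' \<Longrightarrow> sz t = sz t' \<Longrightarrow> t = t'"
proof (induction t arbitrary: i t')
  case BLeaf
  show ?case
  proof (cases t')
    case (BNode l r)
    then show ?thesis using BLeaf.prems(2) sz_pos[of l] sz_pos[of r] by simp
  qed simp
next
  case (BNode l r)
  obtain l' r' where t': "t' = BNode l' r'"
  proof (cases t')
    case BLeaf
    then show ?thesis using BNode.prems(2) sz_pos[of l] sz_pos[of r] by simp
  qed
  have in1: "{i, i + sz l} \<in> segs i (BNode l r)" "{i + sz l, i + sz l + sz r} \<in> segs i (BNode l r)"
    using segs_root[of i l] segs_root[of "i + sz l" r] by auto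
  have in2: "{i, i + sz l'} \<in> segs i (BNode l r)"
    "{i + sz l', i + sz l' + sz r'} \<in> segs i (BNode l r)"
    using segs_root[of i l'] segs_root[of "i + sz l'" r'] BNode.prems(1) unfolding t' by auto
  have sum: "sz l + sz r = sz l' + sz r'" using BNode.prems(2) t' by simp
  have "\<not> sz l < sz l'"
  proof
    assume "sz l < sz l'"
    then show False
      using sum sz_pos[of l] sz_pos[of r'] by (intro segs_noncrossing[OF in2(1) in1(2)]) linarith+
  qed
  moreover have "\<not> sz l' < sz l"
  proof
    assume "sz l' < sz l"
    then show False
      using sum sz_pos[of l'] sz_pos[of r] by (intro segs_noncrossing[OF in1(1) in2(2)]) linarith+
  qed
  ultimately have l: "sz l = sz l'" by simp
  then have r: "sz r = sz r'" using BNode.prems(2) t' by simp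
  have "segs i l = {e \<in> segs i (BNode l r). e \<subseteq> {..i + sz l}}" by (rule segs_left)
  also have "\<dots> = {e \<in> segs i (BNode l' r'). e \<subseteq> {..i + sz l'}}"
    using BNode.prems(1) l by (simp only: t')
  also have "\<dots> = segs i l'" by (rule segs_left[symmetric])
  finally have "segs i l = segs i l'" .
  moreover have "segs (i + sz l) r = segs (i + sz l) r'"
  proof -
    have "segs (i + sz l) r = {e \<in> segs i (BNode l r). e \<subseteq> {i + sz l..}}" by (rule segs_right)
    also have "\<dots> = {e \<in> segs i (BNode l' r'). e \<subseteq> {i + sz l'..}}"
      using BNode.prems(1) l by (simp only: t')
    also have "\<dots> = segs (i + sz l') r'" by (rule segs_right[symmetric])
    finally show ?thesis using l by simp
  qed
  ultimately show ?case using BNode.IH l r t' by blast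
qed

section \<open>Matching trees with maximal non-crossing sets of diagonals\<close>

lemma sides_iff:
  assumes "a < b" "1 \<le> a" "b \<le> N"
  shows "{a, b} \<in> sides N \<longleftrightarrow> b = a + 1 \<or> a = 1 \<and> b = N"
  using assms unfolding sides_def by (auto simp: doubleton_eq_iff)

lemma diagonals_iff:
  assumes "a < b"
  shows "{a, b} \<in> diagonals N \<longleftrightarrow> 1 \<le> a \<and> b \<le> N \<and> b \<noteq> a + 1 \<and> \<not> (a = 1 \<and> b = N)"
  (is "?l \<longleftrightarrow> ?r")
proof
  assume ?l
  then obtain i j where "{a, b} = {i, j}" "i \<in> {1..N}" "j \<in> {1..N}" "{a, b} \<notin> sides N"
    unfolding diagonals_def by blast
  then have "1 \<le> a" "b \<le> N" by (auto simp: doubleton_eq_iff)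
  then show ?r using \<open>{a, b} \<notin> sides N\<close> sides_iff[OF assms] by blast
next
  assume r: ?r
  then have "{a, b} \<notin> sides N" using sides_iff[OF assms] by blast
  moreover have "\<exists>i j. {a, b} = {i, j} \<and> i \<in> {1..N} \<and> j \<in> {1..N} \<and> i \<noteq> j"
    using r assms by (intro exI[of _ a] exI[of _ b]) auto
  ultimately show ?l unfolding diagonals_def by blast
qed

lemma diagonals_pair: "e \<in> diagonals N \<Longrightarrow> \<exists>a b. e = {a, b} \<and> a < b"
  unfolding diagonals_def by (auto simp: neq_iff)

lemma sides_pair: "2 \<le> N \<Longrightarrow> e \<in> sides N \<Longrightarrow> \<exists>a b. e = {a, b} \<and> a < b \<and> 1 \<le> a \<and> b \<le> N"
  unfolding sides_def
proof (elim UnE)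
  assume "e \<in> {{i, i + 1} |i. 1 \<le> i \<and> i < N}"
  then obtain i where "e = {i, i + 1}" "1 \<le> i" "i < N" by blast
  then show ?thesis by (intro exI[of _ i] exI[of _ "i + 1"]) simp
next
  assume N: "2 \<le> N" and "e \<in> {{N, 1}}"
  then show ?thesis by (intro exI[of _ 1] exI[of _ N]) auto
qed

lemma side_not_crossing:
  assumes "{a, b} \<in> sides N" "a < b" "1 \<le> a" "b \<le> N" "c < d" "1 \<le> c" "d \<le> N"
  shows "\<not> crossing {a, b} {c, d}"
  using assms sides_iff[of a b N] by (auto simp: crossing_iff)

lemma sides_subset_segs:
  assumes "sz t + 1 = N"
  shows "sides N \<subseteq> segs 1 t"
proof
  fix e assume e: "e \<in> sides N"
  have N: "2 \<le> N" using assms sz_pos[of t] by linarith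
  from sides_pair[OF N e] obtain a b where ab: "e = {a, b}" "a < b" "1 \<le> a" "b \<le> N" by blast
  with e sides_iff[of a b N] consider "b = a + 1" | "a = 1" "b = N" by blast
  then show "e \<in> segs 1 t"
  proof cases
    case 1
    then show ?thesis using ab assms segs_side[of 1 a t] by auto
  next
    case 2
    then show ?thesis using ab assms segs_root[of 1 t] by auto
  qed
qed

definition tri :: "nat \<Rightarrow> btree \<Rightarrow> nat set set" where
  "tri N t = segs 1 t - sides N"

lemma tri_Un_sides: "sz t + 1 = N \<Longrightarrow> sides N \<union> tri N t = segs 1 t"
  using sides_subset_segs unfolding tri_def by blast

lemma triangulation_tri:
  assumes "sz t + 1 = N"
  shows "triangulation N (tri N t)"
  unfolding triangulation_def
proof (intro conjI ballI)
  have pair: "\<exists>a b. e = {a, b} \<and> 1 \<le> a \<and> a < b \<and> b \<le> N" if "e \<in> segs 1 t" for e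
    using segs_bounds[OF that] assms by auto
  show "tri N t \<subseteq> diagonals N"
  proof
    fix e assume e: "e \<in> tri N t"
    then obtain a b where ab: "e = {a, b}" "1 \<le> a" "a < b" "b \<le> N"
      using pair unfolding tri_def by blast
    then show "e \<in> diagonals N"
      using e sides_iff[of a b N] diagonals_iff[of a b N] unfolding tri_def by blast
  qed
  fix e assume e: "e \<in> tri N t"
  fix f assume f: "f \<in> tri N t"
  from pair e obtain a b where ab: "e = {a, b}" "a < b" unfolding tri_def by blast
  from pair f obtain c d where cd: "f = {c, d}" "c < d" unfolding tri_def by blast
  show "\<not> crossing e f"
    using segs_noncrossing[of a b 1 t c d] segs_noncrossing[of c d 1 t a b] e f ab cd
    unfolding tri_def by (auto simp: crossing_iff)
next
  fix e assume e: "e \<in> diagonals N - tri N t"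
  then obtain a b where ab: "e = {a, b}" "a < b" using diagonals_pair by blast
  then have bd: "1 \<le> a" "b \<le> N" "{a, b} \<notin> sides N"
    using e diagonals_iff[of a b N] by (auto simp: diagonals_def)
  then have "{a, b} \<notin> segs 1 t" using e ab unfolding tri_def by blast
  then obtain c d where cd: "c < d" "{c, d} \<in> segs 1 t" "crossing {a, b} {c, d}"
    using segs_maximal[of a b 1 t] ab bd assms by auto
  have cd': "1 \<le> c" "d \<le> N" using segs_pair[OF cd(1,2)] assms by auto
  have "{c, d} \<notin> sides N"
  proof
    assume "{c, d} \<in> sides N"
    then have "\<not> crossing {c, d} {a, b}" using side_not_crossing cd(1) cd' ab(2) bd by blast
    then show False using cd(1,3) ab(2) by (auto simp: crossing_iff)
  qed
  then show "\<exists>f\<in>tri N t. crossing e f" using cd ab unfolding tri_def by blast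
qed

lemma tri_inj: "tri N t = tri N t' \<Longrightarrow> sz t + 1 = N \<Longrightarrow> sz t' + 1 = N \<Longrightarrow> t = t'"
  using tri_Un_sides[of t N] tri_Un_sides[of t' N] segs_inj[of 1 t t'] by auto

text \<open>The apex is the last neighbor \<open>k\<close> of \<open>i\<close> before
  \<open>j\<close>. A diagonal crossing \<open>{k, j}\<close> would cross \<open>{i, j}\<close> or
  \<open>{i, k}\<close>, or start at \<open>i\<close> and contradict the choice of
  \<open>k\<close>.\<close>

lemma triangulation_apex:
  assumes T: "triangulation N T" and S: "S = sides N \<union> T"
    and ij: "{i, j} \<in> S" "i + 1 < j" "1 \<le> i" "j \<le> N"
  shows "\<exists>k. i < k \<and> k < j \<and> {i, k} \<in> S \<and> {k, j} \<in> S"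
proof -
  let ?K = "{k. i < k \<and> k < j \<and> {i, k} \<in> S}"
  define k where "k = Max ?K"
  have fin: "finite ?K" by simp
  have "{i, i + 1} \<in> sides N" using sides_iff[of i "i + 1" N] ij by auto
  then have "i + 1 \<in> ?K" using ij S by auto
  then have "k \<in> ?K" unfolding k_def using fin Max_in by blast
  then have k: "i < k" "k < j" "{i, k} \<in> S" by auto
  have max: "m \<le> k" if "i < m" "m < j" "{i, m} \<in> S" for m
    unfolding k_def using that fin by (intro Max_ge) auto
  have nc: "\<not> crossing {a, b} {c, d}"
    if "{a, b} \<in> S" "{c, d} \<in> T" "a < b" "1 \<le> a" "b \<le> N" "c < d" for a b c d
  proof (cases "{a, b} \<in> sides N")
    case True
    have "{c, d} \<in> diagonals N" using T that unfolding triangulation_def by blast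
    then show ?thesis using True side_not_crossing that diagonals_iff[of c d N] by blast
  next
    case False
    then show ?thesis using that S T unfolding triangulation_def by blast
  qed
  have "{k, j} \<in> S"
  proof (rule ccontr)
    assume kj: "{k, j} \<notin> S"
    then have "{k, j} \<notin> sides N" using S by simp
    then have "{k, j} \<in> diagonals N - T"
      using kj S k ij sides_iff[of k j N] diagonals_iff[of k j N] by auto
    then obtain f where f: "f \<in> T" "crossing {k, j} f" using T unfolding triangulation_def by blast
    then obtain x y where xy: "f = {x, y}" "x < y" "1 \<le> x" "y \<le> N"
      using T diagonals_pair diagonals_iff unfolding triangulation_def by (metis subsetD)
    have "k < x \<and> x < j \<and> j < y \<or> x < k \<and> k < y \<and> y < j"
      using f xy k crossing_iff[of k j x y] by auto
    then show False
    proof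
      assume "k < x \<and> x < j \<and> j < y"
      then have "crossing {i, j} {x, y}" using k xy by (simp add: crossing_iff)
      then show False using nc[of i j x y] f xy ij by simp
    next
      assume a: "x < k \<and> k < y \<and> y < j"
      consider "x < i" | "x = i" | "i < x" by linarith
      then show False
      proof cases
        case 1
        then have "crossing {i, j} {x, y}" using a k xy by (simp add: crossing_iff)
        then show False using nc[of i j x y] f xy ij by simp
      next
        case 2
        then show False using max[of y] f xy S a k by auto
      next
        case 3
        then have "crossing {i, k} {x, y}" using a k xy by (simp add: crossing_iff)
        then show False using nc[of i k x y] f xy ij k by simp
      qed
    qed
  qed
  with k show ?thesis by blast
qed

lemma triangulation_noncrossing:
  assumes T: "triangulation N T" and S: "S = sides N \<union> T"
    and "{a, b} \<in> S" "{c, d} \<in> S" "1 \<le> a" "a < c" "c < b" "b < d" "d \<le> N"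
  shows False
proof -
  have cr: "crossing {a, b} {c, d}" "crossing {c, d} {a, b}" using assms
    by (auto simp: crossing_iff)
  have "\<not> {a, b} \<in> sides N" "\<not> {c, d} \<in> sides N"
    using cr side_not_crossing[of a b N c d] side_not_crossing[of c d N a b] assms by auto
  then show False using cr assms unfolding triangulation_def by blast
qed

lemma triangulation_pair:
  assumes "triangulation N T" "2 \<le> N" "e \<in> sides N \<union> T"
  shows "\<exists>a b. e = {a, b} \<and> 1 \<le> a \<and> a < b \<and> b \<le> N"
proof (cases "e \<in> sides N")
  case True
  then show ?thesis using sides_pair[OF assms(2)] by blast
next
  case False
  then have "e \<in> diagonals N" using assms unfolding triangulation_def by blast
  moreover from this obtain a b where "e = {a, b}" "a < b" using diagonals_pair by blast
  ultimately show ?thesis using diagonals_iff[of a b N] by auto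
qed

lemma triangulation_subtree:
  assumes T: "triangulation N T" and S: "S = sides N \<union> T"
    and "{i, j} \<in> S" "i < j" "1 \<le> i" "j \<le> N"
  shows "\<exists>t. sz t = j - i \<and> segs i t = {e \<in> S. e \<subseteq> {i..j}}"
  using assms(3-)
proof (induction "j - i" arbitrary: i j rule: less_induct)
  case less
  have N: "2 \<le> N" using less.prems by simp
  have pair: "\<exists>a b. e = {a, b} \<and> i \<le> a \<and> a < b \<and> b \<le> j" if e: "e \<in> S" "e \<subseteq> {i..j}" for e
  proof -
    obtain a b where "e = {a, b}" "a < b" using triangulation_pair[OF T N, of e] e(1) S by blast
    then show ?thesis using e(2) by (intro exI[of _ a] exI[of _ b]) simp
  qed
  show ?case
  proof (cases "j = i + 1")
    case True
    have "{e \<in> S. e \<subseteq> {i..j}} = {{i, i + 1}}"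
    proof (intro set_eqI iffI)
      fix e assume "e \<in> {e \<in> S. e \<subseteq> {i..j}}"
      then obtain a b where "e = {a, b}" "i \<le> a" "a < b" "b \<le> j" using pair by blast
      then show "e \<in> {{i, i + 1}}" using True by (auto simp: le_Suc_eq)
    qed (use less.prems True in auto)
    then show ?thesis using True by (intro exI[of _ BLeaf]) simp
  next
    case False
    then have "i + 1 < j" using less.prems by linarith
    then obtain k where k: "i < k" "k < j" "{i, k} \<in> S" "{k, j} \<in> S"
      using triangulation_apex[OF T S less.prems(1) _ less.prems(3,4)] by blast
    have lt: "k - i < j - i" "k \<le> N" "j - k < j - i" "1 \<le> k" using k less.prems by linarith+
    obtain l where l: "sz l = k - i" "segs i l = {e \<in> S. e \<subseteq> {i..k}}"
      using less.hyps[OF lt(1) k(3,1) less.prems(3) lt(2)] by blast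
    obtain r where r: "sz r = j - k" "segs k r = {e \<in> S. e \<subseteq> {k..j}}"
      using less.hyps[OF lt(3) k(4,2) lt(4) less.prems(4)] by blast
    have "segs i (BNode l r) = insert {i, j} ({e \<in> S. e \<subseteq> {i..k}} \<union> {e \<in> S. e \<subseteq> {k..j}})"
      using l r k by simp
    also have "\<dots> = {e \<in> S. e \<subseteq> {i..j}}"
    proof (intro set_eqI iffI)
      fix e assume e: "e \<in> {e \<in> S. e \<subseteq> {i..j}}"
      then obtain a b where ab: "e = {a, b}" "i \<le> a" "a < b" "b \<le> j" using pair by blast
      have ab': "{a, b} \<in> S" "1 \<le> a" "b \<le> N" using e ab less.prems by auto
      have "\<not> (a < k \<and> k < b \<and> i < a)"
        using triangulation_noncrossing[OF T S k(3) ab'(1) less.prems(3)] ab'(3) by blast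
      moreover have "\<not> (a < k \<and> k < b \<and> b < j)"
        using triangulation_noncrossing[OF T S ab'(1) k(4) ab'(2)] less.prems(4) by blast
      ultimately have "b \<le> k \<or> k \<le> a \<or> a = i \<and> b = j" using ab by linarith
      then show "e \<in> insert {i, j} ({e \<in> S. e \<subseteq> {i..k}} \<union> {e \<in> S. e \<subseteq> {k..j}})"
        using e ab by auto
    next
      fix e assume "e \<in> insert {i, j} ({e \<in> S. e \<subseteq> {i..k}} \<union> {e \<in> S. e \<subseteq> {k..j}})"
      moreover have "{i, j} \<subseteq> {i..j}" "{i..k} \<subseteq> {i..j}" "{k..j} \<subseteq> {i..j}" using k by simp_all
      ultimately show "e \<in> {e \<in> S. e \<subseteq> {i..j}}" using less.prems(1) by blast
    qed
    finally show ?thesis using l r k by (intro exI[of _ "BNode l r"]) simp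
  qed
qed

lemma triangulation_ex_tree:
  assumes T: "triangulation N T" and N: "2 \<le> N"
  shows "\<exists>t. sz t + 1 = N \<and> tri N t = T"
proof -
  have "{1, N} \<in> sides N \<union> T" using sides_iff[of 1 N N] N by auto
  then obtain t where t: "sz t = N - 1" "segs 1 t = {e \<in> sides N \<union> T. e \<subseteq> {1..N}}"
    using triangulation_subtree[OF T refl, of 1 N] N by auto
  have "{e \<in> sides N \<union> T. e \<subseteq> {1..N}} = sides N \<union> T"
    using triangulation_pair[OF T N] by fastforce
  moreover have "sides N \<inter> T = {}" using T unfolding triangulation_def diagonals_def by blast
  ultimately have "tri N t = T" unfolding tri_def t(2) by blast
  then show ?thesis using t(1) N by (intro exI[of _ t]) simp
qed

section \<open>Rotations are flips\<close>

text \<open>\<open>e\<close> and \<open>f\<close> are the two diagonals of the quadrilateral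
  \<open>a\<close>, \<open>b\<close>, \<open>c\<close>, \<open>d\<close>. Comparing the segment sets
  after deleting both makes the condition symmetric, as reversed rotations require.\<close>

definition exchange :: "nat \<Rightarrow> btree \<Rightarrow> btree \<Rightarrow> nat \<Rightarrow> nat \<Rightarrow> nat \<Rightarrow> nat \<Rightarrow> nat set \<Rightarrow> nat set \<Rightarrow> bool"
  where "exchange i s t a b c d e f \<longleftrightarrow>
    a < b \<and> b < c \<and> c < d \<and> i \<le> a \<and> d \<le> i + sz s \<and>
    (e = {a, c} \<and> f = {b, d} \<or> e = {b, d} \<and> f = {a, c}) \<and> e \<in> segs i s \<and> f \<in> segs i t \<and>
    {{a, b}, {b, c}, {c, d}, {a, d}} \<subseteq> segs i s \<inter> segs i t \<and> segs i s - {e} = segs i t - {f}"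

lemma exchange_bounds:
  assumes "exchange i s t a b c d e f" "g = e \<or> g = f"
  shows "\<exists>x y. g = {x, y} \<and> x < y \<and> i \<le> x \<and> y \<le> i + sz s"
proof -
  have lt: "a < b" "b < c" "c < d" "i \<le> a" "d \<le> i + sz s" and "g = {a, c} \<or> g = {b, d}"
    using assms by (auto simp: exchange_def)
  then consider "g = {a, c}" | "g = {b, d}" by blast
  then show ?thesis
  proof cases
    case 1
    then show ?thesis using lt by (intro exI[of _ a] exI[of _ c]) simp
  next
    case 2
    then show ?thesis using lt by (intro exI[of _ b] exI[of _ d]) simp
  qed
qed

lemma Un_Diff_exchange:
  "X - {e} = X' - {f} \<Longrightarrow> e \<notin> Y \<Longrightarrow> f \<notin> Y \<Longrightarrow> (X \<union> Y) - {e} = (X' \<union> Y) - {f}"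
  by blast

lemma rot_sz: "rot s t \<Longrightarrow> sz s = sz t"
  by (induction rule: rot.induct) auto

lemma rot_exchange:
  assumes "rot s t"
  shows "\<exists>a b c d e f. exchange i s t a b c d e f"
  using assms
proof (induction arbitrary: i rule: rot.induct)
  case (rot_right a b c)
  let ?p = "i + sz a" and ?q = "i + sz a + sz b" and ?r = "i + sz a + sz b + sz c"
  have lt: "i < ?p" "?p < ?q" "?q < ?r" by simp_all
  have out: "{i, ?q} \<notin> segs i a" "{i, ?q} \<notin> segs ?p b" "{i, ?q} \<notin> segs ?q c"
    using segs_pair[of i ?q i a] segs_pair[of i ?q ?p b] segs_pair[of i ?q ?q c] lt by auto
  have out': "{?p, ?r} \<notin> segs i a" "{?p, ?r} \<notin> segs ?p b" "{?p, ?r} \<notin> segs ?q c"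
    using segs_pair[of ?p ?r i a] segs_pair[of ?p ?r ?p b] segs_pair[of ?p ?r ?q c] lt by auto
  have ne: "{i, ?q} \<noteq> {i, ?r}" "{?p, ?r} \<noteq> {i, ?r}" using lt by (auto simp: doubleton_eq_iff)
  let ?U = "segs i a \<union> segs ?p b \<union> segs ?q c"
  have U: "segs i (BNode (BNode a b) c) = insert {i, ?r} (insert {i, ?q} ?U)"
    "segs i (BNode a (BNode b c)) = insert {i, ?r} (insert {?p, ?r} ?U)"
    by (simp_all add: add.assoc Un_assoc)
  have "segs i (BNode (BNode a b) c) - {{i, ?q}} = segs i (BNode a (BNode b c)) - {{?p, ?r}}"
    unfolding U using out out' ne by (simp add: insert_Diff_if)
  moreover have "{{i, ?p}, {?p, ?q}, {?q, ?r}, {i, ?r}} \<subseteq>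
      segs i (BNode (BNode a b) c) \<inter> segs i (BNode a (BNode b c))"
    unfolding U using segs_root[of i a] segs_root[of ?p b] segs_root[of ?q c] by simp
  moreover have "{i, ?q} \<in> segs i (BNode (BNode a b) c)" "{?p, ?r} \<in> segs i (BNode a (BNode b c))"
    unfolding U by simp_all
  moreover have "?r \<le> i + sz (BNode (BNode a b) c)" by simp
  ultimately have "exchange i (BNode (BNode a b) c) (BNode a (BNode b c)) i ?p ?q ?r {i, ?q} {?p, ?r}"
    unfolding exchange_def using lt by (intro conjI disjI1 refl le_refl)
  then show ?case by (intro exI)
next
  case (rot_sym s t)
  then obtain a b c d e f where "exchange i s t a b c d e f" by blast
  then have "exchange i t s a b c d f e"
    using rot_sz[OF rot_sym.hyps] by (auto simp: exchange_def)
  then show ?case by (intro exI)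
next
  case (rot_in_left s t u)
  then obtain a b c d e f where ex: "exchange i s t a b c d e f" by blast
  have out: "g \<notin> insert {i, i + sz s + sz u} (segs (i + sz s) u)" if g: "g = e \<or> g = f" for g
  proof -
    obtain x y where "g = {x, y}" "x < y" "y \<le> i + sz s" using exchange_bounds[OF ex g] by blast
    then show ?thesis
      using segs_pair[of x y "i + sz s" u] doubleton_less_iff[of x y i "i + sz s + sz u"] by auto
  qed
  let ?Y = "insert {i, i + sz s + sz u} (segs (i + sz s) u)"
  have Y: "segs i (BNode s u) = segs i s \<union> ?Y" "segs i (BNode t u) = segs i t \<union> ?Y"
    using rot_sz[OF rot_in_left.hyps] by auto
  have "(segs i s \<union> ?Y) - {e} = (segs i t \<union> ?Y) - {f}"
    using ex out[of e] out[of f] unfolding exchange_def by (intro Un_Diff_exchange) simp_all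
  then have "exchange i (BNode s u) (BNode t u) a b c d e f"
    using ex unfolding exchange_def Y by auto
  then show ?case by (intro exI)
next
  case (rot_in_right s t u)
  then obtain a b c d e f where ex: "exchange (i + sz u) s t a b c d e f" by blast
  have out: "g \<notin> insert {i, i + sz u + sz s} (segs i u)" if g: "g = e \<or> g = f" for g
  proof -
    obtain x y where "g = {x, y}" "x < y" "i + sz u \<le> x" using exchange_bounds[OF ex g] by blast
    then show ?thesis
      using segs_pair[of x y i u] doubleton_less_iff[of x y i "i + sz u + sz s"] by auto
  qed
  let ?Y = "insert {i, i + sz u + sz s} (segs i u)"
  have Y: "segs i (BNode u s) = segs (i + sz u) s \<union> ?Y" "segs i (BNode u t) = segs (i + sz u) t \<union>
    ?Y"
    using rot_sz[OF rot_in_right.hyps] by auto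
  have "(segs (i + sz u) s \<union> ?Y) - {e} = (segs (i + sz u) t \<union> ?Y) - {f}"
    using ex out[of e] out[of f] unfolding exchange_def by (intro Un_Diff_exchange) simp_all
  then have "exchange i (BNode u s) (BNode u t) a b c d e f"
    using ex unfolding exchange_def Y by auto
  then show ?case by (intro exI)
qed

lemma rot_flip:
  assumes "rot s t" "sz s + 1 = N"
  shows "flip N (tri N s) (tri N t)"
proof -
  obtain a b c d e f where
    q: "a < b" "b < c" "c < d" "1 \<le> a" "d \<le> 1 + sz s" and
    ef: "e = {a, c} \<and> f = {b, d} \<or> e = {b, d} \<and> f = {a, c}" "e \<in> segs 1 s" "f \<in> segs 1 t"
    "{{a, b}, {b, c}, {c, d}, {a, d}} \<subseteq> segs 1 s \<inter> segs 1 t" "segs 1 s - {e} = segs 1 t - {f}"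
    using rot_exchange[OF assms(1), of 1] unfolding exchange_def by (elim conjE exE) (rule that)
  have ns: "{a, c} \<notin> sides N" "{b, d} \<notin> sides N"
    using q assms(2) sides_iff[of a c N] sides_iff[of b d N] by auto
  have T': "tri N t = (tri N s - {e}) \<union> {f}"
    unfolding tri_def using ef(1,3,5) ns by blast
  have eT: "e \<in> tri N s" unfolding tri_def using ef(1,2) ns by blast
  have tr: "{x, y, z} \<in> triangles N (tri N s)"
    if "x < y" "y < z" "{x, y} \<in> segs 1 s" "{y, z} \<in> segs 1 s" "{x, z} \<in> segs 1 s" for x y z
    unfolding triangles_def tri_Un_sides[OF assms(2)] using that by blast
  have sg: "{a, b} \<in> segs 1 s" "{b, c} \<in> segs 1 s" "{c, d} \<in> segs 1 s" "{a, d} \<in> segs 1 s"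
    using ef(4) by simp_all
  have lt: "a < c" "b < d" using q by simp_all
  from ef(1) show ?thesis
  proof
    assume e: "e = {a, c} \<and> f = {b, d}"
    then have "{a, c} \<in> segs 1 s" using ef(2) by simp
    then have "{a, b, c} \<in> triangles N (tri N s)" "{a, c, d} \<in> triangles N (tri N s)"
      using tr[OF q(1,2)] tr[OF lt(1) q(3)] sg by blast+
    moreover have "{a, c} \<in> tri N s" "tri N t = (tri N s - {{a, c}}) \<union> {{b, d}}"
      using e eT T' by simp_all
    moreover have "distinct [a, b, c, d]" using q by simp
    ultimately show ?thesis unfolding flip_def by blast
  next
    assume e: "e = {b, d} \<and> f = {a, c}"
    then have "{b, d} \<in> segs 1 s" using ef(2) by simp
    then have "{b, c, d} \<in> triangles N (tri N s)" "{a, b, d} \<in> triangles N (tri N s)"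
      using tr[OF q(2,3)] tr[OF q(1) lt(2)] sg by blast+
    \<comment> \<open>\<open>flip\<close> lists the quadrilateral cyclically from an end of the
      removed diagonal, hence the shift to \<open>b, c, d, a\<close>.\<close>
    moreover have "{a, b, d} = {b, d, a}" by auto
    ultimately have "{b, c, d} \<in> triangles N (tri N s)" "{b, d, a} \<in> triangles N (tri N s)"
      by simp_all
    moreover have "{b, d} \<in> tri N s" "tri N t = (tri N s - {{b, d}}) \<union> {{c, a}}"
      using e eT T' by (simp_all add: insert_commute)
    moreover have "distinct [b, c, d, a]" using q by simp
    ultimately show ?thesis unfolding flip_def by blast
  qed
qed

section \<open>Colors\<close>

fun mixed :: "(nat \<Rightarrow> color) \<Rightarrow> nat \<Rightarrow> btree \<Rightarrow> bool" where
  "mixed c i BLeaf \<longleftrightarrow> True"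
| "mixed c i (BNode l r) \<longleftrightarrow>
    \<not> (c i = c (i + sz l) \<and> c i = c (i + sz l + sz r)) \<and> mixed c i l \<and> mixed c (i + sz l) r"

text \<open>A 3-cycle of segments lies in one subtree or straddles the split point. In the latter
  case its longest segment is the root segment, and its middle corner is the split point, as
  otherwise one of its shorter segments would straddle it too.\<close>

lemma mixed_triangle:
  assumes "mixed c i t" "x < y" "y < z" "{x, y} \<in> segs i t" "{y, z} \<in> segs i t" "{x, z} \<in> segs i t"
  shows "\<not> (c x = c y \<and> c x = c z)"
  using assms
proof (induction t arbitrary: i)
  case BLeaf
  then show ?case
    using doubleton_less_iff[of x y i "i + 1"] doubleton_less_iff[of y z i "i + 1"] by simp
next
  case (BNode l r)
  let ?m = "i + sz l"
  have xz: "x < z" using BNode.prems by simp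
  note iff = segs_BNode_iff[of _ _ i l r]
  have L: "a < b \<Longrightarrow> {a, b} \<in> segs i l \<Longrightarrow> b \<le> ?m" for a b using segs_pair[of a b i l] by simp
  have R: "a < b \<Longrightarrow> {a, b} \<in> segs ?m r \<Longrightarrow> ?m \<le> a" for a b using segs_pair[of a b ?m r] by simp
  have l': "a < b \<Longrightarrow> {a, b} \<in> segs i (BNode l r) \<Longrightarrow> b \<le> ?m \<Longrightarrow> {a, b} \<in> segs i l" for a b
    using iff[of a b] R[of a b] sz_pos[of r] by auto
  have r': "a < b \<Longrightarrow> {a, b} \<in> segs i (BNode l r) \<Longrightarrow> ?m \<le> a \<Longrightarrow> {a, b} \<in> segs ?m r" for a b
    using iff[of a b] L[of a b] sz_pos[of l] by auto
  have root: "a < b \<Longrightarrow> {a, b} \<in> segs i (BNode l r) \<Longrightarrow> a < ?m \<Longrightarrow> ?m < b \<Longrightarrow> a = i \<and> b = ?m + sz r" for a b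
    using iff[of a b] L[of a b] R[of a b] by auto
  consider "z \<le> ?m" | "?m \<le> x" | "x < ?m" "?m < z" by linarith
  then show ?case
  proof cases
    case 1
    have "y \<le> ?m" "mixed c i l" using 1 BNode.prems(1,3) by simp_all
    then show ?thesis
      using BNode.IH(1)[OF _ BNode.prems(2,3)] l'[OF BNode.prems(2,4)] l'[OF BNode.prems(3,5)]
        l'[OF xz BNode.prems(6)] 1 by blast
  next
    case 2
    have "?m \<le> y" "mixed c ?m r" using 2 BNode.prems(1,2) by simp_all
    then show ?thesis
      using BNode.IH(2)[OF _ BNode.prems(2,3)] r'[OF BNode.prems(2,4)] r'[OF BNode.prems(3,5)]
        r'[OF xz BNode.prems(6)] 2 by blast
  next
    case 3
    then have ends: "x = i" "z = ?m + sz r" using root[OF xz BNode.prems(6)] by blast+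
    have "\<not> y < ?m" using root[OF BNode.prems(3,5)] 3 ends BNode.prems(2) by blast
    moreover have "\<not> ?m < y" using root[OF BNode.prems(2,4)] 3 ends BNode.prems(3) by blast
    ultimately have "y = ?m" by simp
    then show ?thesis using BNode.prems(1) ends by simp
  qed
qed

lemma mixed_if_triangles:
  assumes "\<And>x y z. x < y \<Longrightarrow> y < z \<Longrightarrow> {x, y} \<in> segs i t \<Longrightarrow> {y, z} \<in> segs i t \<Longrightarrow> {x, z} \<in> segs i t \<Longrightarrow>
    \<not> (c x = c y \<and> c x = c z)"
  shows "mixed c i t"
  using assms
proof (induction t arbitrary: i)
  case (BNode l r)
  let ?m = "i + sz l"
  have "mixed c i l" by (rule BNode.IH(1), rule BNode.prems) simp_all
  moreover have "mixed c ?m r" by (rule BNode.IH(2), rule BNode.prems) simp_all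
  moreover have "\<not> (c i = c ?m \<and> c i = c (?m + sz r))"
    using segs_root[of i l] segs_root[of ?m r] by (intro BNode.prems) auto
  ultimately show ?case by simp
qed simp

lemma colorful_tri:
  assumes "sz t + 1 = sum_list \<alpha>"
  shows "colorful \<alpha> (tri (sum_list \<alpha>) t) \<longleftrightarrow> mixed (point_color \<alpha>) 1 t"
proof
  let ?c = "point_color \<alpha>" and ?N = "sum_list \<alpha>"
  assume col: "colorful \<alpha> (tri ?N t)"
  show "mixed ?c 1 t"
  proof (rule mixed_if_triangles)
    fix x y z :: nat
    assume "x < y" "y < z" "{x, y} \<in> segs 1 t" "{y, z} \<in> segs 1 t" "{x, z} \<in> segs 1 t"
    then have "{x, y, z} \<in> triangles ?N (tri ?N t)"
      unfolding triangles_def tri_Un_sides[OF assms] by blast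
    then have "\<not> (\<exists>k. \<forall>p\<in>{x, y, z}. ?c p = k)" using col unfolding colorful_def by blast
    then show "\<not> (?c x = ?c y \<and> ?c x = ?c z)" by auto
  qed
next
  let ?c = "point_color \<alpha>" and ?N = "sum_list \<alpha>"
  assume mx: "mixed ?c 1 t"
  show "colorful \<alpha> (tri ?N t)"
    unfolding colorful_def
  proof
    fix \<tau> assume "\<tau> \<in> triangles ?N (tri ?N t)"
    then obtain x y z where "\<tau> = {x, y, z}" "x < y" "y < z"
      "{x, y} \<in> segs 1 t" "{y, z} \<in> segs 1 t" "{x, z} \<in> segs 1 t"
      unfolding triangles_def tri_Un_sides[OF assms] by blast
    moreover from this have "\<not> (?c x = ?c y \<and> ?c x = ?c z)" by (intro mixed_triangle[OF mx])
    ultimately show "\<not> (\<exists>k. \<forall>p\<in>\<tau>. ?c p = k)" by auto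
  qed
qed

section \<open>Colorful triangulations and the word of a tree\<close>

definition side_word :: "(nat \<Rightarrow> color) \<Rightarrow> nat \<Rightarrow> nat \<Rightarrow> bool list" where
  "side_word c i n = map (\<lambda>j. c j = c (j + 1)) [i..<i + n]"

lemma side_word_add: "side_word c i (m + n) = side_word c i m @ side_word c (i + m) n"
  using upt_add_eq_append[of i "i + m" n] by (simp add: side_word_def add.assoc)

lemma side_word_1: "side_word c i (Suc 0) = [c i = c (i + 1)]"
  by (simp add: side_word_def)

lemma length_side_word [simp]: "length (side_word c i n) = n"
  by (simp add: side_word_def)

lemma sz_to_bin [simp]: "sz (to_bin s) = length (word s)"
  by (induction s) auto

lemma color_cases: "(a :: color) \<noteq> b \<Longrightarrow> d = a \<or> d = b"
  by (cases a; cases b; cases d) auto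

text \<open>Every subtree spans a bichromatic segment. So the corners of a quadrilateral alternate
  in color, and neither of its diagonals creates a monochromatic triangle.\<close>

lemma mixed_to_bin:
  assumes "word s = side_word c i (length (word s))"
  shows "c i \<noteq> c (i + length (word s)) \<and> mixed c i (to_bin s)"
  using assms
proof (induction s arbitrary: i)
  case Side
  then show ?case by (simp add: side_word_1)
next
  case (LTri s)
  then have "True # word s = [c i = c (i + 1)] @ side_word c (i + 1) (length (word s))"
    using side_word_add[of c i "Suc 0" "length (word s)"] by (simp add: side_word_1)
  then have "c i = c (i + 1)" "word s = side_word c (i + 1) (length (word s))" by auto
  with LTri.IH[of "i + 1"] show ?case by simp
next
  case (RTri s)
  let ?n = "length (word s)"
  have "word s @ [True] = side_word c i ?n @ [c (i + ?n) = c (i + ?n + 1)]"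
    using RTri.prems side_word_add[of c i ?n "Suc 0"] by (simp add: side_word_1)
  then have "c (i + ?n) = c (i + ?n + 1)" "word s = side_word c i ?n" by auto
  with RTri.IH[of i] show ?case by auto
next
  case (Quad x s1 s2 s3)
  let ?n1 = "length (word s1)" and ?n2 = "length (word s2)" and ?n3 = "length (word s3)"
  have "word s1 @ word s2 @ word s3 =
      side_word c i ?n1 @ side_word c (i + ?n1) ?n2 @ side_word c (i + ?n1 + ?n2) ?n3"
    using Quad.prems side_word_add[of c i ?n1 "?n2 + ?n3"] side_word_add[of c "i + ?n1" ?n2 ?n3]
      by simp
  then have "word s1 = side_word c i ?n1" "word s2 = side_word c (i + ?n1) ?n2"
    "word s3 = side_word c (i + ?n1 + ?n2) ?n3" by simp_all
  with Quad.IH(1)[of i] Quad.IH(2)[of "i + ?n1"] Quad.IH(3)[of "i + ?n1 + ?n2"]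
  have "c i \<noteq> c (i + ?n1)" "c (i + ?n1) \<noteq> c (i + ?n1 + ?n2)"
    "c (i + ?n1 + ?n2) \<noteq> c (i + ?n1 + ?n2 + ?n3)"
    and m: "mixed c i (to_bin s1)" "mixed c (i + ?n1) (to_bin s2)"
      "mixed c (i + ?n1 + ?n2) (to_bin s3)"
    by blast+
  then have eq: "c (i + ?n1 + ?n2) = c i" "c (i + ?n1 + ?n2 + ?n3) = c (i + ?n1)"
    and ne: "c i \<noteq> c (i + ?n1)" "c (i + ?n1) \<noteq> c i"
    using color_cases[of "c (i + ?n1)" "c i" "c (i + ?n1 + ?n2)"]
      color_cases[of "c (i + ?n1)" "c i" "c (i + ?n1 + ?n2 + ?n3)"] by fastforce+
  have sz: "sz (to_bin s1) = ?n1" "sz (to_bin s2) = ?n2" "sz (to_bin s3) = ?n3" by simp_all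
  have ar: "i + ?n1 + (?n2 + ?n3) = i + ?n1 + ?n2 + ?n3" "i + (?n1 + ?n2) = i + ?n1 + ?n2"
    "i + length (word (Quad x s1 s2 s3)) = i + ?n1 + ?n2 + ?n3" by simp_all
  have "mixed c i (to_bin (Quad x s1 s2 s3))"
  proof (cases x)
    case True
    show ?thesis
      unfolding to_bin.simps if_P[OF True] mixed.simps sz.simps sz ar using ne eq m by metis
  next
    case False
    show ?thesis
      unfolding to_bin.simps if_not_P[OF False] mixed.simps sz.simps sz ar using ne eq m by metis
  qed
  then show ?case unfolding ar eq using ne by blast
qed

text \<open>The color of the apex tells which of the two lower sides of the root triangle is
  monochromatic. If that is a polygon side, the root is \<open>LTri\<close> or \<open>RTri\<close>;
  otherwise the triangle behind it has a third corner of the other color and completes a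
  quadrilateral.\<close>

lemma to_bin_complete:
  assumes "mixed c i t" "c i \<noteq> c (i + sz t)"
  shows "\<exists>s. to_bin s = t \<and> word s = side_word c i (sz t)"
  using assms
proof (induction "sz t" arbitrary: i t rule: less_induct)
  case less
  show ?case
  proof (cases t)
    case BLeaf
    then show ?thesis using less.prems by (intro exI[of _ Side]) (simp add: side_word_1)
  next
    case (BNode l r)
    let ?m = "i + sz l"
    have lt: "sz l < sz t" "sz r < sz t" using BNode sz_pos[of l] sz_pos[of r] by simp_all
    have mx: "mixed c i l" "mixed c ?m r" using less.prems(1) BNode by simp_all
    have ne: "c i \<noteq> c (?m + sz r)" using less.prems(2) BNode by (simp add: add.assoc)
    have w: "side_word c i (sz t) = side_word c i (sz l) @ side_word c ?m (sz r)"
      using side_word_add BNode by simp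
    show ?thesis
    proof (cases "c ?m = c i")
      case True
      then have "c ?m \<noteq> c (?m + sz r)" using ne by simp
      from less.hyps[OF lt(2) mx(2) this] obtain s where
        s: "to_bin s = r" "word s = side_word c ?m (sz r)" by blast
      show ?thesis
      proof (cases l)
        case BLeaf
        then show ?thesis using s BNode w True
          by (intro exI[of _ "LTri s"]) (simp add: side_word_1)
      next
        case l: (BNode l1 l2)
        let ?k = "i + sz l1"
        have k: "?m = ?k + sz l2" using l by simp
        have "c i \<noteq> c ?k" "c ?k \<noteq> c (?k + sz l2)" using mx(1) l True by (auto simp: add.assoc)
        moreover have "sz l1 < sz t" "sz l2 < sz t" using lt(1) l by simp_all
        moreover have "mixed c i l1" "mixed c ?k l2" using mx l by simp_all
        ultimately obtain s1 s2 where "to_bin s1 = l1" "word s1 = side_word c i (sz l1)"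
          "to_bin s2 = l2" "word s2 = side_word c ?k (sz l2)"
          using less.hyps[of l1 i] less.hyps[of l2 ?k] by blast
        then show ?thesis using s BNode w l side_word_add[of c i "sz l1" "sz l2"]
          by (intro exI[of _ "Quad False s1 s2 s"]) simp
      qed
    next
      case False
      then have eq: "c ?m = c (?m + sz r)" using ne color_cases by metis
      from less.hyps[OF lt(1) mx(1)] False obtain s where
        s: "to_bin s = l" "word s = side_word c i (sz l)" by metis
      show ?thesis
      proof (cases r)
        case BLeaf
        then show ?thesis using s BNode w eq
          by (intro exI[of _ "RTri s"]) (simp add: side_word_1)
      next
        case r: (BNode r1 r2)
        let ?k = "?m + sz r1"
        have "c ?m \<noteq> c ?k" "c ?k \<noteq> c (?k + sz r2)" using mx(2) r eq by (auto simp: add.assoc)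
        moreover have "sz r1 < sz t" "sz r2 < sz t" using lt(2) r by simp_all
        moreover have "mixed c ?m r1" "mixed c ?k r2" using mx r by simp_all
        ultimately obtain s1 s2 where "to_bin s1 = r1" "word s1 = side_word c ?m (sz r1)"
          "to_bin s2 = r2" "word s2 = side_word c ?k (sz r2)"
          using less.hyps[of r1 ?m] less.hyps[of r2 ?k] by blast
        then show ?thesis using s BNode w r side_word_add[of c ?m "sz r1" "sz r2"]
          by (intro exI[of _ "Quad True s s1 s2"]) simp
      qed
    qed
  qed
qed

lemma count_odd: "odd (length (filter Not (word s)))"
  by (simp add: count_sides)

lemma to_bin_eq_BLeaf: "to_bin s = BLeaf \<longleftrightarrow> s = Side"
  by (cases s) auto

text \<open>Equal words distinguish \<open>LTri Side\<close> from \<open>RTri Side\<close>, which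
  have the same image. Different bits at the root would make the word of one child a concatenation
  of two such words, although each has an odd number of bichromatic sides.\<close>

lemma to_bin_inj: "word s = word s' \<Longrightarrow> to_bin s = to_bin s' \<Longrightarrow> s = s'"
proof (induction s arbitrary: s')
  case Side
  then show ?case using to_bin_eq_BLeaf[of s'] by simp
next
  case (LTri s)
  show ?case
  proof (cases s')
    case Side
    then show ?thesis using LTri.prems by simp
  next
    case (LTri t)
    then show ?thesis using LTri.prems LTri.IH by simp
  next
    case (RTri t)
    then have "s = Side" "t = Side" using LTri.prems(2) to_bin_eq_BLeaf[of s] to_bin_eq_BLeaf[of
      t] by auto
    then show ?thesis using LTri.prems(1) RTri by simp
  next
    case (Quad j a b c)
    then have "a = Side" using LTri.prems(2) to_bin_eq_BLeaf[of a] by (auto split: if_splits)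
    then show ?thesis using LTri.prems(1) Quad by simp
  qed
next
  case (RTri s)
  show ?case
  proof (cases s')
    case Side
    then show ?thesis using RTri.prems by simp
  next
    case (LTri t)
    then have "s = Side" "t = Side" using RTri.prems(2) to_bin_eq_BLeaf[of s] to_bin_eq_BLeaf[of
      t] by auto
    then show ?thesis using RTri.prems(1) LTri by simp
  next
    case (RTri t)
    then show ?thesis using RTri.prems RTri.IH by simp
  next
    case (Quad j a b c)
    then have "c = Side" using RTri.prems(2) to_bin_eq_BLeaf[of c] by (auto split: if_splits)
    then show ?thesis using RTri.prems(1) Quad by (simp flip: append_assoc)
  qed
next
  case (Quad i s1 s2 s3)
  show ?case
  proof (cases s')
    case Side
    then show ?thesis using Quad.prems by (auto split: if_splits)
  next
    case (LTri t)
    then have "s1 = Side" using Quad.prems(2) to_bin_eq_BLeaf[of s1] by (auto split: if_splits)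
    then show ?thesis using Quad.prems(1) LTri by simp
  next
    case (RTri t)
    then have "s3 = Side" using Quad.prems(2) to_bin_eq_BLeaf[of s3] by (auto split: if_splits)
    then show ?thesis using Quad.prems(1) RTri by (simp flip: append_assoc)
  next
    case s': (Quad j t1 t2 t3)
    have no: False
      if eq: "word a @ word b @ word d = word a' @ word b' @ word d'"
        and l: "length (word a') = length (word a) + length (word b)"
      for a b d a' b' d' :: "bool ctree"
    proof -
      have "word a' @ (word b' @ word d') = (word a @ word b) @ word d" using eq by simp
      then have "word a' = word a @ word b" using l by (metis append_eq_append_conv length_append)
      then have "odd (length (filter Not (word a)) + length (filter Not (word b)))"
        using count_odd[of a'] by simp
      then show False using count_odd[of a] count_odd[of b] by simp
    qed
    have wd: "word s1 @ word s2 @ word s3 = word t1 @ word t2 @ word t3" using Quad.prems(1) s'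
      by simp
    have ij: "i = j"
    proof (rule ccontr)
      assume "i \<noteq> j"
      then consider "i" "\<not> j" | "\<not> i" "j" by blast
      then show False
      proof cases
        case 1
        then have "to_bin s1 = BNode (to_bin t1) (to_bin t2)" using Quad.prems(2) s' by simp
        then have "length (word s1) = length (word t1) + length (word t2)"
          by (metis sz.simps(2) sz_to_bin)
        then show False using no wd by metis
      next
        case 2
        then have "to_bin t1 = BNode (to_bin s1) (to_bin s2)" using Quad.prems(2) s' by simp
        then have "length (word t1) = length (word s1) + length (word s2)"
          by (metis sz.simps(2) sz_to_bin)
        then show False using no wd by metis
      qed
    qed
    then have b: "to_bin s1 = to_bin t1" "to_bin s2 = to_bin t2" "to_bin s3 = to_bin t3"
      using Quad.prems(2) s' by (auto split: if_splits)
    then have "length (word s1) = length (word t1)" "length (word s2) = length (word t2)"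
      using sz_to_bin by metis+
    then have "word s1 = word t1" "word s2 = word t2" "word s3 = word t3" using wd by auto
    then show ?thesis using Quad.IH b ij s' by simp
  qed
qed

section \<open>The side word of a coloring sequence\<close>

fun other :: "color \<Rightarrow> color" where
  "other Red = Blue"
| "other Blue = Red"

fun color_runs :: "color \<Rightarrow> nat list \<Rightarrow> color list" where
  "color_runs k [] = []"
| "color_runs k (a # as) = replicate a k @ color_runs (other k) as"

lemma color_word_eq: "color_word \<alpha> = color_runs Red \<alpha>"
proof -
  have "concat (map (\<lambda>i. replicate (\<alpha> ! i) (if even i then k else other k)) [0..<length \<alpha>]) =
    color_runs k \<alpha>"
    for k
  proof (induction \<alpha> arbitrary: k)
    case (Cons a as)
    let ?f = "\<lambda>i. replicate ((a # as) ! i) (if even i then k else other k)"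
    have oo: "other (other k) = k" by (cases k) auto
    have split: "[0..<length (a # as)] = 0 # map Suc [0..<length as]"
      by (simp add: upt_conv_Cons map_Suc_upt del: upt_Suc)
    have shift: "map (?f \<circ> Suc) [0..<length as] =
        map (\<lambda>i. replicate (as ! i) (if even i then other k else other (other k))) [0..<length as]"
      using oo by auto
    show ?case
      unfolding split list.map(2) map_map shift concat.simps Cons.IH by simp
  qed simp
  from this[of Red] show ?thesis unfolding color_word_def other.simps .
qed

fun eqs :: "'a list \<Rightarrow> bool list" where
  "eqs (x # y # zs) = (x = y) # eqs (y # zs)"
| "eqs _ = []"

lemma length_eqs: "length (eqs xs) = length xs - 1"
  by (induction xs rule: eqs.induct) auto

lemma nth_eqs: "Suc j < length xs \<Longrightarrow> eqs xs ! j = (xs ! j = xs ! Suc j)"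
proof (induction xs arbitrary: j rule: eqs.induct)
  case (1 x y zs)
  then show ?case by (cases j) auto
qed auto

lemma eqs_replicate: "eqs (replicate (Suc n) k) = replicate n True"
  by (induction n) auto

lemma eqs_replicate_append: "eqs (replicate (Suc n) k @ y # ys) = replicate n True @ (k =
  y) # eqs (y # ys)"
  by (induction n) auto

lemma eqs_color_runs:
  "(\<forall>a\<in>set \<alpha>. 1 \<le> a) \<Longrightarrow> eqs (color_runs k \<alpha>) = runs (map (\<lambda>a. a - 1) \<alpha>)"
proof (induction "map (\<lambda>a. a - 1) \<alpha>" arbitrary: \<alpha> k rule: runs.induct)
  case (2 b)
  then obtain a where "\<alpha> = [a]" "b = a - 1" by auto
  then show ?case using 2 eqs_replicate[of "a - 1" k] by simp
next
  case (3 b c bs)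
  from 3(2) obtain a \<beta> where "\<alpha> = a # \<beta>" "map (\<lambda>a. a - 1) \<beta> = c # bs" by (cases \<alpha>) auto
  then obtain a' as where \<alpha>: "\<alpha> = a # a' # as" by (cases \<beta>) auto
  have a: "1 \<le> a" "1 \<le> a'" using 3(3) \<alpha> by auto
  have IH: "eqs (color_runs (other k) (a' # as)) = runs (map (\<lambda>a. a - 1) (a' # as))"
    by (rule 3(1)) (use 3(2,3) \<alpha> in simp_all)
  have "color_runs (other k) (a' # as) = other k # (replicate (a' - 1) (other k) @
    color_runs (other (other k)) as)"
    using a(2) by (cases a') auto
  moreover have "k \<noteq> other k" by (cases k) auto
  ultimately have "eqs (replicate (Suc (a - 1)) k @ color_runs (other k) (a' # as)) =
      replicate (a - 1) True @ False # eqs (color_runs (other k) (a' # as))"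
    using eqs_replicate_append[of "a - 1" k "other k"] by simp
  then show ?case using a \<alpha> IH by simp
qed simp

lemma length_color_runs: "length (color_runs k \<alpha>) = sum_list \<alpha>"
  by (induction \<alpha> arbitrary: k) auto

lemma hd_color_runs: "\<forall>a\<in>set \<alpha>. 1 \<le> a \<Longrightarrow> \<alpha> \<noteq> [] \<Longrightarrow> hd (color_runs k \<alpha>) = k"
  by (cases \<alpha>) auto

lemma last_color_runs:
  "\<forall>a\<in>set \<alpha>. 1 \<le> a \<Longrightarrow> \<alpha> \<noteq> [] \<Longrightarrow> last (color_runs k \<alpha>) = (if even (length \<alpha>) then other k else k)"
proof (induction \<alpha> arbitrary: k)
  case (Cons a as)
  have oo: "other (other k) = k" by (cases k) auto
  show ?case
  proof (cases "as = []")
    case True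
    then show ?thesis using Cons.prems by simp
  next
    case False
    then have "color_runs (other k) as \<noteq> []" using Cons.prems by (cases as) auto
    then show ?thesis using Cons.IH[of "other k"] Cons.prems False oo by simp
  qed
qed simp

lemma side_word_point_color:
  assumes "\<forall>a\<in>set \<alpha>. 1 \<le> a"
  shows "side_word (point_color \<alpha>) 1 (sum_list \<alpha> - 1) = runs (map (\<lambda>a. a - 1) \<alpha>)"
proof -
  have "side_word (point_color \<alpha>) 1 (sum_list \<alpha> - 1) = eqs (color_runs Red \<alpha>)"
  proof (rule nth_equalityI)
    show "length (side_word (point_color \<alpha>) 1 (sum_list \<alpha> - 1)) = length (eqs (color_runs Red \<alpha>))"
      by (simp add: length_eqs length_color_runs)
  next
    fix j assume "j < length (side_word (point_color \<alpha>) 1 (sum_list \<alpha> - 1))"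
    then have j: "j < sum_list \<alpha> - 1" by simp
    then show "side_word (point_color \<alpha>) 1 (sum_list \<alpha> - 1) ! j = eqs (color_runs Red \<alpha>) ! j"
      using nth_eqs[of j "color_runs Red \<alpha>"]
      by (simp add: side_word_def point_color_def color_word_eq length_color_runs)
  qed
  then show ?thesis using eqs_color_runs[OF assms] by simp
qed

lemma count_runs: "bs \<noteq> [] \<Longrightarrow> length (filter Not (runs bs)) = length bs - 1"
  by (induction bs rule: runs.induct) auto

section \<open>The Hamilton cycle\<close>

text \<open>Arcs are the pairs of their end points, so a walk is its vertex list zipped with the
  shifted list; \<open>z = x\<close> closes it to a cycle.\<close>

lemma closed_walk:
  assumes "tail G = fst" "head G = snd"
  shows "pre_digraph.cas G x (zip (x # ys) (ys @ [z])) z"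
    and "pre_digraph.awalk_verts G x (zip (x # ys) (ys @ [z])) = x # ys @ [z]"
  using assms
  by (induction ys arbitrary: x) (auto simp: pre_digraph.cas.simps pre_digraph.awalk_verts.simps)

lemma set_closed_walk:
  "successively E (x # ys) \<Longrightarrow> E (last (x # ys)) z \<Longrightarrow> (a, b) \<in> set (zip (x # ys) (ys @ [z])) \<Longrightarrow>
    E a b \<and> a \<in> set (x # ys) \<and> b \<in> set (ys @ [z])"
proof (induction ys arbitrary: x)
  case (Cons y ys)
  then show ?case by auto
qed auto

theorem theorem2:
  fixes \<alpha> :: "nat list"
  assumes "coloring_sequence \<alpha>" and "length \<alpha> \<ge> 10"
  shows "\<exists>p. hamilton_cycle (colorful_flip_graph \<alpha>) p"
proof -
  let ?N = "sum_list \<alpha>" and ?c = "point_color \<alpha>"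
  let ?bs = "map (\<lambda>a. a - 1) \<alpha>"
  define w where "w = runs ?bs"
  define V where "V = {T. triangulation ?N T \<and> colorful \<alpha> T}"
  define g where "g s = tri ?N (to_bin s)" for s
  have pos: "\<forall>a\<in>set \<alpha>. 1 \<le> a" and ev: "even (length \<alpha>)" and ne: "\<alpha> \<noteq> []"
    using assms by (auto simp: coloring_sequence_def)
  have "length \<alpha> \<le> ?N" using pos by (induction \<alpha>) auto
  then have N: "2 \<le> ?N" using assms(2) by simp
  have w: "side_word ?c 1 (?N - 1) = w" unfolding w_def by (rule side_word_point_color[OF pos])
  have len: "length w = ?N - 1" using length_side_word[of ?c 1 "?N - 1"] unfolding w .
  have "0 < length (color_runs Red \<alpha>)" using N unfolding length_color_runs by linarith
  then have "color_runs Red \<alpha> \<noteq> []" by blast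
  \<comment> \<open>The even length makes the last class blue, so the root side between the points 1
    and \<open>?N\<close> is bichromatic, as the tree model requires.\<close>
  then have ends: "?c 1 \<noteq> ?c ?N"
    using hd_color_runs[OF pos ne, of Red] last_color_runs[OF pos ne, of Red] ev
    by (simp add: point_color_def color_word_eq hd_conv_nth last_conv_nth length_color_runs)
  have size: "sz (to_bin s) + 1 = ?N" if "word s = w" for s using that len N by simp
  have img: "g ` {s. word s = w} = V"
  proof (intro set_eqI iffI)
    fix T assume "T \<in> g ` {s. word s = w}"
    then obtain s where s: "word s = w" "T = g s" by blast
    have "word s = side_word ?c 1 (length (word s))" using s(1) w len by simp
    then have "mixed ?c 1 (to_bin s)" using mixed_to_bin by blast
    then show "T \<in> V"
      using s size[OF s(1)] triangulation_tri colorful_tri unfolding V_def g_def by blast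
  next
    fix T assume T: "T \<in> V"
    then obtain t where t: "sz t + 1 = ?N" "tri ?N t = T"
      using triangulation_ex_tree[OF _ N] unfolding V_def by blast
    then have "mixed ?c 1 t" using T colorful_tri unfolding V_def by blast
    moreover have "?c 1 \<noteq> ?c (1 + sz t)" using ends t(1) by simp
    ultimately obtain s where "to_bin s = t" "word s = side_word ?c 1 (sz t)"
      using to_bin_complete by blast
    moreover have "sz t = ?N - 1" using t(1) by simp
    ultimately show "T \<in> g ` {s. word s = w}" using t(2) w unfolding g_def by auto
  qed
  have inj: "inj_on g {s. word s = w}"
  proof (rule inj_onI)
    fix s s' assume "s \<in> {s. word s = w}" "s' \<in> {s. word s = w}" "g s = g s'"
    then show "s = s'" using tri_inj[of ?N "to_bin s" "to_bin s'"] size to_bin_inj[of s s']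
      unfolding g_def by simp
  qed
  have "spanned w" unfolding w_def using assms(2) ev by (intro spanned_runs) auto
  moreover have "9 \<le> length (filter Not w)"
    unfolding w_def using count_runs[of ?bs] assms(2) ne by simp
  ultimately obtain xs u v where xs: "hpath tflip {s. word s =
    w} xs u v" "tflip v u" "3 \<le> length xs"
    using ctree_hamilton by blast
  define E where "E S T \<longleftrightarrow> S \<in> V \<and> T \<in> V \<and> flip ?N S T" for S T
  have fl: "E (g s) (g s')" if "s \<in> set xs" "s' \<in> set xs" "tflip s s'" for s s'
  proof -
    have ws: "word s = w" "word s' = w" using that xs(1) by (auto simp: hpath_def)
    have "flip ?N (g s) (g s')"
      unfolding g_def using that(3) size[OF ws(1)] by (intro rot_flip) (simp_all add: tflip_def)
    moreover have "g s \<in> V" "g s' \<in> V" using ws img by blast+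
    ultimately show ?thesis by (simp add: E_def)
  qed
  obtain y ys where ys: "map g xs = y # ys" using xs(3) by (cases "map g xs") auto
  have "successively (\<lambda>s s'. E (g s) (g s')) xs"
    using xs(1) unfolding hpath_def by (auto elim!: successively_mono intro: fl)
  then have succ: "successively E (y # ys)" by (simp flip: ys add: successively_map)
  have xs_ne: "xs \<noteq> []" using xs(3) by auto
  have hl: "last xs = v" "hd xs = u" using xs(1) by (auto simp: hpath_def)
  have "E (g v) (g u)" using fl[of v u] xs hl xs_ne last_in_set hd_in_set by metis
  moreover have "last (map g xs) = g v" "hd (map g xs) = g u"
    using hl xs_ne by (simp_all add: last_map hd_map)
  then have "last (y # ys) = g v" "y = g u" by (simp_all only: ys list.sel)
  ultimately have cl: "E (last (y # ys)) y" by (simp only:)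
  have setV: "set (y # ys) = V" using xs(1) img by (simp flip: ys add: hpath_def)
  have dist: "distinct (y # ys)" using xs(1) inj by (simp flip: ys add: hpath_def distinct_map)
  let ?G = "colorful_flip_graph \<alpha>" and ?p = "zip (y # ys) (ys @ [y])"
  have G: "verts ?G = V" "tail ?G = fst" "head ?G = snd" and arcs: "arcs ?G = {(S, T). E S T}"
    by (auto simp: colorful_flip_graph_def associahedron_def V_def E_def)
  have "pre_digraph.awalk ?G y ?p y"
    unfolding pre_digraph.awalk_def using closed_walk(1)[OF G(2,3)] set_closed_walk[OF succ cl] setV
    by (auto simp: G arcs)
  moreover have "distinct (tl (pre_digraph.awalk_verts ?G y ?p))"
    using dist by (simp add: closed_walk(2)[OF G(2,3)])
  ultimately have "pre_digraph.cycle ?G ?p"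
    unfolding pre_digraph.cycle_def by auto
  moreover have "length (y # ys) = length xs" by (simp flip: ys)
  then have "3 \<le> length ?p" using xs(3) by simp
  moreover have "tail ?G ` set ?p = verts ?G"
  proof -
    have "map fst ?p = y # ys" by simp
    then show ?thesis using setV G by (metis list.set_map)
  qed
  ultimately show ?thesis unfolding hamilton_cycle_def by blast
qed

end
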